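(* Let $(\bar x,\bar y)$ be a local minimizer of the bilevel program (BP). Suppose that the feasible map $\mathcal F(x)=\{y:g(x,y)\le0\}$ is RCR-regular at $(\bar x,\bar y)$ and $S(x)$ is inner semi-continuous at $(\bar x,\bar y)$ in direction $u$. Then the value function $V$ is directionally Lipschitz continuous and directionally differentiable at $\bar x$ in direction $u$ and $V'(\bar x;u)=\max_{\lambda\in\Lambda(\bar x,\bar y)}\nabla_x\mathcal L(\bar x,\bar y;\lambda)u$. Suppose that there exists $v$ such that $(u,v)\in C(\bar x,\bar y)$. Furthermore suppose that there exists no nonzero vector $(\alpha,\nu_g,\nu_G)$ satisfying $$0\in\alpha\nabla f(\bar x,\bar y)-\alpha W(\bar x,\bar y,u,v)\times\{0\}+\nabla g(\bar x,\bar y)^T\nu_g+\nabla G(\bar x,\bar y)^T\nu_G,$$ $$\alpha\ge0,\ 0\le\nu_g\perp g(\bar x,\bar y),\ \nu_g\perp\nabla g(\bar x,\bar y)(u,v),\ 0\le\nu_G\perp G(\bar x,\bar y),\ \nu_G\perp\nabla G(\bar x,\bar y)(u,v),$$ where $W(\bar x,\bar y,u,v):=\{\nabla_xf(\bar x,\bar y)+\nabla_xg(\bar x,\bar y)^T\lambda:\lambda\in\Lambda(\bar x,\bar y)\cap\{\nabla g(\bar x,\bar y)(u,v)\}^\perp\}$, and for which there exist sequences $t_k\downarrow0$, $(u^k,v^k)\to(u,v)$ such that $\alpha(f(\bar x+t_ku^k,\bar y+t_kv^k)-V(\bar x+t_ku^k))>0$ if $\alpha>0$; $g_i(\bar x+t_ku^k,\bar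 y+t_kv^k)>0$ if $(\nu_g)_i>0$, $i\in I_g(\bar x,\bar y)$; and $G_i(\bar x+t_ku^k,\bar y+t_kv^k)>0$ if $(\nu_G)_i>0$, $i\in I_G(\bar x,\bar y)$. Then there exists a vector $(\lambda^V,\lambda_g,\lambda_G,\lambda)\in\mathbb R^{1+p+q+p}$ satisfying $$0=\nabla_xF(\bar x,\bar y)-\lambda^V\nabla_xg(\bar x,\bar y)^T\lambda+\nabla_xg(\bar x,\bar y)^T\lambda_g+\nabla_xG(\bar x,\bar y)^T\lambda_G,$$ $$0=\nabla_yF(\bar x,\bar y)+\lambda^V\nabla_yf(\bar x,\bar y)+\nabla_yg(\bar x,\bar y)^T\lambda_g+\nabla_yG(\bar x,\bar y)^T\lambda_G,$$ $$\lambda^V\ge0,\ 0\le\lambda_g\perp g(\bar x,\bar y),\ \lambda_g\perp\nabla g(\bar x,\bar y)(u,v),\ 0\le\lambda_G\perp G(\bar x,\bar y),\ \lambda_G\perp\nabla G(\bar x,\bar y)(u,v),$$ $$0=\nabla_yf(\bar x,\bar y)+\nabla_yg(\bar x,\bar y)^T\lambda,\quad0\le\lambda\perp g(\bar x,\bar y),\quad\lambda\perp\nabla g(\bar x,\bar y)(u,v).$$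
   Context: Let $F,f:\mathbb R^n\times\mathbb R^m\to\mathbb R$, $G:\mathbb R^n\times\mathbb R^m\to\mathbb R^q$, $g:\mathbb R^n\times\mathbb R^m\to\mathbb R^p$ be continuously differentiable. Let $S(x)$ be the set of optimal solutions of the lower level problem $\min_y f(x,y)$ s.t. $g(x,y)\le0$, and $V(x)=\inf_y\{f(x,y):g(x,y)\le0\}$. (BP): $\min_{x,y}F(x,y)$ s.t. $y\in S(x)$, $G(x,y)\le0$. $I_g(x,y)=\{i:g_i(x,y)=0\}$, $I_G(x,y)=\{i:G_i(x,y)=0\}$; $\mathcal L(x,y;\lambda)=f(x,y)+g(x,y)^T\lambda$; $\Lambda(x,y)=\{\lambda\in\mathbb R^p:\nabla_y\mathcal L(x,y;\lambda)=0,\ g(x,y)^T\lambda=0,\ \lambda\ge0\}$; $\{w\}^\perp$ is the orthogonal complement of $w$. $\mathbb B$ is the open unit ball. For a direction $d$ and $\epsilon,\delta>0$: $\mathcal V_{\epsilon,\delta}(d):=\{z\in\epsilon\mathbb B : \big\|\,\|d\|z-\|z\|d\,\big\|\le\delta\|z\|\|d\|\}$. $V'(\bar x;u)=\lim_{t\downarrow0}(V(\bar x+tu)-V(\bar x))/t$; $V$ is directionally differentiable at $\bar x$ in direction $u$ if this limit exists. $V$ is directionally Lipschitz continuous at $\bar x$ in direction $u$ if there are $L,\epsilon,\delta>0$ such that $V$ is finite and $|V(x)-V(x')|\le L\|x-x'\|$ for all $x,x'\in\bar x+\mathcal V_{\epsilon,\delta}(u)$. $(u,v)\in C(\bar x,\bar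 y)$ (critical cone) means $\nabla f(\bar x,\bar y)(u,v)\le V'(\bar x;u)$, $\nabla g_i(\bar x,\bar y)(u,v)\le0$ for $i\in I_g(\bar x,\bar y)$, $\nabla G_i(\bar x,\bar y)(u,v)\le0$ for $i\in I_G(\bar x,\bar y)$, and $\nabla F(\bar x,\bar y)(u,v)\le0$. RCR regularity of $\mathcal F$ at $(\bar x,\bar y)$ with $\bar y\in\mathcal F(\bar x)$: there is $\delta>0$ such that for any $K\subseteq I_g(\bar x,\bar y)$ the family $\{\nabla_yg_j(x,y)\}_{j\in K}$ has the same rank at all $(x,y)$ in the open ball of radius $\delta$ about $(\bar x,\bar y)$. Directional inner semi-continuity: for $\bar y\in S(\bar x)$, $S$ is inner semi-continuous at $(\bar x,\bar y)$ in direction $u$ if for any sequences $t_k\downarrow0$, $u^k\to u$, there exists a sequence $y^k\in S(\bar x+t_ku^k)$ converging to $\bar y$. *)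

theory Defs
  imports "HOL-Analysis.Analysis"
begin

section \<open>Derivatives\<close>

definition cont_differentiable ::
    "('a::real_normed_vector \<Rightarrow> 'b::real_normed_vector) \<Rightarrow> bool" where
  "cont_differentiable \<phi> \<longleftrightarrow>
     (\<exists>\<phi>'. (\<forall>z. (\<phi> has_derivative blinfun_apply (\<phi>' z)) (at z)) \<and> continuous_on UNIV \<phi>')"

definition gradient :: "('a::real_inner \<Rightarrow> real) \<Rightarrow> 'a \<Rightarrow> 'a" where
  "gradient \<phi> a = (THE D. GDERIV \<phi> a :> D)"

definition grad_x :: "('a::real_inner \<times> 'b \<Rightarrow> real) \<Rightarrow> 'a \<times> 'b \<Rightarrow> 'a" where
  "grad_x \<phi> z = gradient (\<lambda>x. \<phi> (x, snd z)) (fst z)"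

definition grad_y :: "('a \<times> 'b::real_inner \<Rightarrow> real) \<Rightarrow> 'a \<times> 'b \<Rightarrow> 'b" where
  "grad_y \<phi> z = gradient (\<lambda>y. \<phi> (fst z, y)) (snd z)"

text \<open>The Jacobian of a map on a product space is used as the linear map
  \<open>frechet_derivative \<phi> (at z)\<close>; its transpose is the adjoint.\<close>

definition jac_tr ::
    "('a::euclidean_space \<Rightarrow> 'c::euclidean_space) \<Rightarrow> 'a \<Rightarrow> 'c \<Rightarrow> 'a" where
  "jac_tr \<phi> z = adjoint (frechet_derivative \<phi> (at z))"

definition jac_x_tr ::
    "('a::euclidean_space \<times> 'b \<Rightarrow> 'c::euclidean_space) \<Rightarrow> 'a \<times> 'b \<Rightarrow> 'c \<Rightarrow> 'a" where
  "jac_x_tr \<phi> z = jac_tr (\<lambda>x. \<phi> (x, snd z)) (fst z)"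

definition jac_y_tr ::
    "('a \<times> 'b::euclidean_space \<Rightarrow> 'c::euclidean_space) \<Rightarrow> 'a \<times> 'b \<Rightarrow> 'c \<Rightarrow> 'b" where
  "jac_y_tr \<phi> z = jac_tr (\<lambda>y. \<phi> (fst z, y)) (snd z)"


section \<open>The bilevel program\<close>

text \<open>Inequalities between vectors of type \<open>real ^ 'p\<close> are componentwise.\<close>

definition feas_map :: "('a \<times> 'b \<Rightarrow> real ^ 'p) \<Rightarrow> 'a \<Rightarrow> 'b set" where
  "feas_map g x = {y. g (x, y) \<le> 0}"

definition sol_map :: "('a \<times> 'b \<Rightarrow> real) \<Rightarrow> ('a \<times> 'b \<Rightarrow> real ^ 'p) \<Rightarrow> 'a \<Rightarrow> 'b set" where
  "sol_map f g x = {y. is_arg_min (\<lambda>y. f (x, y)) (\<lambda>y. y \<in> feas_map g x) y}"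

text \<open>The value function is extended real valued: it is \<open>\<infinity>\<close> where the lower level is
  infeasible and \<open>-\<infinity>\<close> where it is unbounded.\<close>

definition val_fun :: "('a \<times> 'b \<Rightarrow> real) \<Rightarrow> ('a \<times> 'b \<Rightarrow> real ^ 'p) \<Rightarrow> 'a \<Rightarrow> ereal" where
  "val_fun f g x = (INF y\<in>feas_map g x. ereal (f (x, y)))"

definition bp_feasible ::
    "('a \<times> 'b \<Rightarrow> real) \<Rightarrow> ('a \<times> 'b \<Rightarrow> real ^ 'q) \<Rightarrow> ('a \<times> 'b \<Rightarrow> real ^ 'p) \<Rightarrow> ('a \<times> 'b) set" where
  "bp_feasible f G g = {(x, y). y \<in> sol_map f g x \<and> G (x, y) \<le> 0}"

definition bp_local_minimizer ::
    "('a::metric_space \<times> 'b::metric_space \<Rightarrow> real) \<Rightarrow> ('a \<times> 'b \<Rightarrow> real) \<Rightarrow>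
     ('a \<times> 'b \<Rightarrow> real ^ 'q) \<Rightarrow> ('a \<times> 'b \<Rightarrow> real ^ 'p) \<Rightarrow> 'a \<times> 'b \<Rightarrow> bool" where
  "bp_local_minimizer F f G g z \<longleftrightarrow>
     z \<in> bp_feasible f G g \<and>
     (\<exists>\<epsilon>>0. \<forall>z'\<in>bp_feasible f G g \<inter> ball z \<epsilon>. F z \<le> F z')"

definition active :: "('z \<Rightarrow> real ^ 'p) \<Rightarrow> 'z \<Rightarrow> 'p set" where
  "active g z = {i. g z $ i = 0}"

definition lagrangian ::
    "('z \<Rightarrow> real) \<Rightarrow> ('z \<Rightarrow> real ^ 'p) \<Rightarrow> real ^ 'p \<Rightarrow> 'z \<Rightarrow> real" where
  "lagrangian f g lam z = f z + g z \<bullet> lam"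

definition multipliers ::
    "('a \<times> 'b::real_inner \<Rightarrow> real) \<Rightarrow> ('a \<times> 'b \<Rightarrow> real ^ 'p) \<Rightarrow> 'a \<times> 'b \<Rightarrow> (real ^ 'p) set" where
  "multipliers f g z = {lam. grad_y (lagrangian f g lam) z = 0 \<and> g z \<bullet> lam = 0 \<and> 0 \<le> lam}"


section \<open>Directional notions\<close>

definition dir_nbhd :: "real \<Rightarrow> real \<Rightarrow> 'a::real_normed_vector \<Rightarrow> 'a set" where
  "dir_nbhd \<epsilon> \<delta> d =
     {z \<in> ball 0 \<epsilon>. norm (norm d *\<^sub>R z - norm z *\<^sub>R d) \<le> \<delta> * norm z * norm d}"

definition dir_quotient ::
    "('a::real_normed_vector \<Rightarrow> ereal) \<Rightarrow> 'a \<Rightarrow> 'a \<Rightarrow> real \<Rightarrow> ereal" where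
  "dir_quotient V x u t = (V (x + t *\<^sub>R u) - V x) / ereal t"

definition dir_deriv :: "('a::real_normed_vector \<Rightarrow> ereal) \<Rightarrow> 'a \<Rightarrow> 'a \<Rightarrow> ereal" where
  "dir_deriv V x u = Lim (at_right 0) (dir_quotient V x u)"

definition dir_differentiable ::
    "('a::real_normed_vector \<Rightarrow> ereal) \<Rightarrow> 'a \<Rightarrow> 'a \<Rightarrow> bool" where
  "dir_differentiable V x u \<longleftrightarrow>
     (\<exists>d::real. (dir_quotient V x u \<longlongrightarrow> ereal d) (at_right 0))"

definition dir_lipschitz ::
    "('a::real_normed_vector \<Rightarrow> ereal) \<Rightarrow> 'a \<Rightarrow> 'a \<Rightarrow> bool" where
  "dir_lipschitz V x u \<longleftrightarrow>
     (\<exists>L>0. \<exists>\<epsilon>>0. \<exists>\<delta>>0.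
        (\<forall>x1\<in>(+) x ` dir_nbhd \<epsilon> \<delta> u. \<bar>V x1\<bar> \<noteq> \<infinity>) \<and>
        (\<forall>x1\<in>(+) x ` dir_nbhd \<epsilon> \<delta> u. \<forall>x2\<in>(+) x ` dir_nbhd \<epsilon> \<delta> u.
           \<bar>V x1 - V x2\<bar> \<le> ereal (L * norm (x1 - x2))))"

text \<open>As usual for limits along sequences, the selection \<open>y k\<close> is required to lie in
  the image set for all large \<open>k\<close> only.  Demanding it for every \<open>k\<close> would force
  nonempty values on the whole space, since \<open>t\<close> and \<open>w\<close> may start anywhere.\<close>

definition dir_inner_semicontinuous ::
    "('a::real_normed_vector \<Rightarrow> 'b::topological_space set) \<Rightarrow> 'a \<Rightarrow> 'b \<Rightarrow> 'a \<Rightarrow> bool" where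
  "dir_inner_semicontinuous S x y u \<longleftrightarrow>
     y \<in> S x \<and>
     (\<forall>t w. (\<forall>k. 0 < t k) \<and> t \<longlonglongrightarrow> 0 \<and> w \<longlonglongrightarrow> u \<longrightarrow>
        (\<exists>yk. (\<forall>\<^sub>F k in sequentially. yk k \<in> S (x + t k *\<^sub>R w k)) \<and> yk \<longlonglongrightarrow> y))"

definition rcr_regular ::
    "('a::metric_space \<times> 'b::euclidean_space \<Rightarrow> real ^ 'p) \<Rightarrow> 'a \<times> 'b \<Rightarrow> bool" where
  "rcr_regular g z \<longleftrightarrow>
     snd z \<in> feas_map g (fst z) \<and>
     (\<exists>\<delta>>0. \<forall>K\<subseteq>active g z. \<exists>r.
        \<forall>z'\<in>ball z \<delta>. dim ((\<lambda>j. grad_y (\<lambda>z. g z $ j) z') ` K) = r)"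

definition critical_cone ::
    "('a::real_normed_vector \<times> 'b::real_normed_vector \<Rightarrow> real) \<Rightarrow> ('a \<times> 'b \<Rightarrow> real) \<Rightarrow>
     ('a \<times> 'b \<Rightarrow> real ^ 'q) \<Rightarrow> ('a \<times> 'b \<Rightarrow> real ^ 'p) \<Rightarrow> 'a \<times> 'b \<Rightarrow> ('a \<times> 'b) set" where
  "critical_cone F f G g z = {(u, v).
     ereal (frechet_derivative f (at z) (u, v)) \<le> dir_deriv (val_fun f g) (fst z) u \<and>
     (\<forall>i\<in>active g z. frechet_derivative g (at z) (u, v) $ i \<le> 0) \<and>
     (\<forall>i\<in>active G z. frechet_derivative G (at z) (u, v) $ i \<le> 0) \<and>
     frechet_derivative F (at z) (u, v) \<le> 0}"

definition W_set ::
    "('a::euclidean_space \<times> 'b::real_inner \<Rightarrow> real) \<Rightarrow> ('a \<times> 'b \<Rightarrow> real ^ 'p) \<Rightarrow>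
     'a \<times> 'b \<Rightarrow> 'a \<times> 'b \<Rightarrow> 'a set" where
  "W_set f g z d =
     {grad_x f z + jac_x_tr g z lam | lam.
        lam \<in> multipliers f g z \<inter> orthogonal_comp {frechet_derivative g (at z) d}}"

end

theory Submission
  imports Defs
begin

text \<open>
  Constant rank makes multipliers with independent support locally bounded, and applied to the
  projection onto the lower level feasible set with a subset \<open>K\<close> of the active constraints turned
  into equations it gives a local error bound, uniform in \<open>K\<close>.  Comparing solutions at nearby
  parameters through points where the constraints in the support \<open>K\<close> of a multiplier hold with
  equality turns the multiplier into first order lower and upper expansions of \<open>V\<close>.  Hence
  \<open>V\<close> is directionally Lipschitz with the asserted derivative, and limits of multipliers along
  the direction \<open>u\<close> are maximisers, so they are orthogonal to \<open>\<nabla>g(u,v)\<close>.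

  At a local minimiser of a smooth function plus the Euclidean norm of the violations of
  \<open>f - V \<le> 0\<close>, \<open>g \<le> 0\<close>, \<open>G \<le> 0\<close>, the lower expansions of \<open>V\<close> bound its lower Dini
  derivatives; in the limit, separation from a compact convex set of multipliers yields a
  stationarity equation.  If no error bound held along \<open>(u,v)\<close>, minimising the violation near
  badly approximable points would give an abnormal multiplier of norm one whose positive entries
  belong to violated constraints, which is excluded.  So the violation is an exact penalty along
  \<open>(u,v)\<close>, and minimising the penalised objective near the points \<open>z + t (u,v)\<close> gives the
  multipliers of the theorem.
\<close>

section \<open>Constant rank and Karush--Kuhn--Tucker multipliers\<close>

text \<open>For the lower level nothing beyond constant rank is assumed, so two standard tools fail:
  the multiplier set may be unbounded, and perturbed constraint systems need not be solvable. The
  first is met by always selecting one multiplier of controlled size (\<open>R_mult\<close>), which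
  makes the multiplier sets used later compact; the second by letting the error bound presuppose a
  point in the perturbed system, the witness being a lower level solution. \<open>V\<close> is
  controlled only on a thin cone of points along \<open>u\<close>, with \<open>x0\<close> at its
  apex, so no subdifferential at \<open>x0\<close> is at hand. Stationarity is therefore tested one
  direction (a,b) at a time; the multiplier found depends on (a,b), and only its affine role
  together with separation produces a single one. The auxiliary minimisations run over balls of
  radius o(t) about points z0 + t w with w near (u,v), with a quadratic term whose value on the
  sphere beats the possible decrease: minimisers are then interior, the additional gradient tends to
  0, and the rescaled displacements still converge to (u,v).\<close>

definition comb :: "('i::finite \<Rightarrow> 'b::real_vector) \<Rightarrow> real ^ 'i \<Rightarrow> 'b" where
  "comb A c = (\<Sum>i\<in>UNIV. c $ i *\<^sub>R A i)"

text \<open>Independence of a family, not of a set: a repeated vector counts as dependent.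
  Coefficients live in the full space and vanish off \<open>J\<close>, so that families at different
  points can be compared with one fixed \<open>J\<close>.\<close>

definition indep_family :: "('i::finite \<Rightarrow> 'b::real_vector) \<Rightarrow> 'i set \<Rightarrow> bool" where
  "indep_family A J \<longleftrightarrow> (\<forall>c. (\<forall>i. i \<notin> J \<longrightarrow> c $ i = 0) \<and> comb A c = 0 \<longrightarrow> c = 0)"

section \<open>Linear combinations and their reduction to independent subfamilies\<close>

lemma comb_add: "comb A (c + d) = comb A c + comb A d"
  by (simp add: comb_def scaleR_add_left sum.distrib)

lemma comb_scaleR: "comb A (r *\<^sub>R c) = r *\<^sub>R comb A c"
  by (simp add: comb_def scaleR_sum_right)

lemma comb_diff: "comb A (c - d) = comb A c - comb A d"
  by (simp add: comb_def scaleR_diff_left sum_subtractf)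

lemma linear_comb: "linear (comb A)"
  by (intro linearI) (simp_all add: comb_add comb_scaleR)

lemma inner_comb: "comb A c \<bullet> w = (\<Sum>i\<in>UNIV. c $ i * (A i \<bullet> w))"
  by (simp add: comb_def inner_sum_left)

lemma fst_comb: "fst (comb A c) = comb (\<lambda>i. fst (A i)) c"
  by (simp add: comb_def fst_sum)

lemma snd_comb: "snd (comb A c) = comb (\<lambda>i. snd (A i)) c"
  by (simp add: comb_def snd_sum)

lemma tendsto_comb:
  fixes A :: "'k \<Rightarrow> 'i::finite \<Rightarrow> 'b::real_normed_vector"
  assumes "\<And>i. ((\<lambda>k. A k i) \<longlongrightarrow> A0 i) \<F>" and "(c \<longlongrightarrow> c0) \<F>"
  shows "((\<lambda>k. comb (A k) (c k)) \<longlongrightarrow> comb A0 c0) \<F>"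
  unfolding comb_def by (intro tendsto_intros assms)

text \<open>Conic Caratheodory reduction with signs: as long as the support is dependent, a multiple
  of a dependency is subtracted that kills an entry without reversing the sign of any other
  one.\<close>

lemma comb_reduce:
  fixes c :: "real ^ 'i"
  shows "\<exists>c'. (\<forall>i. 0 \<le> c' $ i * c $ i) \<and> (\<forall>i. c $ i = 0 \<longrightarrow> c' $ i = 0) \<and>
    comb A c' = comb A c \<and> indep_family A {i. c' $ i \<noteq> 0}"
proof (induction "card {i. c $ i \<noteq> 0}" arbitrary: c rule: less_induct)
  case less
  show ?case
  proof (cases "indep_family A {i. c $ i \<noteq> 0}")
    case True
    then show ?thesis by (intro exI[of _ c]) auto
  next
    case False
    then obtain e where e: "\<And>i. c $ i = 0 \<Longrightarrow> e $ i = 0" "comb A e = 0" "e \<noteq> 0"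
      unfolding indep_family_def by auto
    define I where "I = {i. e $ i \<noteq> 0}"
    have "I \<noteq> {}" using e(3) by (auto simp: I_def vec_eq_iff)
    \<comment> \<open>Ratio test: the smallest ratio in absolute value belongs to the first entry to
      vanish, so at that moment no other entry has passed through zero.\<close>
    define i0 where "i0 = arg_min_on (\<lambda>i. \<bar>c $ i / e $ i\<bar>) I"
    have i0: "i0 \<in> I" and min: "\<And>i. i \<in> I \<Longrightarrow> \<bar>c $ i0 / e $ i0\<bar> \<le> \<bar>c $ i / e $ i\<bar>"
      using arg_min_if_finite[of I "\<lambda>i. \<bar>c $ i / e $ i\<bar>"] \<open>I \<noteq> {}\<close>
      by (auto simp: i0_def not_less)
    define \<tau> where "\<tau> = c $ i0 / e $ i0"
    define c1 where "c1 = c - \<tau> *\<^sub>R e"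
    have c1i: "c1 $ i = c $ i - \<tau> * e $ i" for i by (simp add: c1_def)
    have "c1 $ i0 = 0" using i0 by (simp add: c1i \<tau>_def I_def)
    moreover have "c $ i0 \<noteq> 0" using i0 e(1) by (auto simp: I_def)
    moreover have supp: "c $ i = 0 \<Longrightarrow> c1 $ i = 0" for i by (simp add: c1i e(1))
    ultimately have "{i. c1 $ i \<noteq> 0} \<subset> {i. c $ i \<noteq> 0}" by auto
    then have "card {i. c1 $ i \<noteq> 0} < card {i. c $ i \<noteq> 0}"
      by (intro psubset_card_mono) auto
    from less[OF this] obtain c' where c': "\<And>i. 0 \<le> c' $ i * c1 $ i"
      "\<And>i. c1 $ i = 0 \<Longrightarrow> c' $ i = 0" "comb A c' = comb A c1" "indep_family A {i. c' $ i \<noteq> 0}"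
      by blast
    have bound: "\<bar>\<tau> * e $ i\<bar> \<le> \<bar>c $ i\<bar>" for i
    proof (cases "i \<in> I")
      case True
      then show ?thesis using min[OF True] by (simp add: \<tau>_def I_def abs_mult field_simps)
    qed (simp add: I_def)
    have sgn1: "0 \<le> c1 $ i * c $ i" for i
    proof -
      have "\<bar>\<tau> * e $ i * c $ i\<bar> \<le> \<bar>c $ i\<bar> * \<bar>c $ i\<bar>"
        using bound[of i] by (metis abs_ge_zero abs_mult mult_right_mono)
      then show ?thesis by (simp add: c1i algebra_simps abs_le_iff)
    qed
    have "0 \<le> c' $ i * c $ i" for i
    proof (cases "c1 $ i = 0")
      case False
      then show ?thesis using c'(1)[of i] sgn1[of i] by (smt (verit) mult_less_0_iff zero_le_mult_iff)
    qed (simp add: c'(2))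
    moreover have "comb A c' = comb A c"
      using c'(3) e(2) by (simp add: c1_def comb_diff comb_scaleR)
    ultimately show ?thesis using c'(2,4) supp by blast
  qed
qed

text \<open>An injective linear map on the coordinate subspace of \<open>J\<close> is bounded below
  by some \<open>e\<close>; a perturbation of the vectors of total size below \<open>e / 2\<close>
  costs at most half of this bound, whence the constant \<open>2 / e\<close>.\<close>

lemma indep_family_bound:
  fixes A :: "'z::metric_space \<Rightarrow> 'i::finite \<Rightarrow> 'b::euclidean_space"
  assumes cont: "\<And>i. isCont (\<lambda>z. A z i) z0" and ind: "indep_family (A z0) J"
  shows "\<exists>R>0. \<forall>\<^sub>F z in nhds z0. \<forall>c. (\<forall>i. i \<notin> J \<longrightarrow> c $ i = 0) \<longrightarrow> norm c \<le> R * norm (comb (A z) c)"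
proof -
  define S where "S = {c::real^'i. \<forall>i. i \<notin> J \<longrightarrow> c $ i = 0}"
  have S: "subspace S" unfolding S_def subspace_def by auto
  obtain e where e: "e > 0" "\<And>c. c \<in> S \<Longrightarrow> norm (comb (A z0) c) \<ge> e * norm c"
    using injective_imp_isometric[OF closed_subspace[OF S] S linear_conv_bounded_linear[THEN iffD1, OF linear_comb[of "A z0"]]]
      ind unfolding S_def indep_family_def by blast
  have "((\<lambda>z. \<Sum>i\<in>UNIV. norm (A z i - A z0 i)) \<longlongrightarrow> (\<Sum>i\<in>UNIV. norm (A z0 i - A z0 i))) (nhds z0)"
    by (intro tendsto_sum tendsto_norm tendsto_diff tendsto_const)
      (use cont tendsto_at_iff_tendsto_nhds[of "\<lambda>z. A z _" z0] in \<open>simp add: isCont_def\<close>)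
  then have "((\<lambda>z. \<Sum>i\<in>UNIV. norm (A z i - A z0 i)) \<longlongrightarrow> 0) (nhds z0)" by simp
  then have "\<forall>\<^sub>F z in nhds z0. (\<Sum>i\<in>UNIV. norm (A z i - A z0 i)) < e / 2"
    using e(1) by (intro order_tendstoD(2)[where a = "e/2"]) auto
  then have "\<forall>\<^sub>F z in nhds z0. \<forall>c. (\<forall>i. i \<notin> J \<longrightarrow> c $ i = 0) \<longrightarrow> norm c \<le> (2 / e) * norm (comb (A z) c)"
  proof eventually_elim
    case (elim z)
    show ?case
    proof (intro allI impI)
      fix c :: "real^'i" assume c: "\<forall>i. i \<notin> J \<longrightarrow> c $ i = 0"
      have "norm (comb (A z) c - comb (A z0) c) = norm (\<Sum>i\<in>UNIV. c $ i *\<^sub>R (A z i - A z0 i))"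
        by (simp add: comb_def scaleR_diff_right sum_subtractf)
      also have "\<dots> \<le> (\<Sum>i\<in>UNIV. norm (c $ i *\<^sub>R (A z i - A z0 i)))" by (rule norm_sum)
      also have "\<dots> \<le> (\<Sum>i\<in>UNIV. norm c * norm (A z i - A z0 i))"
        by (intro sum_mono) (simp add: mult_right_mono component_le_norm_cart)
      also have "\<dots> = norm c * (\<Sum>i\<in>UNIV. norm (A z i - A z0 i))" by (simp add: sum_distrib_left)
      also have "\<dots> \<le> norm c * (e / 2)" using elim by (intro mult_left_mono) auto
      finally have 1: "norm (comb (A z) c - comb (A z0) c) \<le> norm c * (e / 2)" .
      have "e * norm c \<le> norm (comb (A z0) c)" using e(2) c by (simp add: S_def)
      also have "\<dots> \<le> norm (comb (A z) c) + norm (comb (A z) c - comb (A z0) c)"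
        by (metis norm_minus_commute norm_triangle_sub)
      finally have "e * norm c \<le> norm (comb (A z) c) + norm c * (e/2)" using 1 by linarith
      then show "norm c \<le> (2 / e) * norm (comb (A z) c)" using e(1) by (simp add: field_simps)
    qed
  qed
  moreover have "2 / e > 0" using e(1) by simp
  ultimately show ?thesis by blast
qed

text \<open>After reduction the support is independent at \<open>z\<close>. The hypothesis
  \<open>ind\<close> makes it independent at \<open>z0\<close> as well, so one of finitely many
  bounds from \<open>indep_family_bound\<close> applies; without it the coefficients could blow up
  as \<open>z\<close> tends to \<open>z0\<close>.\<close>

lemma comb_reduce_bounded:
  fixes A :: "'z::metric_space \<Rightarrow> 'i::finite \<Rightarrow> 'b::euclidean_space"
  assumes cont: "\<And>i. isCont (\<lambda>z. A z i) z0"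
    and ind: "\<forall>\<^sub>F z in nhds z0. \<forall>J\<subseteq>I. indep_family (A z) J \<longrightarrow> indep_family (A z0) J"
  shows "\<exists>R>0. \<forall>\<^sub>F z in nhds z0. \<forall>c. (\<forall>i. i \<notin> I \<longrightarrow> c $ i = 0) \<longrightarrow>
    (\<exists>c'. (\<forall>i. 0 \<le> c' $ i * c $ i) \<and> (\<forall>i. c $ i = 0 \<longrightarrow> c' $ i = 0) \<and>
      comb (A z) c' = comb (A z) c \<and> norm c' \<le> R * norm (comb (A z) c))"
proof -
  have "\<exists>R>0. indep_family (A z0) J \<longrightarrow> (\<forall>\<^sub>F z in nhds z0. \<forall>c. (\<forall>i. i \<notin> J \<longrightarrow> c $ i = 0) \<longrightarrow> norm c \<le> R * norm (comb (A z) c))" for J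
    using indep_family_bound[OF cont, where J = J] by (cases "indep_family (A z0) J") (auto intro: exI[of _ 1])
  then have "\<forall>J. \<exists>R>0. indep_family (A z0) J \<longrightarrow> (\<forall>\<^sub>F z in nhds z0. \<forall>c. (\<forall>i. i \<notin> J \<longrightarrow> c $ i = 0) \<longrightarrow> norm c \<le> R * norm (comb (A z) c))"
    by blast
  from choice[OF this] obtain R where Rpos: "\<And>J. R J > 0" and R: "\<And>J. indep_family (A z0) J \<Longrightarrow>
      \<forall>\<^sub>F z in nhds z0. \<forall>c. (\<forall>i. i \<notin> J \<longrightarrow> c $ i = 0) \<longrightarrow> norm c \<le> R J * norm (comb (A z) c)"
    by blast
  define Rm where "Rm = (\<Sum>J\<in>UNIV. R J)"
  have RR: "R J \<le> Rm" for J unfolding Rm_def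
    by (rule member_le_sum) (auto intro: less_imp_le[OF Rpos])
  have "Rm > 0" using Rpos[of "{}"] RR[of "{}"] by linarith
  have "\<forall>\<^sub>F z in nhds z0. \<forall>J\<in>{J. indep_family (A z0) J}. \<forall>c. (\<forall>i. i \<notin> J \<longrightarrow> c $ i = 0) \<longrightarrow> norm c \<le> R J * norm (comb (A z) c)"
    using R by (intro eventually_ball_finite) auto
  with ind have "\<forall>\<^sub>F z in nhds z0. \<forall>c. (\<forall>i. i \<notin> I \<longrightarrow> c $ i = 0) \<longrightarrow>
    (\<exists>c'. (\<forall>i. 0 \<le> c' $ i * c $ i) \<and> (\<forall>i. c $ i = 0 \<longrightarrow> c' $ i = 0) \<and>
      comb (A z) c' = comb (A z) c \<and> norm c' \<le> Rm * norm (comb (A z) c))"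
  proof eventually_elim
    case (elim z)
    show ?case
    proof (intro allI impI)
      fix c :: "real^'i" assume c: "\<forall>i. i \<notin> I \<longrightarrow> c $ i = 0"
      obtain c' where c': "\<forall>i. 0 \<le> c' $ i * c $ i" "\<forall>i. c $ i = 0 \<longrightarrow> c' $ i = 0"
        "comb (A z) c' = comb (A z) c" "indep_family (A z) {i. c' $ i \<noteq> 0}"
        using comb_reduce[of c "A z"] by blast
      have "{i. c' $ i \<noteq> 0} \<subseteq> I" using c c'(2) by auto
      then have "indep_family (A z0) {i. c' $ i \<noteq> 0}" using elim(1) c'(4) by blast
      then have "norm c' \<le> R {i. c' $ i \<noteq> 0} * norm (comb (A z) c')" using elim(2) by auto
      also have "\<dots> \<le> Rm * norm (comb (A z) c)" unfolding c'(3) by (intro mult_right_mono RR) auto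
      finally show "\<exists>c'. (\<forall>i. 0 \<le> c' $ i * c $ i) \<and> (\<forall>i. c $ i = 0 \<longrightarrow> c' $ i = 0) \<and>
        comb (A z) c' = comb (A z) c \<and> norm c' \<le> Rm * norm (comb (A z) c)"
        using c' by blast
    qed
  qed
  then show ?thesis using \<open>Rm > 0\<close> by blast
qed

text \<open>Residual of a mixed system: constraints in \<open>K\<close> are equations and keep their
  sign, the others are inequalities. In both cases the square is continuously differentiable, which
  is what the quadratic penalty needs.\<close>

definition viol :: "'i set \<Rightarrow> 'i \<Rightarrow> real \<Rightarrow> real" where
  "viol K i r = (if i \<in> K then r else max 0 r)"

lemma DERIV_max0_square: "((\<lambda>r::real. (max 0 r)\<^sup>2) has_real_derivative 2 * max 0 r) (at r)"
proof (cases "r = 0")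
  case True
  have "((\<lambda>h::real. (max 0 h)\<^sup>2 / h) \<longlongrightarrow> 0) (at 0)"
  proof (rule Lim_null_comparison)
    show "\<forall>\<^sub>F h in at 0. norm ((max 0 h)\<^sup>2 / h) \<le> \<bar>h\<bar>"
      by (intro always_eventually allI) (auto simp: max_def power2_eq_square)
    show "((\<lambda>h::real. \<bar>h\<bar>) \<longlongrightarrow> 0) (at 0)" by (rule tendsto_eq_intros | simp)+
  qed
  then show ?thesis using True by (simp add: DERIV_def)
next
  case False
  show ?thesis
  proof (cases "r > 0")
    case True
    have "((\<lambda>r::real. r\<^sup>2) has_real_derivative 2 * max 0 r) (at r)"
      using True by (auto intro!: derivative_eq_intros)
    then show ?thesis
      by (rule has_field_derivative_transform_within_open[where S = "{0<..}"]) (use True in auto)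
  next
    case F: False
    have "((\<lambda>r::real. 0) has_real_derivative 2 * max 0 r) (at r)" using False F by auto
    then show ?thesis
      by (rule has_field_derivative_transform_within_open[where S = "{..<0}"]) (use F False in auto)
  qed
qed

lemma DERIV_viol_square: "((\<lambda>r. (viol K i r)\<^sup>2) has_real_derivative 2 * viol K i r) (at r)"
proof (cases "i \<in> K")
  case True
  then show ?thesis by (auto simp: viol_def intro!: derivative_eq_intros)
next
  case False
  then show ?thesis using DERIV_max0_square by (simp add: viol_def)
qed

lemma continuous_viol: "continuous_on UNIV (viol K i)"
  unfolding viol_def by (cases "i \<in> K") (auto intro!: continuous_intros)

lemma GDERIV_sum:
  assumes "\<And>i. i \<in> I \<Longrightarrow> GDERIV (f i) x :> f' i"
  shows "GDERIV (\<lambda>x. \<Sum>i\<in>I. f i x) x :> (\<Sum>i\<in>I. f' i)"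
  using assms unfolding gderiv_def inner_sum_right by (intro has_derivative_sum) auto

lemma GDERIV_norm_square: "GDERIV (\<lambda>y. (norm (y - p))\<^sup>2) y :> 2 *\<^sub>R (y - p)"
  unfolding gderiv_def power2_norm_eq_inner
  by (auto intro!: derivative_eq_intros simp: inner_commute algebra_simps)

lemma GDERIV_local_min:
  assumes "GDERIV \<phi> y :> D" and "\<forall>\<^sub>F z in nhds y. \<phi> y \<le> \<phi> z"
  shows "D = 0"
proof -
  obtain e where "e > 0" "\<forall>z\<in>ball y e. \<phi> y \<le> \<phi> z"
    using assms(2) by (auto simp: eventually_nhds_metric dist_commute)
  then have "(\<lambda>h. h \<bullet> D) = (\<lambda>h. 0)"
    using assms(1) unfolding gderiv_def
    by (intro differential_zero_maxmin[of y "ball y e" \<phi>]) auto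
  then have "D \<bullet> D = 0" by meson
  then show ?thesis by simp
qed

lemma GDERIV_isCont: "GDERIV \<phi> y :> D \<Longrightarrow> isCont \<phi> y"
  unfolding gderiv_def by (rule has_derivative_continuous)

text \<open>The penalty method yields approximate multipliers at nearby points; constant rank is what
  keeps them bounded after reduction to an independent subfamily.\<close>

lemma kkt_indep_persistence:
  fixes \<phi> :: "'b::euclidean_space \<Rightarrow> real" and h :: "'i::finite \<Rightarrow> 'b \<Rightarrow> real"
  assumes d\<phi>: "\<And>y. GDERIV \<phi> y :> D\<phi> y" and c\<phi>: "isCont D\<phi> p"
    and dh: "\<And>i y. GDERIV (h i) y :> Dh y i" and ch: "\<And>i. isCont (\<lambda>y. Dh y i) p"
    and feas: "\<And>i. viol K i (h i p) = 0"
    and min: "\<epsilon> > 0" "\<And>y. y \<in> cball p \<epsilon> \<Longrightarrow> (\<And>i. viol K i (h i y) = 0) \<Longrightarrow> \<phi> p \<le> \<phi> y"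
    and ind: "\<forall>\<^sub>F y in nhds p. \<forall>J\<subseteq>{i. h i p = 0}. indep_family (Dh y) J \<longrightarrow> indep_family (Dh p) J"
  shows "\<exists>c. (\<forall>i. i \<notin> K \<longrightarrow> 0 \<le> c $ i) \<and> (\<forall>i. c $ i * h i p = 0) \<and> D\<phi> p + comb (Dh p) c = 0"
proof -
  \<comment> \<open>The proximal term makes the penalised minimisers converge to \<open>p\<close>,
    although \<open>p\<close> need not be a strict minimiser.\<close>
  define P where "P n y = \<phi> y + (norm (y - p))\<^sup>2 + real n * (\<Sum>i\<in>UNIV. (viol K i (h i y))\<^sup>2)" for n y
  have cont\<phi>: "continuous_on UNIV \<phi>" and conth: "\<And>i. continuous_on UNIV (h i)"
    using d\<phi> dh by (auto intro!: continuous_at_imp_continuous_on GDERIV_isCont)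
  have contv: "continuous_on UNIV (\<lambda>y. viol K i (h i y))" for i
    using continuous_on_compose[OF conth[of i] continuous_on_subset[OF continuous_viol]]
    by (auto simp: o_def)
  have contP: "continuous_on (cball p \<epsilon>) (P n)" for n
    unfolding P_def
    by (intro continuous_intros continuous_on_subset[OF cont\<phi>] continuous_on_subset[OF contv]) auto
  have "\<exists>y\<in>cball p \<epsilon>. \<forall>z\<in>cball p \<epsilon>. P n y \<le> P n z" for n
    using min(1) by (intro continuous_attains_inf contP) auto
  then obtain y where y: "\<And>n. y n \<in> cball p \<epsilon>" "\<And>n z. z \<in> cball p \<epsilon> \<Longrightarrow> P n (y n) \<le> P n z"
    by metis
  have Pp: "P n (y n) \<le> \<phi> p" for n
    using y(2)[of p n] min(1) feas by (simp add: P_def)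
  obtain q r where r: "strict_mono r" and q: "q \<in> cball p \<epsilon>" "(y \<circ> r) \<longlonglongrightarrow> q"
    using compact_cball[of p \<epsilon>] y(1) unfolding compact_def by blast
  have lim\<phi>: "(\<lambda>n. \<phi> (y (r n))) \<longlonglongrightarrow> \<phi> q"
    using continuous_on_tendsto_compose[OF cont\<phi> q(2)] by (simp add: o_def)
  have limv: "(\<lambda>n. viol K i (h i (y (r n)))) \<longlonglongrightarrow> viol K i (h i q)" for i
    using continuous_on_tendsto_compose[OF contv q(2)] by (simp add: o_def)
  have limn: "(\<lambda>n. (norm (y (r n) - p))\<^sup>2) \<longlonglongrightarrow> (norm (q - p))\<^sup>2"
    using q(2) by (intro tendsto_intros) (simp add: o_def)
  \<comment> \<open>The penalty values stay below \<open>\<phi> p\<close> while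
    \<open>\<phi>\<close> is bounded below on the ball, so the squared violation is of order
    1/n.\<close>
  have feasq: "viol K i (h i q) = 0" for i
  proof -
    obtain C where C: "\<And>z. z \<in> cball p \<epsilon> \<Longrightarrow> \<phi> p - \<phi> z \<le> C"
      using continuous_attains_inf[of "cball p \<epsilon>" \<phi>] continuous_on_subset[OF cont\<phi>] min(1)
      by (metis compact_cball cball_eq_empty diff_left_mono less_imp_le not_less subset_UNIV)
    have "(viol K i (h i (y n)))\<^sup>2 \<le> C / real n" if "n > 0" for n
    proof -
      have "(viol K i (h i (y n)))\<^sup>2 \<le> (\<Sum>i\<in>UNIV. (viol K i (h i (y n)))\<^sup>2)"
        by (rule member_le_sum) auto
      then have "real n * (viol K i (h i (y n)))\<^sup>2 \<le> real n * (\<Sum>i\<in>UNIV. (viol K i (h i (y n)))\<^sup>2)"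
        by (intro mult_left_mono) auto
      also have "\<dots> \<le> C" using Pp[of n] C[OF y(1)[of n]] zero_le_power2[of "norm (y n - p)"]
        unfolding P_def by linarith
      finally show ?thesis using that by (simp add: field_simps)
    qed
    then have "\<forall>\<^sub>F n in sequentially. norm ((viol K i (h i (y n)))\<^sup>2) \<le> C / real n"
      by (intro eventually_sequentiallyI[of 1]) auto
    then have "(\<lambda>n. (viol K i (h i (y n)))\<^sup>2) \<longlonglongrightarrow> 0"
      by (rule Lim_null_comparison) (rule lim_const_over_n)
    from LIMSEQ_subseq_LIMSEQ[OF this r] have "(\<lambda>n. (viol K i (h i (y (r n))))\<^sup>2) \<longlonglongrightarrow> 0"
      by (simp add: o_def)
    with tendsto_power[OF limv[of i], of 2] have "(viol K i (h i q))\<^sup>2 = 0"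
      by (rule LIMSEQ_unique)
    then show ?thesis by simp
  qed
  have "\<phi> (y (r n)) + (norm (y (r n) - p))\<^sup>2 \<le> \<phi> p" for n
    using Pp[of "r n"] sum_nonneg[of UNIV "\<lambda>i. (viol K i (h i (y (r n))))\<^sup>2"]
      mult_nonneg_nonneg[of "real (r n)" "\<Sum>i\<in>UNIV. (viol K i (h i (y (r n))))\<^sup>2"]
    unfolding P_def by (smt (verit) of_nat_0_le_iff zero_le_power2)
  then have "\<phi> q + (norm (q - p))\<^sup>2 \<le> \<phi> p"
    using LIMSEQ_le_const2[OF tendsto_add[OF lim\<phi> limn]] by blast
  \<comment> \<open>The limit \<open>q\<close> is admissible, so \<open>\<phi> p\<close> is at most
    \<open>\<phi> q\<close>, and the proximal term has no room left.\<close>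
  with min(2)[OF q(1) feasq] have "q = p"
    by (smt (verit) power2_less_eq_zero_iff norm_eq_zero right_minus_eq)
  then have yp: "(\<lambda>n. y (r n)) \<longlonglongrightarrow> p" using q(2) by (simp add: o_def)
  \<comment> \<open>The multipliers read off from the gradient of the penalty; nothing bounds them
    as n grows.\<close>
  define w where "w n = (\<chi> i. 2 * real (r n) * viol K i (h i (y (r n))))" for n
  define b where "b n = D\<phi> (y (r n)) + 2 *\<^sub>R (y (r n) - p)" for n
  have stat: "\<forall>\<^sub>F n in sequentially. b n + comb (Dh (y (r n))) (w n) = 0"
  proof -
    have "\<forall>\<^sub>F n in sequentially. y (r n) \<in> ball p \<epsilon>"
      using tendstoD[OF yp min(1)] by (simp add: dist_commute)
    then show ?thesis
    proof eventually_elim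
      case (elim n)
      have "\<forall>\<^sub>F z in nhds (y (r n)). P (r n) (y (r n)) \<le> P (r n) z"
        using elim eventually_nhds_in_open[of "ball p \<epsilon>" "y (r n)"] y(2)
        by (auto elim!: eventually_mono)
      moreover have "GDERIV (P (r n)) (y (r n)) :> b n + comb (Dh (y (r n))) (w n)"
      proof -
        have "GDERIV (\<lambda>y. (viol K i (h i y))\<^sup>2) (y (r n)) :>
            (2 * viol K i (h i (y (r n)))) *\<^sub>R Dh (y (r n)) i" for i
          by (rule GDERIV_DERIV_compose[OF dh DERIV_viol_square])
        from GDERIV_sum[OF this, where I = UNIV]
        have s: "GDERIV (\<lambda>y. \<Sum>i\<in>UNIV. (viol K i (h i y))\<^sup>2) (y (r n)) :>
            (\<Sum>i\<in>UNIV. (2 * viol K i (h i (y (r n)))) *\<^sub>R Dh (y (r n)) i)" .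
        have "GDERIV (\<lambda>y. real (r n) * (\<Sum>i\<in>UNIV. (viol K i (h i y))\<^sup>2)) (y (r n)) :>
            real (r n) *\<^sub>R (\<Sum>i\<in>UNIV. (2 * viol K i (h i (y (r n)))) *\<^sub>R Dh (y (r n)) i)"
          using GDERIV_mult[OF GDERIV_const[of "real (r n)"] s] by simp
        moreover have "real (r n) *\<^sub>R (\<Sum>i\<in>UNIV. (2 * viol K i (h i (y (r n)))) *\<^sub>R Dh (y (r n)) i)
            = comb (Dh (y (r n))) (w n)"
          by (simp add: comb_def w_def scaleR_sum_right mult.assoc mult.left_commute)
        ultimately show ?thesis unfolding P_def b_def
          by (intro GDERIV_add d\<phi> GDERIV_norm_square) simp
      qed
      ultimately show ?case by (rule GDERIV_local_min[rotated])
    qed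
  qed
  \<comment> \<open>Eventually \<open>w\<close> is supported on the active indices. There it can be
    exchanged for coefficients with the same combination whose size is controlled by the convergent
    sequence \<open>b\<close>.\<close>
  define I where "I = {i. h i p = 0}"
  obtain R where R: "R > 0" "\<forall>\<^sub>F z in nhds p. \<forall>c. (\<forall>i. i \<notin> I \<longrightarrow> c $ i = 0) \<longrightarrow>
    (\<exists>c'. (\<forall>i. 0 \<le> c' $ i * c $ i) \<and> (\<forall>i. c $ i = 0 \<longrightarrow> c' $ i = 0) \<and>
      comb (Dh z) c' = comb (Dh z) c \<and> norm c' \<le> R * norm (comb (Dh z) c))"
    using comb_reduce_bounded[where A = Dh and I = I, OF ch ind[folded I_def]] by blast
  have wI: "\<forall>\<^sub>F n in sequentially. \<forall>i. i \<notin> I \<longrightarrow> w n $ i = 0"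
  proof (rule eventually_all_finite)
    fix i
    show "\<forall>\<^sub>F n in sequentially. i \<notin> I \<longrightarrow> w n $ i = 0"
    proof (cases "i \<in> I")
      case False
      with feas[of i] have iK: "i \<notin> K" and neg: "h i p < 0"
        by (auto simp: viol_def I_def max_def split: if_splits)
      have "(\<lambda>n. h i (y (r n))) \<longlonglongrightarrow> h i p"
        using continuous_on_tendsto_compose[OF conth yp] by simp
      from order_tendstoD(2)[OF this neg] show ?thesis
        by eventually_elim (use iK in \<open>simp add: w_def viol_def\<close>)
    qed simp
  qed
  have "\<forall>\<^sub>F n in sequentially. \<exists>c'. (\<forall>i. 0 \<le> c' $ i * w n $ i) \<and> (\<forall>i. w n $ i = 0 \<longrightarrow> c' $ i = 0) \<and>
     (\<forall>i. i \<notin> I \<longrightarrow> c' $ i = 0) \<and> b n + comb (Dh (y (r n))) c' = 0 \<and> norm c' \<le> R * norm (b n)"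
    using eventually_compose_filterlim[OF R(2) yp] wI stat
  proof eventually_elim
    case (elim n)
    then have "norm (comb (Dh (y (r n))) (w n)) = norm (b n)"
      by (metis add_eq_0_iff norm_minus_cancel)
    with elim show ?case by metis
  qed
  then obtain c where c: "\<forall>\<^sub>F n in sequentially. (\<forall>i. 0 \<le> c n $ i * w n $ i) \<and> (\<forall>i. w n $ i = 0 \<longrightarrow> c n $ i = 0) \<and>
     (\<forall>i. i \<notin> I \<longrightarrow> c n $ i = 0) \<and> b n + comb (Dh (y (r n))) (c n) = 0 \<and> norm (c n) \<le> R * norm (b n)"
    unfolding eventually_ex by blast
  have limb: "b \<longlonglongrightarrow> D\<phi> p + 2 *\<^sub>R (p - p)"
    unfolding b_def by (intro tendsto_intros isCont_tendsto_compose[OF c\<phi>] yp)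
  then have limb: "b \<longlonglongrightarrow> D\<phi> p" by simp
  then have "(\<lambda>n. norm (b n)) \<longlonglongrightarrow> norm (D\<phi> p)" by (rule tendsto_norm)
  then have "\<forall>\<^sub>F n in sequentially. norm (b n) < norm (D\<phi> p) + 1"
    by (rule order_tendstoD(2)) simp
  with c have "\<forall>\<^sub>F n in sequentially. c n \<in> cball 0 (R * (norm (D\<phi> p) + 1))"
  proof eventually_elim
    case (elim n)
    then have "norm (c n) \<le> R * norm (b n)" by blast
    also have "\<dots> \<le> R * (norm (D\<phi> p) + 1)" using elim(2) R(1) by (intro mult_left_mono) auto
    finally show ?case by simp
  qed
  then obtain N where N: "\<And>n. c (n + N) \<in> cball 0 (R * (norm (D\<phi> p) + 1))"
    unfolding eventually_sequentially by (metis le_add2)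
  then obtain c0 s where s: "strict_mono s" and c0: "((\<lambda>n. c (n + N)) \<circ> s) \<longlonglongrightarrow> c0"
    using compact_cball[of 0 "R * (norm (D\<phi> p) + 1)"] unfolding compact_def by metis
  define \<sigma> where "\<sigma> n = s n + N" for n
  have sm: "strict_mono \<sigma>" using s unfolding \<sigma>_def strict_mono_def by auto
  have lc: "(\<lambda>n. c (\<sigma> n)) \<longlonglongrightarrow> c0" using c0 by (simp add: o_def \<sigma>_def)
  have lci: "(\<lambda>n. c (\<sigma> n) $ i) \<longlonglongrightarrow> c0 $ i" for i using lc by (rule tendsto_vec_nth)
  have cs: "\<forall>\<^sub>F n in sequentially. (\<forall>i. 0 \<le> c (\<sigma> n) $ i * w (\<sigma> n) $ i) \<and> (\<forall>i. w (\<sigma> n) $ i = 0 \<longrightarrow> c (\<sigma> n) $ i = 0) \<and>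
     (\<forall>i. i \<notin> I \<longrightarrow> c (\<sigma> n) $ i = 0) \<and> b (\<sigma> n) + comb (Dh (y (r (\<sigma> n)))) (c (\<sigma> n)) = 0"
    using eventually_subseq[OF sm c] by eventually_elim blast
  \<comment> \<open>The reduction preserves signs only relative to \<open>w\<close>, which is
    nonnegative off \<open>K\<close>; where \<open>w\<close> vanishes the new coefficient vanishes
    too.\<close>
  have "0 \<le> c0 $ i" if "i \<notin> K" for i
  proof (rule tendsto_lowerbound[OF lci])
    show "\<forall>\<^sub>F n in sequentially. 0 \<le> c (\<sigma> n) $ i" using cs
    proof eventually_elim
      case (elim n)
      have "0 \<le> w (\<sigma> n) $ i" using that by (simp add: w_def viol_def)
      then show ?case using elim
        by (metis linorder_not_less mult_neg_pos order_le_less)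
    qed
  qed simp
  moreover have "c0 $ i * h i p = 0" for i
  proof (cases "i \<in> I")
    case False
    have "\<forall>\<^sub>F n in sequentially. c (\<sigma> n) $ i = 0" using cs by eventually_elim (use False in blast)
    then have "c0 $ i = 0" using lci[of i] by (metis LIMSEQ_unique tendsto_eventually)
    then show ?thesis by simp
  qed (simp add: I_def)
  moreover have "D\<phi> p + comb (Dh p) c0 = 0"
  proof -
    have "(\<lambda>n. y (r (\<sigma> n))) \<longlonglongrightarrow> p" using LIMSEQ_subseq_LIMSEQ[OF yp sm] by (simp add: o_def)
    then have "(\<lambda>n. comb (Dh (y (r (\<sigma> n)))) (c (\<sigma> n))) \<longlonglongrightarrow> comb (Dh p) c0"
      by (intro tendsto_comb lc isCont_tendsto_compose[OF ch])
    moreover have "(\<lambda>n. b (\<sigma> n)) \<longlonglongrightarrow> D\<phi> p" using LIMSEQ_subseq_LIMSEQ[OF limb sm] by (simp add: o_def)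
    ultimately have "(\<lambda>n. b (\<sigma> n) + comb (Dh (y (r (\<sigma> n)))) (c (\<sigma> n))) \<longlonglongrightarrow> D\<phi> p + comb (Dh p) c0"
      by (rule tendsto_add[rotated])
    moreover have "(\<lambda>n. b (\<sigma> n) + comb (Dh (y (r (\<sigma> n)))) (c (\<sigma> n))) \<longlonglongrightarrow> 0"
      using cs by (intro tendsto_eventually) (auto elim: eventually_mono)
    ultimately show ?thesis by (rule LIMSEQ_unique)
  qed
  ultimately show ?thesis by blast
qed

section \<open>Error bound for the lower level feasible set\<close>

lemma eventually_nhds_ball: "(\<forall>\<^sub>F z in nhds a. P z) \<longleftrightarrow> (\<exists>\<delta>>0. \<forall>z\<in>ball a \<delta>. P z)"
  by (auto simp: eventually_nhds_metric dist_commute)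

lemma finite_uniform_radius:
  fixes P :: "'i::finite \<Rightarrow> real \<Rightarrow> bool"
  assumes ex: "\<And>i. \<exists>\<delta>>0. P i \<delta>" and anti: "\<And>i \<delta> \<delta>'. P i \<delta> \<Longrightarrow> 0 < \<delta>' \<Longrightarrow> \<delta>' \<le> \<delta> \<Longrightarrow> P i \<delta>'"
  shows "\<exists>\<delta>>0. \<forall>i. P i \<delta>"
proof -
  obtain d where d: "\<And>i. d i > 0" "\<And>i. P i (d i)" using ex by metis
  have "Min (range d) > 0" using d(1) by simp
  moreover have "P i (Min (range d))" for i using anti[OF d(2) \<open>Min (range d) > 0\<close>] by simp
  ultimately show ?thesis by blast
qed

text \<open>Mean value inequality on a ball in which every gradient is within \<open>e / 2\<close>
  of \<open>D z0\<close>. The slope may be taken at a third point \<open>w\<close>, because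
  \<open>error_bound\<close> linearises at a projection and not at the base point.\<close>

lemma GDERIV_strict:
  fixes \<phi> :: "'z::euclidean_space \<Rightarrow> real"
  assumes d: "\<And>z. GDERIV \<phi> z :> D z" and c: "isCont D z0" and e: "e > 0"
  shows "\<exists>\<delta>>0. \<forall>z\<in>ball z0 \<delta>. \<forall>z'\<in>ball z0 \<delta>. \<forall>w\<in>ball z0 \<delta>.
    \<bar>\<phi> z - \<phi> z' - D w \<bullet> (z - z')\<bar> \<le> e * norm (z - z')"
proof -
  from c e obtain \<delta> where \<delta>: "\<delta> > 0" "\<And>z. dist z z0 < \<delta> \<Longrightarrow> dist (D z) (D z0) < e / 2"
    unfolding continuous_at by (metis half_gt_zero isCont_def c continuous_at_eps_delta dist_norm LIM_def dist_self)
  have "\<bar>\<phi> z - \<phi> z' - D w \<bullet> (z - z')\<bar> \<le> e * norm (z - z')"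
    if z: "z \<in> ball z0 \<delta>" "z' \<in> ball z0 \<delta>" "w \<in> ball z0 \<delta>" for z z' w
  proof -
    have "norm (\<phi> z - \<phi> z' - (\<lambda>h. h \<bullet> D w) (z - z')) \<le> norm (z - z') * e"
    proof (rule differentiable_bound_linearization[where S = "ball z0 \<delta>" and f' = "\<lambda>x h. h \<bullet> D x"])
      show "z' + t *\<^sub>R (z - z') \<in> ball z0 \<delta>" if "t \<in> {0..1}" for t
      proof -
        have "z' + t *\<^sub>R (z - z') = (1 - t) *\<^sub>R z' + t *\<^sub>R z" by (simp add: algebra_simps)
        then show ?thesis using convexD_alt[OF convex_ball z(2,1)] that by auto
      qed
      show "(\<phi> has_derivative (\<lambda>h. h \<bullet> D x)) (at x within ball z0 \<delta>)" for x
        using d[of x] unfolding gderiv_def by (rule has_derivative_at_withinI)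
      show "onorm ((\<lambda>h. h \<bullet> D x) - (\<lambda>h. h \<bullet> D w)) \<le> e" if "x \<in> ball z0 \<delta>" for x
      proof (rule onorm_le)
        fix h :: 'z
        have "dist (D x) (D w) \<le> dist (D x) (D z0) + dist (D w) (D z0)" by (rule dist_triangle2)
        also have "\<dots> \<le> e" using \<delta>(2)[of x] \<delta>(2)[of w] that z(3) by (simp add: dist_commute)
        finally have "norm (D x - D w) \<le> e" by (simp add: dist_norm)
        then have "norm h * norm (D x - D w) \<le> e * norm h"
          by (metis mult.commute mult_left_mono norm_ge_zero)
        then show "norm (((\<lambda>h. h \<bullet> D x) - (\<lambda>h. h \<bullet> D w)) h) \<le> e * norm h"
          using Cauchy_Schwarz_ineq2[of h "D x - D w"] by (simp add: inner_diff_right)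
      qed
    qed (use z in auto)
    then show ?thesis by (simp add: inner_commute mult.commute)
  qed
  then show ?thesis using \<delta>(1) by blast
qed

lemma GDERIV_local_lipschitz:
  fixes \<phi> :: "'z::euclidean_space \<Rightarrow> real"
  assumes d: "\<And>z. GDERIV \<phi> z :> D z" and c: "isCont D z0"
  shows "\<exists>\<delta>>0. \<forall>z\<in>ball z0 \<delta>. \<forall>z'\<in>ball z0 \<delta>. \<bar>\<phi> z - \<phi> z'\<bar> \<le> (norm (D z0) + 1) * norm (z - z')"
proof -
  obtain \<delta> where \<delta>: "\<delta> > 0" "\<And>z z' w. z\<in>ball z0 \<delta> \<Longrightarrow> z'\<in>ball z0 \<delta> \<Longrightarrow> w\<in>ball z0 \<delta> \<Longrightarrow>
    \<bar>\<phi> z - \<phi> z' - D w \<bullet> (z - z')\<bar> \<le> 1 * norm (z - z')"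
    using GDERIV_strict[OF d c, of 1] by auto
  have "\<bar>\<phi> z - \<phi> z'\<bar> \<le> (norm (D z0) + 1) * norm (z - z')" if "z\<in>ball z0 \<delta>" "z'\<in>ball z0 \<delta>" for z z'
    using \<delta>(2)[OF that, of z0] \<delta>(1) Cauchy_Schwarz_ineq2[of "D z0" "z - z'"]
    by (simp add: algebra_simps)
  then show ?thesis using \<delta>(1) by blast
qed

lemma GDERIV_family_lipschitz:
  fixes h :: "'z::euclidean_space \<Rightarrow> real ^ 'i"
  assumes d: "\<And>z i. GDERIV (\<lambda>z. h z $ i) z :> D z i" and c: "\<And>i. isCont (\<lambda>z. D z i) z0"
  shows "\<exists>C>0. \<exists>\<delta>>0. \<forall>i. \<forall>z\<in>ball z0 \<delta>. \<forall>z'\<in>ball z0 \<delta>. \<bar>h z $ i - h z' $ i\<bar> \<le> C * norm (z - z')"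
proof -
  define C where "C = (\<Sum>i\<in>UNIV. norm (D z0 i) + 1)"
  have C: "norm (D z0 i) + 1 \<le> C" for i unfolding C_def by (rule member_le_sum) auto
  have "C > 0" using C[of undefined] norm_ge_zero[of "D z0 undefined"] by linarith
  have "\<exists>\<delta>>0. \<forall>i. \<forall>z\<in>ball z0 \<delta>. \<forall>z'\<in>ball z0 \<delta>. \<bar>h z $ i - h z' $ i\<bar> \<le> C * norm (z - z')"
  proof (rule finite_uniform_radius)
    fix i
    obtain \<delta> where \<delta>: "\<delta> > 0" "\<And>z z'. z\<in>ball z0 \<delta> \<Longrightarrow> z'\<in>ball z0 \<delta> \<Longrightarrow> \<bar>h z $ i - h z' $ i\<bar> \<le> (norm (D z0 i) + 1) * norm (z - z')"
      using GDERIV_local_lipschitz[OF d c, of i] by blast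
    have "\<bar>h z $ i - h z' $ i\<bar> \<le> C * norm (z - z')" if "z\<in>ball z0 \<delta>" "z'\<in>ball z0 \<delta>" for z z'
      using \<delta>(2)[OF that] mult_right_mono[OF C[of i], of "norm (z - z')"] by simp
    then show "\<exists>\<delta>>0. \<forall>z\<in>ball z0 \<delta>. \<forall>z'\<in>ball z0 \<delta>. \<bar>h z $ i - h z' $ i\<bar> \<le> C * norm (z - z')"
      using \<delta>(1) by blast
  qed auto
  then show ?thesis using \<open>C > 0\<close> by blast
qed

section \<open>Partial gradients, lower level solutions and the real valued value function\<close>

lemma GDERIV_slice_snd:
  fixes \<phi> :: "'a::euclidean_space \<times> 'b::euclidean_space \<Rightarrow> real"
  assumes "GDERIV \<phi> (x, y) :> D"
  shows "GDERIV (\<lambda>y. \<phi> (x, y)) y :> snd D"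
proof -
  have "((\<lambda>y. (x, y)) has_derivative (\<lambda>h. (0, h))) (at y)" by (auto intro!: derivative_eq_intros)
  from has_derivative_compose[OF this assms[unfolded gderiv_def]]
  show ?thesis by (simp add: gderiv_def o_def inner_prod_def)
qed

lemma GDERIV_slice_fst:
  fixes \<phi> :: "'a::euclidean_space \<times> 'b::euclidean_space \<Rightarrow> real"
  assumes "GDERIV \<phi> (x, y) :> D"
  shows "GDERIV (\<lambda>x. \<phi> (x, y)) x :> fst D"
proof -
  have "((\<lambda>x. (x, y)) has_derivative (\<lambda>h. (h, 0))) (at x)" by (auto intro!: derivative_eq_intros)
  from has_derivative_compose[OF this assms[unfolded gderiv_def]]
  show ?thesis by (simp add: gderiv_def o_def inner_prod_def)
qed

lemma sol_map_iff:
  "y \<in> sol_map f g x \<longleftrightarrow> (\<forall>i. g (x, y) $ i \<le> 0) \<and>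
     (\<forall>y'. (\<forall>i. g (x, y') $ i \<le> 0) \<longrightarrow> f (x, y) \<le> f (x, y'))"
  unfolding sol_map_def is_arg_min_def feas_map_def by (auto simp: less_eq_vec_def not_less)

lemma viol_empty_iff: "viol {} i r = 0 \<longleftrightarrow> r \<le> 0"
  by (auto simp: viol_def)

lemma viol_0_imp: "viol K i r = 0 \<Longrightarrow> r \<le> 0" "viol K i r = 0 \<Longrightarrow> i \<in> K \<Longrightarrow> r = 0"
  by (auto simp: viol_def max_def split: if_splits)

text \<open>\<open>real_of_ereal\<close> sends both infinities to 0, so this value is meaningless
  where the lower level is infeasible or unbounded. Statements about it are therefore guarded by
  nonemptiness of the solution set.\<close>

definition real_val :: "('a \<times> 'b \<Rightarrow> real) \<Rightarrow> ('a \<times> 'b \<Rightarrow> real ^ 'p) \<Rightarrow> 'a \<Rightarrow> real" where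
  "real_val f g x = real_of_ereal (val_fun f g x)"

lemma val_fun_sol:
  assumes "y \<in> sol_map f g x"
  shows "val_fun f g x = ereal (f (x, y))"
  using assms unfolding val_fun_def sol_map_iff
  by (intro INF_eqI) (auto simp: feas_map_def less_eq_vec_def)

lemma real_val_sol: "y \<in> sol_map f g x \<Longrightarrow> real_val f g x = f (x, y)"
  by (simp add: real_val_def val_fun_sol)

lemma real_val_le: "sol_map f g x \<noteq> {} \<Longrightarrow> (\<And>i. g (x, p) $ i \<le> 0) \<Longrightarrow> real_val f g x \<le> f (x, p)"
  using real_val_sol sol_map_iff by (metis all_not_in_conv)

text \<open>RCR regularity enters as \<open>constant_rank\<close>, phrased through independence of
  subfamilies, the form used by the reduction lemmas. Gradients are explicit parameters, so that the
  definite descriptions behind \<open>gradient\<close> only appear in the final translation.\<close>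

locale regular_lower_level =
  fixes f :: "'a::euclidean_space \<times> 'b::euclidean_space \<Rightarrow> real"
    and g :: "'a \<times> 'b \<Rightarrow> real ^ 'p"
    and Df :: "'a \<times> 'b \<Rightarrow> 'a \<times> 'b"
    and Dg :: "'a \<times> 'b \<Rightarrow> 'p \<Rightarrow> 'a \<times> 'b"
    and x0 :: 'a and y0 :: 'b
  assumes Df: "\<And>z. GDERIV f z :> Df z" and isCont_Df: "\<And>z. isCont Df z"
    and Dg: "\<And>z i. GDERIV (\<lambda>z. g z $ i) z :> Dg z i" and isCont_Dg: "\<And>z i. isCont (\<lambda>z. Dg z i) z"
    and constant_rank: "\<forall>\<^sub>F z in nhds (x0, y0). \<forall>J\<subseteq>active g (x0, y0).
      indep_family (\<lambda>i. snd (Dg z i)) J \<longleftrightarrow> indep_family (\<lambda>i. snd (Dg (x0, y0) i)) J"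
    and sol0: "y0 \<in> sol_map f g x0"
begin

abbreviation "z0 \<equiv> (x0, y0)"
abbreviation "act \<equiv> active g (x0, y0)"
abbreviation "S \<equiv> sol_map f g"
abbreviation "V \<equiv> real_val f g"

definition DL :: "real ^ 'p \<Rightarrow> 'a \<times> 'b \<Rightarrow> 'a \<times> 'b" where
  "DL lam z = Df z + comb (Dg z) lam"

definition lag :: "real ^ 'p \<Rightarrow> 'a \<times> 'b \<Rightarrow> real" where
  "lag lam z = f z + (\<Sum>i\<in>UNIV. lam $ i * g z $ i)"

text \<open>Componentwise complementarity passes to limits and is what the support arguments use; at
  \<open>z0\<close>, where the constraints hold, it agrees with the inner product form of
  \<open>multipliers\<close>.\<close>

definition mult :: "'a \<times> 'b \<Rightarrow> (real ^ 'p) set" where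
  "mult z = {lam. (\<forall>i. 0 \<le> lam $ i) \<and> (\<forall>i. lam $ i * g z $ i = 0) \<and> snd (DL lam z) = 0}"

lemma isCont_f: "isCont f z" and isCont_g: "isCont (\<lambda>z. g z $ i) z"
  using Df Dg GDERIV_isCont by blast+

lemma GDERIV_lag: "GDERIV (lag lam) z :> DL lam z"
proof -
  have "GDERIV (\<lambda>z. lam $ i * g z $ i) z :> lam $ i *\<^sub>R Dg z i" for i
    using GDERIV_mult[OF GDERIV_const[of "lam $ i"] Dg] by simp
  then show ?thesis unfolding lag_def DL_def comb_def by (intro GDERIV_add Df GDERIV_sum) simp
qed

lemma tendsto_DL:
  assumes "(lam \<longlongrightarrow> lam0) \<F>" "(z \<longlongrightarrow> w) \<F>"
  shows "((\<lambda>k. DL (lam k) (z k)) \<longlongrightarrow> DL lam0 w) \<F>"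
  unfolding DL_def
  by (intro tendsto_add tendsto_comb assms isCont_tendsto_compose[OF isCont_Df assms(2)]
     isCont_tendsto_compose[OF isCont_Dg assms(2)])

lemma isCont_DL: "isCont (DL lam) z"
  unfolding isCont_def by (rule tendsto_DL) auto

lemma g0_le: "g z0 $ i \<le> 0"
  using sol0 by (simp add: sol_map_iff)

section \<open>Stability of active constraints and of independence near the base point\<close>

lemma inactive_near: "\<exists>\<delta>>0. \<forall>z\<in>ball z0 \<delta>. \<forall>i. i \<notin> act \<longrightarrow> g z $ i < 0"
proof -
  have "\<forall>\<^sub>F z in nhds z0. \<forall>i. i \<notin> act \<longrightarrow> g z $ i < 0"
  proof (rule eventually_all_finite)
    fix i
    show "\<forall>\<^sub>F z in nhds z0. i \<notin> act \<longrightarrow> g z $ i < 0"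
    proof (cases "i \<in> act")
      case False
      then have "g z0 $ i < 0" using g0_le[of i] by (auto simp: active_def)
      have "((\<lambda>z. g z $ i) \<longlongrightarrow> g z0 $ i) (nhds z0)"
        using isCont_g[where i = i and z = z0] tendsto_at_iff_tendsto_nhds[of "\<lambda>z. g z $ i" z0]
        by (simp add: isCont_def)
      from order_tendstoD(2)[OF this \<open>g z0 $ i < 0\<close>] show ?thesis by (auto elim: eventually_mono)
    qed simp
  qed
  then show ?thesis unfolding eventually_nhds_ball by blast
qed

lemma comb_reduce_near:
  "\<exists>R>0. \<exists>\<delta>>0. \<forall>z\<in>ball z0 \<delta>. \<forall>c. (\<forall>i. i \<notin> act \<longrightarrow> c $ i = 0) \<longrightarrow>
    (\<exists>c'. (\<forall>i. 0 \<le> c' $ i * c $ i) \<and> (\<forall>i. c $ i = 0 \<longrightarrow> c' $ i = 0) \<and>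
      comb (\<lambda>i. snd (Dg z i)) c' = comb (\<lambda>i. snd (Dg z i)) c \<and>
      norm c' \<le> R * norm (comb (\<lambda>i. snd (Dg z i)) c))"
proof -
  have cont: "isCont (\<lambda>z. snd (Dg z i)) z0" for i using isCont_Dg by (intro continuous_intros) auto
  have ind: "\<forall>\<^sub>F z in nhds z0. \<forall>J\<subseteq>act. indep_family (\<lambda>i. snd (Dg z i)) J \<longrightarrow> indep_family (\<lambda>i. snd (Dg z0 i)) J"
    using constant_rank by eventually_elim blast
  from comb_reduce_bounded[where A = "\<lambda>z i. snd (Dg z i)" and I = act, OF cont ind]
  show ?thesis by (simp only: eventually_nhds_ball)
qed

text \<open>Multipliers are needed at points other than \<open>z0\<close>, with only y varying. Both
  \<open>(x, y)\<close> and \<open>(x, y')\<close> are compared with \<open>z0\<close>, and near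
  \<open>z0\<close> no inactive constraint becomes active, so constant rank covers the subfamilies
  in question.\<close>

lemma persistence_near:
  "\<exists>\<delta>>0. \<forall>x y. (x, y) \<in> ball z0 \<delta> \<longrightarrow> (\<forall>\<^sub>F y' in nhds y. \<forall>J\<subseteq>{i. g (x, y) $ i = 0}.
     indep_family (\<lambda>i. snd (Dg (x, y') i)) J \<longrightarrow> indep_family (\<lambda>i. snd (Dg (x, y) i)) J)"
proof -
  obtain \<delta>1 where \<delta>1: "\<delta>1 > 0" "\<forall>z\<in>ball z0 \<delta>1. \<forall>i. i \<notin> act \<longrightarrow> g z $ i < 0"
    using inactive_near by blast
  obtain \<delta>2 where \<delta>2: "\<delta>2 > 0" "\<forall>z\<in>ball z0 \<delta>2. \<forall>J\<subseteq>act.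
      indep_family (\<lambda>i. snd (Dg z i)) J \<longleftrightarrow> indep_family (\<lambda>i. snd (Dg z0 i)) J"
    using constant_rank[unfolded eventually_nhds_ball] by (elim exE conjE) (rule that)
  show ?thesis
  proof (intro exI[of _ "min \<delta>1 \<delta>2"] conjI allI impI)
    fix x y assume xy: "(x, y) \<in> ball z0 (min \<delta>1 \<delta>2)"
    then have "{i. g (x, y) $ i = 0} \<subseteq> act" using \<delta>1(2) by force
    have "((\<lambda>y'. (x, y')) \<longlongrightarrow> (x, y)) (nhds y)" by (intro tendsto_intros) (simp add: filterlim_ident)
    moreover have "\<forall>\<^sub>F z in nhds (x, y). z \<in> ball z0 (min \<delta>1 \<delta>2)"
      by (rule eventually_nhds_in_open) (use xy in auto)
    ultimately have "\<forall>\<^sub>F y' in nhds y. (x, y') \<in> ball z0 (min \<delta>1 \<delta>2)"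
      by (rule eventually_compose_filterlim[rotated])
    then show "\<forall>\<^sub>F y' in nhds y. \<forall>J\<subseteq>{i. g (x, y) $ i = 0}.
      indep_family (\<lambda>i. snd (Dg (x, y') i)) J \<longrightarrow> indep_family (\<lambda>i. snd (Dg (x, y) i)) J"
    proof eventually_elim
      case (elim y')
      have "(x, y) \<in> ball z0 \<delta>2" "(x, y') \<in> ball z0 \<delta>2" using elim xy by auto
      with \<delta>2(2) have "indep_family (\<lambda>i. snd (Dg (x, y') i)) J \<longleftrightarrow> indep_family (\<lambda>i. snd (Dg (x, y) i)) J"
        if "J \<subseteq> act" for J using that by meson
      with \<open>{i. g (x, y) $ i = 0} \<subseteq> act\<close> show ?case by (meson order_trans)
    qed
  qed (use \<delta>1 \<delta>2 in auto)
qed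

lemma kkt_slice:
  assumes p: "(\<forall>\<^sub>F y' in nhds p. \<forall>J\<subseteq>{i. g (x, p) $ i = 0}.
     indep_family (\<lambda>i. snd (Dg (x, y') i)) J \<longrightarrow> indep_family (\<lambda>i. snd (Dg (x, p) i)) J)"
    and "\<And>y. GDERIV \<phi> y :> D\<phi> y" "isCont D\<phi> p"
    and "\<And>i. viol K i (g (x, p) $ i) = 0"
    and "\<And>y. (\<And>i. viol K i (g (x, y) $ i) = 0) \<Longrightarrow> \<phi> p \<le> \<phi> y"
  shows "\<exists>c. (\<forall>i. i \<notin> K \<longrightarrow> 0 \<le> c $ i) \<and> (\<forall>i. c $ i * g (x, p) $ i = 0) \<and>
     D\<phi> p + comb (\<lambda>i. snd (Dg (x, p) i)) c = 0"
proof (rule kkt_indep_persistence[where \<epsilon> = 1 and h = "\<lambda>i y. g (x, y) $ i" and Dh = "\<lambda>y i. snd (Dg (x, y) i)" and \<phi> = \<phi> and D\<phi> = D\<phi>])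
  show "GDERIV (\<lambda>y. g (x, y) $ i) y :> snd (Dg (x, y) i)" for i y by (intro GDERIV_slice_snd Dg)
  show "isCont (\<lambda>y. snd (Dg (x, y) i)) p" for i
    by (intro continuous_snd isCont_o2[where g = "\<lambda>z. Dg z i", OF _ isCont_Dg] continuous_intros)
qed (use assms in auto)

text \<open>The point \<open>q\<close> has to be supplied: constant rank of the y-gradients does not
  make the perturbed system solvable, as a constraint depending on x alone shows. One
  \<open>M\<close> serves all \<open>K\<close>.\<close>

definition error_bound_at :: "real \<Rightarrow> real \<Rightarrow> bool" where
  "error_bound_at M \<delta> \<longleftrightarrow> (\<forall>K\<subseteq>act. \<forall>x y q. (x, y) \<in> ball z0 \<delta> \<longrightarrow> (x, q) \<in> ball z0 \<delta> \<longrightarrow>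
     (\<forall>i. viol K i (g (x, q) $ i) = 0) \<longrightarrow>
     (\<exists>p. (\<forall>i. viol K i (g (x, p) $ i) = 0) \<and> norm (p - y) \<le> M * (\<Sum>i\<in>UNIV. \<bar>viol K i (g (x, y) $ i)\<bar>)))"

text \<open>The projection \<open>p\<close> of \<open>y\<close> satisfies a multiplier equation
  whose reduced coefficients are at most 2R times the distance. Pairing that equation with
  \<open>y - p\<close> and linearising each constraint bounds the squared distance by the distance
  times the violation, plus a quadratic error small enough to be absorbed.\<close>

lemma error_bound: "\<exists>M>0. \<exists>\<delta>>0. error_bound_at M \<delta>"
proof -
  obtain R \<delta>1 where R: "R > 0" "\<delta>1 > 0" "\<forall>z\<in>ball z0 \<delta>1. \<forall>c. (\<forall>i. i \<notin> act \<longrightarrow> c $ i = 0) \<longrightarrow>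
    (\<exists>c'. (\<forall>i. 0 \<le> c' $ i * c $ i) \<and> (\<forall>i. c $ i = 0 \<longrightarrow> c' $ i = 0) \<and>
      comb (\<lambda>i. snd (Dg z i)) c' = comb (\<lambda>i. snd (Dg z i)) c \<and>
      norm c' \<le> R * norm (comb (\<lambda>i. snd (Dg z i)) c))"
    using comb_reduce_near by (elim exE conjE) (rule that)
  obtain \<delta>2 where \<delta>2: "\<delta>2 > 0" "\<And>x y. (x, y) \<in> ball z0 \<delta>2 \<Longrightarrow> (\<forall>\<^sub>F y' in nhds y. \<forall>J\<subseteq>{i. g (x, y) $ i = 0}.
     indep_family (\<lambda>i. snd (Dg (x, y') i)) J \<longrightarrow> indep_family (\<lambda>i. snd (Dg (x, y) i)) J)"
    using persistence_near by blast
  obtain \<delta>3 where \<delta>3: "\<delta>3 > 0" "\<forall>z\<in>ball z0 \<delta>3. \<forall>i. i \<notin> act \<longrightarrow> g z $ i < 0"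
    using inactive_near by blast
  define N where "N = real CARD('p)"
  have N: "N > 0" by (simp add: N_def)
  \<comment> \<open>Chosen so that the N linearisation errors, each weighted by the coefficient
    bound, add up to half of the distance.\<close>
  define e where "e = 1 / (2 * R * N)"
  have e: "e > 0" using R N by (simp add: e_def)
  have "\<exists>\<delta>>0. \<forall>i. \<forall>z\<in>ball z0 \<delta>. \<forall>z'\<in>ball z0 \<delta>. \<forall>w\<in>ball z0 \<delta>.
    \<bar>g z $ i - g z' $ i - Dg w i \<bullet> (z - z')\<bar> \<le> e * norm (z - z')"
    by (rule finite_uniform_radius) (use GDERIV_strict[OF Dg isCont_Dg e] in auto)
  then obtain \<delta>4 where \<delta>4: "\<delta>4 > 0" "\<And>i z z' w. z\<in>ball z0 \<delta>4 \<Longrightarrow> z'\<in>ball z0 \<delta>4 \<Longrightarrow> w\<in>ball z0 \<delta>4 \<Longrightarrow>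
    \<bar>g z $ i - g z' $ i - Dg w i \<bullet> (z - z')\<bar> \<le> e * norm (z - z')" by blast
  \<comment> \<open>The factor 4 leaves room for the projection: \<open>y\<close> and
    \<open>q\<close> are less than 2\<delta> apart, hence so are \<open>y\<close> and
    \<open>p\<close>, and \<open>(x, p)\<close> is within 4\<delta> of \<open>z0\<close>.\<close>
  define \<delta> where "\<delta> = min (min \<delta>1 \<delta>2) (min \<delta>3 \<delta>4) / 4"
  have \<delta>: "\<delta> > 0" using R \<delta>2 \<delta>3 \<delta>4 by (simp add: \<delta>_def)
  have "\<exists>p. (\<forall>i. viol K i (g (x, p) $ i) = 0) \<and> norm (p - y) \<le> (2 * R) * (\<Sum>i\<in>UNIV. \<bar>viol K i (g (x, y) $ i)\<bar>)"
    if K: "K \<subseteq> act" and y: "(x, y) \<in> ball z0 \<delta>" and q: "(x, q) \<in> ball z0 \<delta>" "\<forall>i. viol K i (g (x, q) $ i) = 0"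
    for K x y q
  proof -
    define C where "C = {p. \<forall>i. viol K i (g (x, p) $ i) = 0}"
    have "closed C"
    proof -
      have "continuous_on UNIV (\<lambda>p. g (x, p) $ i)" for i
        by (intro continuous_at_imp_continuous_on ballI isCont_o2[where g = "\<lambda>z. g z $ i", OF _ isCont_g] continuous_intros)
      then have "continuous_on UNIV (\<lambda>p. viol K i (g (x, p) $ i))" for i
        by (rule continuous_on_compose2[OF continuous_viol]) auto
      then show ?thesis unfolding C_def by (intro closed_Collect_all closed_Collect_eq continuous_on_const)
    qed
    then obtain p where p: "p \<in> C" "\<And>p'. p' \<in> C \<Longrightarrow> dist y p \<le> dist y p'"
      using distance_attains_inf[of C y] q(2) unfolding C_def by blast
    show ?thesis
    proof (cases "p = y")
      case True
      then show ?thesis using p(1) R(1)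
        by (intro exI[of _ p]) (auto simp: C_def intro!: mult_nonneg_nonneg sum_nonneg)
    next
      case False
      have "dist y q \<le> dist (x, y) (x, q)" by (simp add: dist_Pair_Pair)
      also have "\<dots> \<le> dist z0 (x, y) + dist z0 (x, q)" by (rule dist_triangle3)
      finally have "dist y p < 2 * \<delta>" using p(2)[of q] q y by (simp add: C_def)
      moreover have "dist z0 (x, p) \<le> dist z0 (x, y) + dist (x, y) (x, p)" by (rule dist_triangle)
      ultimately have "dist z0 (x, p) < 4 * \<delta>" using y \<delta> by (simp add: dist_Pair_Pair)
      then have xp: "(x, p) \<in> ball z0 \<delta>1" "(x, p) \<in> ball z0 \<delta>2" "(x, p) \<in> ball z0 \<delta>3" "(x, p) \<in> ball z0 \<delta>4"
        by (auto simp: \<delta>_def)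
      have xy: "(x, y) \<in> ball z0 \<delta>4" using y \<delta> \<delta>4 by (auto simp: \<delta>_def)
      let ?D = "\<lambda>i. snd (Dg (x, p) i)"
      have "\<exists>c. (\<forall>i. i \<notin> K \<longrightarrow> 0 \<le> c $ i) \<and> (\<forall>i. c $ i * g (x, p) $ i = 0) \<and> 2 *\<^sub>R (p - y) + comb ?D c = 0"
      proof (rule kkt_slice[OF \<delta>2(2)[OF xp(2)] GDERIV_norm_square])
        show "isCont (\<lambda>p. 2 *\<^sub>R (p - y)) p" by (intro continuous_intros)
        show "viol K i (g (x, p) $ i) = 0" for i using p(1) by (simp add: C_def)
        show "(norm (p - y))\<^sup>2 \<le> (norm (p' - y))\<^sup>2" if "\<And>i. viol K i (g (x, p') $ i) = 0" for p'
          using p(2)[of p'] that by (simp add: C_def dist_norm norm_minus_commute)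
      qed
      then obtain c where c: "\<And>i. i \<notin> K \<Longrightarrow> 0 \<le> c $ i" "\<And>i. c $ i * g (x, p) $ i = 0" "2 *\<^sub>R (p - y) + comb ?D c = 0"
        by blast
      \<comment> \<open>Complementarity confines the multiplier to indices active at
        \<open>z0\<close>, the only ones for which constant rank gives a bounded
        replacement.\<close>
      have "\<forall>i. i \<notin> act \<longrightarrow> c $ i = 0" using c(2) \<delta>3(2) xp(3) by (metis less_irrefl mult_eq_0_iff)
      from R(3)[THEN bspec, OF xp(1), THEN spec, THEN mp, OF this] obtain c' where c': "\<And>i. 0 \<le> c' $ i * c $ i" "\<And>i. c $ i = 0 \<Longrightarrow> c' $ i = 0"
        "comb ?D c' = comb ?D c" "norm c' \<le> R * norm (comb ?D c)" by blast
      define b where "b = norm (p - y)"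
      have b: "b > 0" using False by (simp add: b_def)
      have cb: "comb ?D c = - (2 *\<^sub>R (p - y))" using c(3) by (simp add: eq_neg_iff_add_eq_0 add.commute)
      have nc': "norm c' \<le> 2 * R * b" using c'(4) by (simp add: cb b_def)
      have c'p: "c' $ i * g (x, p) $ i = 0" for i using c(2)[of i] c'(2)[of i] by auto
      let ?w = "\<lambda>i. \<bar>viol K i (g (x, y) $ i)\<bar>"
      have summand: "c' $ i * (?D i \<bullet> (y - p)) \<le> 2 * R * b * (?w i + e * b)" for i
      proof -
        have s: "\<bar>g (x, y) $ i - g (x, p) $ i - ?D i \<bullet> (y - p)\<bar> \<le> e * b"
          using \<delta>4(2)[OF xy xp(4) xp(4), of i]
          by (simp add: b_def inner_prod_def norm_minus_commute norm_Pair)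
        \<comment> \<open>On \<open>K\<close> the coefficient has no sign but the residual is
          two-sided; off \<open>K\<close> the coefficient is nonnegative, so satisfied inequalities
          do not contribute positively.\<close>
        have "c' $ i * g (x, y) $ i \<le> \<bar>c' $ i\<bar> * ?w i"
        proof (cases "i \<in> K")
          case True
          then show ?thesis using abs_ge_self[of "c' $ i * g (x, y) $ i"] by (simp add: viol_def abs_mult)
        next
          case False
          then have "0 \<le> c' $ i" using c(1)[of i] c'(1)[of i] c'(2)[of i]
            by (metis less_eq_real_def linorder_not_less mult_neg_pos)
          then show ?thesis using False by (simp add: viol_def mult_left_mono)
        qed
        moreover have "c' $ i * (?D i \<bullet> (y - p)) - c' $ i * g (x, y) $ i \<le> \<bar>c' $ i\<bar> * (e * b)"
        proof -
          have "c' $ i * (?D i \<bullet> (y - p)) - c' $ i * g (x, y) $ i = - c' $ i * (g (x, y) $ i - g (x, p) $ i - ?D i \<bullet> (y - p))"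
            using c'p[of i] by (simp add: algebra_simps)
          also have "\<dots> \<le> \<bar>c' $ i\<bar> * \<bar>g (x, y) $ i - g (x, p) $ i - ?D i \<bullet> (y - p)\<bar>"
            using abs_ge_self[of "- c' $ i * (g (x, y) $ i - g (x, p) $ i - ?D i \<bullet> (y - p))"]
            by (simp only: abs_mult abs_minus_cancel)
          also have "\<dots> \<le> \<bar>c' $ i\<bar> * (e * b)" using s by (intro mult_left_mono) auto
          finally show ?thesis .
        qed
        ultimately have "c' $ i * (?D i \<bullet> (y - p)) \<le> \<bar>c' $ i\<bar> * (?w i + e * b)" by (simp add: algebra_simps)
        also have "\<dots> \<le> 2 * R * b * (?w i + e * b)"
          using component_le_norm_cart[of c' i] nc' e b by (intro mult_right_mono) auto
        finally show ?thesis .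
      qed
      have "2 * b\<^sup>2 = comb ?D c' \<bullet> (y - p)"
        by (simp add: c'(3) cb b_def power2_norm_eq_inner inner_diff algebra_simps)
      also have "\<dots> \<le> (\<Sum>i\<in>UNIV. 2 * R * b * (?w i + e * b))"
        unfolding inner_comb by (intro sum_mono summand)
      also have "\<dots> = 2 * R * b * ((\<Sum>i\<in>UNIV. ?w i) + N * e * b)"
        by (simp add: sum_distrib_left[symmetric] sum.distrib N_def)
      finally have "b * b \<le> b * (R * ((\<Sum>i\<in>UNIV. ?w i) + N * e * b))" by (simp add: power2_eq_square mult.left_commute)
      then have "b \<le> R * ((\<Sum>i\<in>UNIV. ?w i) + N * e * b)" using b by simp
      also have "\<dots> = R * (\<Sum>i\<in>UNIV. ?w i) + b / 2" using R N by (simp add: e_def field_simps)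
      finally show ?thesis using p(1) by (intro exI[of _ p]) (auto simp: C_def b_def)
    qed
  qed
  then show ?thesis unfolding error_bound_at_def using \<delta> R(1) by (intro exI[of _ "2 * R"] conjI exI[of _ \<delta>]) auto
qed

text \<open>Each solution near \<open>z0\<close> has a multiplier by \<open>kkt_slice\<close> with
  no equations. Only the reduced one is bounded, by \<open>R\<close> times the gradient of
  \<open>f\<close>; the full multiplier set may be unbounded.\<close>

lemma bounded_multipliers:
  "\<exists>R>0. \<exists>\<delta>>0. \<forall>x y. (x, y) \<in> ball z0 \<delta> \<longrightarrow> y \<in> S x \<longrightarrow> (\<exists>lam\<in>mult (x, y). norm lam \<le> R)"
proof -
  obtain R \<delta>1 where R: "R > 0" "\<delta>1 > 0" "\<forall>z\<in>ball z0 \<delta>1. \<forall>c. (\<forall>i. i \<notin> act \<longrightarrow> c $ i = 0) \<longrightarrow>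
    (\<exists>c'. (\<forall>i. 0 \<le> c' $ i * c $ i) \<and> (\<forall>i. c $ i = 0 \<longrightarrow> c' $ i = 0) \<and>
      comb (\<lambda>i. snd (Dg z i)) c' = comb (\<lambda>i. snd (Dg z i)) c \<and>
      norm c' \<le> R * norm (comb (\<lambda>i. snd (Dg z i)) c))"
    using comb_reduce_near by (elim exE conjE) (rule that)
  obtain \<delta>2 where \<delta>2: "\<delta>2 > 0" "\<And>x y. (x, y) \<in> ball z0 \<delta>2 \<Longrightarrow> (\<forall>\<^sub>F y' in nhds y. \<forall>J\<subseteq>{i. g (x, y) $ i = 0}.
     indep_family (\<lambda>i. snd (Dg (x, y') i)) J \<longrightarrow> indep_family (\<lambda>i. snd (Dg (x, y) i)) J)"
    using persistence_near by blast
  obtain \<delta>3 where \<delta>3: "\<delta>3 > 0" "\<forall>z\<in>ball z0 \<delta>3. \<forall>i. i \<notin> act \<longrightarrow> g z $ i < 0"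
    using inactive_near by blast
  obtain \<delta>4 where \<delta>4: "\<delta>4 > 0" "\<And>z. dist z z0 < \<delta>4 \<Longrightarrow> dist (Df z) (Df z0) < 1"
    using isCont_Df[of z0] unfolding continuous_at_eps_delta by (metis zero_less_one)
  define \<delta> where "\<delta> = min (min \<delta>1 \<delta>2) (min \<delta>3 \<delta>4)"
  have "\<exists>lam\<in>mult (x, y). norm lam \<le> R * (norm (Df z0) + 1)" if xy: "(x, y) \<in> ball z0 \<delta>" "y \<in> S x" for x y
  proof -
    have b: "(x, y) \<in> ball z0 \<delta>1" "(x, y) \<in> ball z0 \<delta>2" "(x, y) \<in> ball z0 \<delta>3" "dist (x, y) z0 < \<delta>4"
      using xy(1) by (auto simp: \<delta>_def dist_commute)
    let ?D = "\<lambda>i. snd (Dg (x, y) i)"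
    have "\<exists>c. (\<forall>i. i \<notin> {} \<longrightarrow> 0 \<le> c $ i) \<and> (\<forall>i. c $ i * g (x, y) $ i = 0) \<and> snd (Df (x, y)) + comb ?D c = 0"
    proof (rule kkt_slice[OF \<delta>2(2)[OF b(2)] GDERIV_slice_snd[OF Df]])
      show "isCont (\<lambda>y. snd (Df (x, y))) y"
        by (intro continuous_snd isCont_o2[where g = Df, OF _ isCont_Df] continuous_intros)
    qed (use xy(2) in \<open>auto simp: viol_empty_iff sol_map_iff\<close>)
    then obtain c where c: "\<And>i. 0 \<le> c $ i" "\<And>i. c $ i * g (x, y) $ i = 0" "snd (Df (x, y)) + comb ?D c = 0"
      by auto
    have "\<forall>i. i \<notin> act \<longrightarrow> c $ i = 0" using c(2) \<delta>3(2) b(3) by (metis less_irrefl mult_eq_0_iff)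
    from R(3)[THEN bspec, OF b(1), THEN spec, THEN mp, OF this] obtain c' where c': "\<And>i. 0 \<le> c' $ i * c $ i" "\<And>i. c $ i = 0 \<Longrightarrow> c' $ i = 0"
      "comb ?D c' = comb ?D c" "norm c' \<le> R * norm (comb ?D c)" by blast
    have "comb ?D c = - snd (Df (x, y))" using c(3) by (simp add: eq_neg_iff_add_eq_0 add.commute)
    then have "norm (comb ?D c) \<le> norm (Df (x, y))" by (metis norm_minus_cancel norm_snd_le prod.collapse)
    also have "\<dots> \<le> norm (Df z0) + 1"
      using \<delta>4(2)[OF b(4)] norm_triangle_ineq2[of "Df (x, y)" "Df z0"] by (simp add: dist_norm)
    finally have "norm c' \<le> R * (norm (Df z0) + 1)" using c'(4) R(1)
      by (meson order_trans mult_left_mono less_imp_le)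
    moreover have "c' \<in> mult (x, y)"
    proof -
      have "0 \<le> c' $ i" for i using c(1)[of i] c'(1)[of i] c'(2)[of i]
        by (metis less_eq_real_def linorder_not_less mult_neg_pos)
      moreover have "c' $ i * g (x, y) $ i = 0" for i using c(2)[of i] c'(2)[of i] by auto
      ultimately show ?thesis using c(3) c'(3) by (simp add: mult_def DL_def snd_comb)
    qed
    ultimately show ?thesis by blast
  qed
  moreover have "R * (norm (Df z0) + 1) > 0" using R(1) by (simp add: add_nonneg_pos)
  moreover have "\<delta> > 0" using R \<delta>2 \<delta>3 \<delta>4 by (simp add: \<delta>_def)
  ultimately show ?thesis by blast
qed

end

section \<open>First order expansions of the value function\<close>

context regular_lower_level
begin

text \<open>Let \<open>K\<close> be the support of \<open>lam\<close>. A solution \<open>y'\<close>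
  at \<open>x'\<close> is moved to a point \<open>p\<close> of the slice at \<open>x\<close> where
  the constraints in \<open>K\<close> are equations, so that \<open>V x\<close> is at most the
  Lagrangian at \<open>(x, p)\<close>. The slack \<open>s\<close> of \<open>y'\<close> in the
  constraints of \<open>K\<close> need not be of order \<open>norm (x' - x)\<close>, but it raises
  \<open>V x'\<close> above the Lagrangian by at least \<open>c * s\<close>, and this gain pays for
  the part of the displacement caused by \<open>s\<close>.\<close>

lemma real_val_lower_expansion:
  "\<exists>\<delta>>0. \<forall>x y lam \<eta>. (x, y) \<in> ball z0 \<delta> \<longrightarrow> y \<in> S x \<longrightarrow> lam \<in> mult (x, y) \<longrightarrow> \<eta> > 0 \<longrightarrow>
    (\<exists>\<rho>>0. \<forall>x' y'. (x', y') \<in> ball (x, y) \<rho> \<longrightarrow> y' \<in> S x' \<longrightarrow>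
       fst (DL lam (x, y)) \<bullet> (x' - x) - \<eta> * norm (x' - x) \<le> V x' - V x)"
proof -
  obtain M \<delta>1 where M: "M > 0" "\<delta>1 > 0" and eb: "error_bound_at M \<delta>1"
    using error_bound by blast
  obtain \<delta>2 where \<delta>2: "\<delta>2 > 0" "\<forall>z\<in>ball z0 \<delta>2. \<forall>i. i \<notin> act \<longrightarrow> g z $ i < 0"
    using inactive_near by blast
  define N where "N = real CARD('p)"
  have N: "N > 0" by (simp add: N_def)
  have "\<exists>\<rho>>0. \<forall>x' y'. (x', y') \<in> ball (x, y) \<rho> \<longrightarrow> y' \<in> S x' \<longrightarrow>
       fst (DL lam (x, y)) \<bullet> (x' - x) - \<eta> * norm (x' - x) \<le> V x' - V x"
    if xy: "(x, y) \<in> ball z0 (min \<delta>1 \<delta>2)" and sol: "y \<in> S x" and lam: "lam \<in> mult (x, y)" and \<eta>: "\<eta> > 0" for x y lam \<eta>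
  proof -
    let ?z = "(x, y)"
    define K where "K = {i. lam $ i \<noteq> 0}"
    have lam0: "0 \<le> lam $ i" "lam $ i * g ?z $ i = 0" "snd (DL lam ?z) = 0" for i
      using lam by (auto simp: mult_def)
    have gK: "g ?z $ i = 0" if "i \<in> K" for i using lam0(2)[of i] that by (simp add: K_def)
    have "K \<subseteq> act" using gK \<delta>2(2) xy by force
    have gle: "g ?z $ i \<le> 0" for i using sol by (simp add: sol_map_iff)
    \<comment> \<open>The smallest positive multiplier; the inserted 1 covers an empty
      support.\<close>
    define c where "c = Min (insert 1 ((\<lambda>i. lam $ i) ` K))"
    have c: "c > 0" unfolding c_def using lam0(1) by (subst Min_gr_iff) (auto simp: K_def less_le)
    have cK: "c \<le> lam $ i" if "i \<in> K" for i unfolding c_def using that by (intro Min_le) auto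
    obtain C \<rho>1 where C: "C > 0" "\<rho>1 > 0"
      "\<And>i z z'. z \<in> ball ?z \<rho>1 \<Longrightarrow> z' \<in> ball ?z \<rho>1 \<Longrightarrow> \<bar>g z $ i - g z' $ i\<bar> \<le> C * norm (z - z')"
      using GDERIV_family_lipschitz[where h = g and D = Dg, OF Dg isCont_Dg] by blast
    \<comment> \<open>The first bound turns the error proportional to \<open>norm (x' - x)\<close>
      into \<open>\<eta>\<close>, the second makes the error caused by the slack at most
      \<open>c * s\<close>.\<close>
    define e where "e = min (\<eta> / (1 + M * N * C)) (c / M)"
    have pos: "1 + M * N * C > 0" using M N C by (simp add: add_pos_pos)
    have e: "e > 0" using \<eta> c M pos by (simp add: e_def)
    have e1: "e * (1 + M * N * C) \<le> \<eta>" and e2: "e * M \<le> c"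
    proof -
      have "e \<le> \<eta> / (1 + M * N * C)" by (simp add: e_def)
      then show "e * (1 + M * N * C) \<le> \<eta>" using pos by (simp add: pos_le_divide_eq)
      have "e \<le> c / M" by (simp add: e_def)
      then show "e * M \<le> c" using M by (simp add: pos_le_divide_eq)
    qed
    obtain \<rho>2 where \<rho>2: "\<rho>2 > 0" "\<And>z z' w. z\<in>ball ?z \<rho>2 \<Longrightarrow> z'\<in>ball ?z \<rho>2 \<Longrightarrow> w\<in>ball ?z \<rho>2 \<Longrightarrow>
      \<bar>lag lam z - lag lam z' - DL lam w \<bullet> (z - z')\<bar> \<le> e * norm (z - z')"
      using GDERIV_strict[OF GDERIV_lag isCont_DL e] by blast
    have "((\<lambda>z. \<Sum>i\<in>UNIV. \<bar>viol K i (g z $ i)\<bar>) \<longlongrightarrow> (\<Sum>i\<in>UNIV. \<bar>viol K i (g ?z $ i)\<bar>)) (nhds ?z)"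
    proof (intro tendsto_sum tendsto_rabs)
      fix i
      have "((\<lambda>z. g z $ i) \<longlongrightarrow> g ?z $ i) (nhds ?z)"
        using isCont_g[where i = i and z = ?z] tendsto_at_iff_tendsto_nhds[of "\<lambda>z. g z $ i" ?z]
        by (simp add: isCont_def)
      then show "((\<lambda>z. viol K i (g z $ i)) \<longlongrightarrow> viol K i (g ?z $ i)) (nhds ?z)"
        by (rule continuous_on_tendsto_compose[OF continuous_viol]) auto
    qed
    moreover have "viol K i (g ?z $ i) = 0" for i using gK gle by (auto simp: viol_def)
    ultimately have "((\<lambda>z. \<Sum>i\<in>UNIV. \<bar>viol K i (g z $ i)\<bar>) \<longlongrightarrow> 0) (nhds ?z)" by simp
    from order_tendstoD(2)[OF this, of "\<rho>2 / (2 * M)"] \<rho>2(1) M(1)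
    obtain \<rho>3 where \<rho>3: "\<rho>3 > 0" "\<And>z. z \<in> ball ?z \<rho>3 \<Longrightarrow> (\<Sum>i\<in>UNIV. \<bar>viol K i (g z $ i)\<bar>) < \<rho>2 / (2 * M)"
      unfolding eventually_nhds_ball by auto
    \<comment> \<open>Room around \<open>(x, y)\<close> inside the ball of the error bound, so that
      \<open>(x, y')\<close> still lies in it.\<close>
    define \<rho>4 where "\<rho>4 = \<delta>1 - dist z0 ?z"
    have \<rho>4: "\<rho>4 > 0" using xy by (simp add: \<rho>4_def)
    define \<rho> where "\<rho> = min (min \<rho>1 (\<rho>2/2)) (min \<rho>3 \<rho>4)"
    have \<rho>: "\<rho> > 0" using C \<rho>2 \<rho>3 \<rho>4 by (simp add: \<rho>_def)
    have "fst (DL lam ?z) \<bullet> (x' - x) - \<eta> * norm (x' - x) \<le> V x' - V x"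
      if xy': "(x', y') \<in> ball ?z \<rho>" and sol': "y' \<in> S x'" for x' y'
    proof -
      define a where "a = norm (x' - x)"
      have a: "a \<ge> 0" by (simp add: a_def)
      have dy: "dist (x, y) (x, y') < \<rho>"
        using xy' dist_snd_le[of "(x, y)" "(x', y')"] by (simp add: dist_Pair_Pair[of x y x y'])
      have in1: "(x, y') \<in> ball ?z \<rho>1" "(x', y') \<in> ball ?z \<rho>1" and in2: "(x', y') \<in> ball ?z \<rho>2"
        and in3: "(x, y') \<in> ball ?z \<rho>3" using dy xy' \<rho> by (auto simp: \<rho>_def)
      have "(x, y') \<in> ball z0 \<delta>1"
        using dist_triangle[of z0 "(x, y')" ?z] dy by (auto simp: \<rho>_def \<rho>4_def)
      moreover have "?z \<in> ball z0 \<delta>1" using xy by auto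
      moreover have "\<forall>i. viol K i (g ?z $ i) = 0" using gK gle by (auto simp: viol_def)
      ultimately obtain p where p: "\<And>i. viol K i (g (x, p) $ i) = 0"
        "norm (p - y') \<le> M * (\<Sum>i\<in>UNIV. \<bar>viol K i (g (x, y') $ i)\<bar>)"
        using eb \<open>K \<subseteq> act\<close> unfolding error_bound_at_def by meson
      let ?g' = "\<lambda>i. g (x', y') $ i"
      have g'le: "?g' i \<le> 0" for i using sol' by (simp add: sol_map_iff)
      define s where "s = (\<Sum>i\<in>UNIV. if i \<in> K then - ?g' i else 0)"
      have lip: "\<bar>g (x, y') $ i - ?g' i\<bar> \<le> C * a" for i
        using C(3)[OF in1, of i] by (simp add: a_def norm_Pair norm_minus_commute)
      have "\<bar>viol K i (g (x, y') $ i)\<bar> \<le> C * a + (if i \<in> K then - ?g' i else 0)" for i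
        using lip[of i] g'le[of i] by (auto simp: viol_def)
      then have "(\<Sum>i\<in>UNIV. \<bar>viol K i (g (x, y') $ i)\<bar>) \<le> (\<Sum>i\<in>UNIV. C * a + (if i \<in> K then - ?g' i else 0))"
        by (rule sum_mono)
      also have "\<dots> = N * C * a + s" by (simp add: sum.distrib s_def N_def)
      finally have "norm (p - y') \<le> M * (N * C * a + s)"
        using p(2) M(1) by (meson mult_left_mono less_imp_le order_trans)
      then have pb: "norm (p - y') \<le> M * N * C * a + M * s" by (simp add: algebra_simps)
      have "norm (p - y') < \<rho>2 / 2"
      proof -
        have "M * (\<Sum>i\<in>UNIV. \<bar>viol K i (g (x, y') $ i)\<bar>) < M * (\<rho>2 / (2 * M))"
          using \<rho>3(2)[OF in3] M(1) by (intro mult_strict_left_mono)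
        then show ?thesis using p(2) M(1) by simp
      qed
      moreover have "dist (x, y) (x, p) \<le> dist (x, y) (x, y') + norm (p - y')"
        using dist_triangle[of y p y'] by (simp add: dist_Pair_Pair dist_norm norm_minus_commute)
      ultimately have xp: "(x, p) \<in> ball ?z \<rho>2" using dy by (simp add: \<rho>_def)
      have lg: "lam $ i * g (x, p) $ i = 0" for i
        using viol_0_imp(2)[OF p(1)[of i]] by (auto simp: K_def)
      have "V x \<le> f (x, p)" using sol viol_0_imp(1)[OF p(1)] by (intro real_val_le) auto
      also have "f (x, p) = lag lam (x, p)" by (simp add: lag_def lg)
      finally have 1: "V x \<le> lag lam (x, p)" .
      have "c * s \<le> (\<Sum>i\<in>UNIV. lam $ i * (- ?g' i))"
        unfolding s_def sum_distrib_left
      proof (rule sum_mono)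
        fix i show "c * (if i \<in> K then - ?g' i else 0) \<le> lam $ i * (- ?g' i)"
        proof (cases "i \<in> K")
          case True
          then show ?thesis using mult_right_mono[OF cK[OF True], of "- ?g' i"] g'le[of i] by simp
        next
          case False
          then show ?thesis by (simp add: K_def)
        qed
      qed
      then have 2: "lag lam (x', y') + c * s \<le> V x'"
        by (simp add: real_val_sol[OF sol'] lag_def sum_negf)
      have "norm ((x', y') - (x, p)) \<le> a + norm (p - y')"
        using norm_Pair_le[of "x' - x" "y' - p"] by (simp add: a_def norm_minus_commute)
      also have "\<dots> \<le> (1 + M * N * C) * a + M * s" using pb by (simp add: algebra_simps)
      finally have "e * norm ((x', y') - (x, p)) \<le> e * ((1 + M * N * C) * a + M * s)"
        using e by (intro mult_left_mono) auto
      also have "\<dots> \<le> \<eta> * a + c * s"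
      proof -
        have "s \<ge> 0" unfolding s_def using g'le by (intro sum_nonneg) auto
        then show ?thesis using mult_right_mono[OF e1 a] mult_right_mono[OF e2, of s] by (simp add: algebra_simps)
      qed
      finally have 3: "e * norm ((x', y') - (x, p)) \<le> \<eta> * a + c * s" .
      have "\<bar>lag lam (x', y') - lag lam (x, p) - DL lam ?z \<bullet> ((x', y') - (x, p))\<bar> \<le> e * norm ((x', y') - (x, p))"
        using \<rho>2 by (intro \<rho>2(2) in2 xp) auto
      \<comment> \<open>Stationarity in y removes the displacement from \<open>p\<close> to
        \<open>y'\<close> from the linear term; it only enters the remainder.\<close>
      moreover have "DL lam ?z \<bullet> ((x', y') - (x, p)) = fst (DL lam ?z) \<bullet> (x' - x)"
        using lam0(3) by (simp add: inner_prod_def)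
      ultimately show ?thesis using 1 2 3 by (simp add: a_def)
    qed
    then show ?thesis using \<rho> by blast
  qed
  then show ?thesis using M(2) \<delta>2(1) by (intro exI[of _ "min \<delta>1 \<delta>2"]) auto
qed

text \<open>Mirror image of the lower expansion: now \<open>y0\<close> is moved to the slice at
  \<open>x\<close>, with the constraints in \<open>K\<close> as equations. The displacement is of
  order \<open>norm (x - x0)\<close> since those constraints are active at \<open>z0\<close>, and on
  both ends \<open>f\<close> equals the Lagrangian.\<close>

lemma real_val_upper_expansion:
  assumes lam: "snd (DL lam z0) = 0" "\<And>i. i \<notin> K \<Longrightarrow> lam $ i = 0" and K: "K \<subseteq> act" and \<eta>: "\<eta> > 0"
  shows "\<exists>\<rho>>0. \<forall>x y. (x, y) \<in> ball z0 \<rho> \<longrightarrow> y \<in> S x \<longrightarrow> (\<forall>i\<in>K. g (x, y) $ i = 0) \<longrightarrow>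
       V x - V x0 \<le> fst (DL lam z0) \<bullet> (x - x0) + \<eta> * norm (x - x0)"
proof -
  obtain M \<delta>1 where M: "M > 0" "\<delta>1 > 0" and eb: "error_bound_at M \<delta>1"
    using error_bound by blast
  define N where "N = real CARD('p)"
  have N: "N > 0" by (simp add: N_def)
  obtain C \<rho>1 where C: "C > 0" "\<rho>1 > 0"
    "\<And>i z z'. z \<in> ball z0 \<rho>1 \<Longrightarrow> z' \<in> ball z0 \<rho>1 \<Longrightarrow> \<bar>g z $ i - g z' $ i\<bar> \<le> C * norm (z - z')"
    using GDERIV_family_lipschitz[where h = g and D = Dg, OF Dg isCont_Dg] by blast
  have pos: "1 + M * N * C > 0" using M N C by (simp add: add_pos_pos)
  define e where "e = \<eta> / (1 + M * N * C)"
  have e: "e > 0" using \<eta> pos by (simp add: e_def)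
  obtain \<rho>2 where \<rho>2: "\<rho>2 > 0" "\<And>z z' w. z\<in>ball z0 \<rho>2 \<Longrightarrow> z'\<in>ball z0 \<rho>2 \<Longrightarrow> w\<in>ball z0 \<rho>2 \<Longrightarrow>
      \<bar>lag lam z - lag lam z' - DL lam w \<bullet> (z - z')\<bar> \<le> e * norm (z - z')"
    using GDERIV_strict[OF GDERIV_lag isCont_DL e] by blast
  define \<rho> where "\<rho> = min (min \<delta>1 \<rho>1) (\<rho>2 / (1 + M * N * C))"
  have \<rho>: "\<rho> > 0" using C \<rho>2 M pos by (simp add: \<rho>_def)
  have "V x - V x0 \<le> fst (DL lam z0) \<bullet> (x - x0) + \<eta> * norm (x - x0)"
    if xy: "(x, y) \<in> ball z0 \<rho>" and sol: "y \<in> S x" and gK: "\<And>i. i \<in> K \<Longrightarrow> g (x, y) $ i = 0" for x y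
  proof -
    define a where "a = norm (x - x0)"
    have "a \<le> dist z0 (x, y)" using dist_fst_le[of z0 "(x, y)"] by (simp add: a_def dist_norm norm_minus_commute)
    then have a: "0 \<le> a" "a < \<rho>" using xy by (auto simp: a_def)
    have dx: "dist z0 (x, y0) = a" by (simp add: a_def dist_Pair_Pair dist_norm norm_minus_commute)
    \<comment> \<open>The solution \<open>y\<close> serves only as the witness that the system with
      equations in \<open>K\<close> has a point near \<open>z0\<close>.\<close>
    have "\<exists>p. (\<forall>i. viol K i (g (x, p) $ i) = 0) \<and> norm (p - y0) \<le> M * (\<Sum>i\<in>UNIV. \<bar>viol K i (g (x, y0) $ i)\<bar>)"
    proof (rule eb[unfolded error_bound_at_def, rule_format, OF K])
      show "(x, y0) \<in> ball z0 \<delta>1" "(x, y) \<in> ball z0 \<delta>1" using a dx xy by (auto simp: \<rho>_def)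
      show "viol K i (g (x, y) $ i) = 0" for i using gK sol by (auto simp: viol_def sol_map_iff)
    qed
    then obtain p where p: "\<And>i. viol K i (g (x, p) $ i) = 0"
      "norm (p - y0) \<le> M * (\<Sum>i\<in>UNIV. \<bar>viol K i (g (x, y0) $ i)\<bar>)" by blast
    have "\<bar>viol K i (g (x, y0) $ i)\<bar> \<le> C * a" for i
    proof -
      have "\<bar>g (x, y0) $ i - g z0 $ i\<bar> \<le> C * norm ((x, y0) - z0)"
        using a dx C(2) by (intro C(3)) (auto simp: \<rho>_def)
      then have "\<bar>g (x, y0) $ i - g z0 $ i\<bar> \<le> C * a" by (simp add: a_def norm_Pair)
      moreover have "g z0 $ i = 0" if "i \<in> K" using K that by (auto simp: active_def)
      ultimately show ?thesis using g0_le[of i] by (auto simp: viol_def)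
    qed
    then have "(\<Sum>i\<in>UNIV. \<bar>viol K i (g (x, y0) $ i)\<bar>) \<le> (\<Sum>i\<in>(UNIV::'p set). C * a)" by (intro sum_mono)
    then have "(\<Sum>i\<in>UNIV. \<bar>viol K i (g (x, y0) $ i)\<bar>) \<le> N * C * a" by (simp add: N_def)
    then have "norm (p - y0) \<le> M * (N * C * a)" using p(2) M(1) by (meson mult_left_mono less_imp_le order_trans)
    moreover have "norm ((x, p) - z0) \<le> a + norm (p - y0)"
      using norm_Pair_le[of "x - x0" "p - y0"] by (simp add: a_def)
    ultimately have nb: "norm ((x, p) - z0) \<le> (1 + M * N * C) * a" by (simp add: algebra_simps)
    also have "\<dots> < \<rho>2"
    proof -
      have "a < \<rho>2 / (1 + M * N * C)" using a by (simp add: \<rho>_def)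
      then show ?thesis using pos by (simp add: pos_less_divide_eq mult.commute)
    qed
    finally have xp: "(x, p) \<in> ball z0 \<rho>2" by (simp only: mem_ball dist_norm norm_minus_commute[of z0])
    have lg: "lam $ i * g (x, p) $ i = 0" "lam $ i * g z0 $ i = 0" for i
      using viol_0_imp(2)[OF p(1)[of i]] lam(2)[of i] K by (auto simp: active_def)
    have "V x \<le> f (x, p)" using sol viol_0_imp(1)[OF p(1)] by (intro real_val_le) auto
    also have "f (x, p) = lag lam (x, p)" by (simp add: lag_def lg)
    finally have 1: "V x \<le> lag lam (x, p)" .
    have 2: "V x0 = lag lam z0" by (simp add: real_val_sol[OF sol0] lag_def lg)
    have "e * norm ((x, p) - z0) \<le> e * ((1 + M * N * C) * a)" using nb e by (intro mult_left_mono) auto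
    also have "\<dots> = \<eta> * a" using pos by (simp add: e_def)
    finally have 3: "e * norm ((x, p) - z0) \<le> \<eta> * a" .
    have "\<bar>lag lam (x, p) - lag lam z0 - DL lam z0 \<bullet> ((x, p) - z0)\<bar> \<le> e * norm ((x, p) - z0)"
      using \<rho>2 by (intro \<rho>2(2) xp) auto
    moreover have "DL lam z0 \<bullet> ((x, p) - z0) = fst (DL lam z0) \<bullet> (x - x0)"
      using lam(1) by (simp add: inner_prod_def)
    ultimately show ?thesis using 1 2 3 by (simp add: a_def)
  qed
  then show ?thesis using \<rho> by blast
qed

text \<open>Limits of multipliers are multipliers of the base point, and along the sequence itself
  they also give an upper estimate of \<open>V\<close>, which a general multiplier of
  \<open>z0\<close> does not.\<close>

lemma multiplier_limit:
  assumes z: "xk \<longlonglongrightarrow> x0" "yk \<longlonglongrightarrow> y0" and sol: "\<And>k. yk k \<in> S (xk k)"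
    and lam: "\<And>k. lamk k \<in> mult (xk k, yk k)" "lamk \<longlonglongrightarrow> lam"
  shows "lam \<in> mult z0"
    and "\<eta> > 0 \<Longrightarrow> \<forall>\<^sub>F k in sequentially.
      V (xk k) - V x0 \<le> fst (DL lam z0) \<bullet> (xk k - x0) + \<eta> * norm (xk k - x0)"
proof -
  have zk: "(\<lambda>k. (xk k, yk k)) \<longlonglongrightarrow> z0" by (intro tendsto_intros z)
  have li: "(\<lambda>k. lamk k $ i) \<longlonglongrightarrow> lam $ i" for i using lam(2) by (rule tendsto_vec_nth)
  have gk: "(\<lambda>k. g (xk k, yk k) $ i) \<longlonglongrightarrow> g z0 $ i" for i
    by (rule isCont_tendsto_compose[OF isCont_g zk])
  have "0 \<le> lam $ i" for i
    using li by (rule LIMSEQ_le_const) (use lam(1) in \<open>auto simp: mult_def\<close>)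
  moreover have lg: "lam $ i * g z0 $ i = 0" for i
  proof -
    have "(\<lambda>k. lamk k $ i * g (xk k, yk k) $ i) \<longlonglongrightarrow> lam $ i * g z0 $ i" by (intro tendsto_intros li gk)
    moreover have "lamk k $ i * g (xk k, yk k) $ i = 0" for k using lam(1)[of k] by (auto simp: mult_def)
    ultimately have "(\<lambda>k::nat. 0) \<longlonglongrightarrow> lam $ i * g z0 $ i" by simp
    then show ?thesis by (simp only: LIMSEQ_const_iff)
  qed
  moreover have s0: "snd (DL lam z0) = 0"
  proof -
    have "(\<lambda>k. snd (DL (lamk k) (xk k, yk k))) \<longlonglongrightarrow> snd (DL lam z0)"
      by (intro tendsto_snd tendsto_DL lam(2) zk)
    moreover have "snd (DL (lamk k) (xk k, yk k)) = 0" for k using lam(1)[of k] by (auto simp: mult_def)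
    ultimately have "(\<lambda>k::nat. 0) \<longlonglongrightarrow> snd (DL lam z0)" by simp
    then show ?thesis by (simp only: LIMSEQ_const_iff)
  qed
  ultimately show "lam \<in> mult z0" by (simp add: mult_def)
  \<comment> \<open>An index with nonzero limit multiplier has a nonzero multiplier on a tail of the
    sequence, so complementarity turns the constraint into an equation there: exactly the side
    condition of the upper expansion.\<close>
  define K where "K = {i. lam $ i \<noteq> 0}"
  have K: "K \<subseteq> act" using lg by (auto simp: K_def active_def)
  assume "\<eta> > 0"
  then obtain \<rho> where \<rho>: "\<rho> > 0" "\<And>x y. (x, y) \<in> ball z0 \<rho> \<Longrightarrow> y \<in> S x \<Longrightarrow> (\<forall>i\<in>K. g (x, y) $ i = 0) \<Longrightarrow>
       V x - V x0 \<le> fst (DL lam z0) \<bullet> (x - x0) + \<eta> * norm (x - x0)"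
    using real_val_upper_expansion[OF s0 _ K, of \<eta>] by (auto simp: K_def)
  have "\<forall>\<^sub>F k in sequentially. \<forall>i. i \<in> K \<longrightarrow> g (xk k, yk k) $ i = 0"
  proof (rule eventually_all_finite)
    fix i
    show "\<forall>\<^sub>F k in sequentially. i \<in> K \<longrightarrow> g (xk k, yk k) $ i = 0"
    proof (cases "i \<in> K")
      case True
      then have "\<forall>\<^sub>F k in sequentially. lamk k $ i \<noteq> 0"
        by (intro tendsto_imp_eventually_ne[OF li]) (simp add: K_def)
      then show ?thesis by eventually_elim (use lam(1) in \<open>auto simp: mult_def\<close>)
    qed simp
  qed
  moreover have "\<forall>\<^sub>F k in sequentially. (xk k, yk k) \<in> ball z0 \<rho>"
    using tendstoD[OF zk \<rho>(1)] by (simp add: dist_commute)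
  ultimately show "\<forall>\<^sub>F k in sequentially.
      V (xk k) - V x0 \<le> fst (DL lam z0) \<bullet> (xk k - x0) + \<eta> * norm (xk k - x0)"
    by eventually_elim (use \<rho>(2) sol in blast)
qed

end

section \<open>Directional derivative of the value function\<close>

text \<open>Points at small positive multiples of directions close to \<open>d\<close>; unlike \<open>dir_nbhd\<close> this
  is open, and no case distinction on \<open>d = 0\<close> is needed.\<close>

definition dcone :: "'a::real_normed_vector \<Rightarrow> real \<Rightarrow> 'a set" where
  "dcone d \<epsilon> = {t *\<^sub>R w | t w. 0 < t \<and> t < \<epsilon> \<and> norm (w - d) < \<epsilon>}"

section \<open>Calculus of conic neighbourhoods\<close>

lemma inverse_Suc_tendsto_0: "(\<lambda>n. 1 / (real n + 1)) \<longlonglongrightarrow> 0"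
  using LIMSEQ_Suc[OF lim_1_over_n] by (simp add: add.commute)

lemma dcone_mono: "\<epsilon> \<le> \<epsilon>' \<Longrightarrow> dcone d \<epsilon> \<subseteq> dcone d \<epsilon>'"
  unfolding dcone_def by force

lemma open_dcone: "open (dcone d \<epsilon>)"
proof -
  have "dcone d \<epsilon> = (\<Union>t\<in>{0<..<\<epsilon>}. (\<lambda>w. t *\<^sub>R w) ` ball d \<epsilon>)"
    by (force simp: dcone_def image_iff dist_norm norm_minus_commute)
  then show ?thesis by (auto intro!: open_UN open_scaling)
qed

lemma dcone_small:
  assumes "r > 0"
  shows "\<exists>\<epsilon>>0. \<forall>h\<in>dcone d \<epsilon>. norm h < r"
proof (intro exI conjI ballI)
  let ?\<epsilon> = "min 1 (r / (norm d + 1))"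
  have pos: "norm d + 1 > 0" by (simp add: add_nonneg_pos)
  then show "?\<epsilon> > 0" using assms by simp
  fix h assume "h \<in> dcone d ?\<epsilon>"
  then obtain t w where h: "h = t *\<^sub>R w" "0 < t" "t < ?\<epsilon>" "norm (w - d) < ?\<epsilon>" unfolding dcone_def by blast
  then have "norm w < norm d + 1" using norm_triangle_ineq2[of w d] by linarith
  then have "norm h \<le> t * (norm d + 1)" using h by simp
  also have "\<dots> < r" using h(3) pos by (simp add: pos_less_divide_eq)
  finally show "norm h < r" .
qed

lemma dcone_eventually:
  assumes "\<And>k. 0 < t k" "t \<longlonglongrightarrow> 0" "w \<longlonglongrightarrow> d" "\<epsilon> > 0"
  shows "\<forall>\<^sub>F k in sequentially. t k *\<^sub>R w k \<in> dcone d \<epsilon>"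
  using order_tendstoD(2)[OF assms(2,4)] tendstoD[OF assms(3,4)]
  by eventually_elim (use assms(1) in \<open>auto simp: dcone_def dist_norm\<close>)

lemma dcone_sequence:
  assumes "\<And>k. h k \<in> dcone d (1 / (real k + 1))"
  obtains t w where "\<And>k. h k = t k *\<^sub>R w k" "\<And>k. 0 < t k" "t \<longlonglongrightarrow> 0" "w \<longlonglongrightarrow> d"
proof -
  have "\<forall>k. \<exists>t w. h k = t *\<^sub>R w \<and> 0 < t \<and> t < 1 / (real k + 1) \<and> norm (w - d) < 1 / (real k + 1)"
    using assms unfolding dcone_def by blast
  then obtain t w where tw: "\<And>k. h k = t k *\<^sub>R w k" "\<And>k. 0 < t k" "\<And>k. t k < 1 / (real k + 1)"
    "\<And>k. norm (w k - d) < 1 / (real k + 1)" by metis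
  have l: "(\<lambda>k. 1 / (real k + 1)) \<longlonglongrightarrow> 0" by (rule inverse_Suc_tendsto_0)
  have "t \<longlonglongrightarrow> 0"
    by (rule Lim_null_comparison[OF _ l]) (use tw(2,3) in \<open>auto intro!: always_eventually simp: less_imp_le\<close>)
  moreover have "(\<lambda>k. w k - d) \<longlonglongrightarrow> 0"
    by (rule Lim_null_comparison[OF _ l]) (use tw(4) in \<open>auto intro!: always_eventually simp: less_imp_le\<close>)
  ultimately show ?thesis using that[OF tw(1,2)] by (simp add: LIM_zero_cancel)
qed

lemma dcone_sequence_0: "\<lbrakk>t \<longlonglongrightarrow> 0; w \<longlonglongrightarrow> d\<rbrakk> \<Longrightarrow> (\<lambda>k. t k *\<^sub>R w k) \<longlonglongrightarrow> (0::'a::real_normed_vector)"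
  using tendsto_scaleR[of t 0 sequentially w d] by simp

text \<open>The assumption \<open>isc\<close> is sequential inner semi-continuity restated as a
  uniform property of a cone, obtained by contradiction in
  \<open>dir_inner_semicontinuous_dcone\<close>.\<close>

locale directional_lower_level = regular_lower_level f g Df Dg x0 y0
  for f :: "'a::euclidean_space \<times> 'b::euclidean_space \<Rightarrow> real"
    and g :: "'a \<times> 'b \<Rightarrow> real ^ 'p"
    and Df Dg x0 y0 +
  fixes u :: 'a
  assumes isc: "\<And>\<eta>. \<eta> > 0 \<Longrightarrow> \<exists>\<epsilon>>0. \<forall>h\<in>dcone u \<epsilon>. \<exists>y\<in>S (x0 + h). dist y y0 < \<eta>"
begin

text \<open>A radius fixed once and for all: multipliers extracted along different sequences and
  test directions must lie in one compact set, and \<open>dir_mult\<close> is defined through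
  it.\<close>

definition R_mult :: real where
  "R_mult = (SOME R. R > 0 \<and> (\<exists>\<delta>>0. \<forall>x y. (x, y) \<in> ball z0 \<delta> \<longrightarrow> y \<in> S x \<longrightarrow> (\<exists>lam\<in>mult (x, y). norm lam \<le> R)))"

lemma R_mult: "\<exists>\<delta>>0. \<forall>x y. (x, y) \<in> ball z0 \<delta> \<longrightarrow> y \<in> S x \<longrightarrow> (\<exists>lam\<in>mult (x, y). norm lam \<le> R_mult)"
  using someI_ex[OF bounded_multipliers] unfolding R_mult_def[symmetric] by blast

lemma near_solution:
  assumes r: "r > 0"
  shows "\<exists>\<epsilon>>0. \<forall>h\<in>insert 0 (dcone u \<epsilon>). \<exists>y\<in>S (x0 + h). (x0 + h, y) \<in> ball z0 r"
proof -
  obtain \<epsilon>1 where \<epsilon>1: "\<epsilon>1 > 0" "\<forall>h\<in>dcone u \<epsilon>1. \<exists>y\<in>S (x0 + h). dist y y0 < r / 2"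
    using isc[of "r/2"] r by auto
  obtain \<epsilon>2 where \<epsilon>2: "\<epsilon>2 > 0" "\<forall>h\<in>dcone u \<epsilon>2. norm h < r / 2" using dcone_small[of "r/2"] r by auto
  have "\<exists>y\<in>S (x0 + h). (x0 + h, y) \<in> ball z0 r" if "h \<in> insert 0 (dcone u (min \<epsilon>1 \<epsilon>2))" for h
  proof (cases "h = 0")
    case True
    then show ?thesis using sol0 r by (intro bexI[of _ y0]) auto
  next
    case False
    then have "h \<in> dcone u \<epsilon>1" "h \<in> dcone u \<epsilon>2"
      using that dcone_mono[of "min \<epsilon>1 \<epsilon>2" \<epsilon>1 u] dcone_mono[of "min \<epsilon>1 \<epsilon>2" \<epsilon>2 u] by auto
    then obtain y where y: "y \<in> S (x0 + h)" "dist y y0 < r / 2" "norm h < r / 2" using \<epsilon>1(2) \<epsilon>2(2) by blast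
    have "dist z0 (x0 + h, y) \<le> norm h + dist y y0"
      using norm_Pair_le[of "x0 - (x0 + h)" "y0 - y"] by (simp add: dist_norm norm_minus_commute)
    then show ?thesis using y by (intro bexI[of _ y]) auto
  qed
  then show ?thesis using \<epsilon>1(1) \<epsilon>2(1) by (intro exI[of _ "min \<epsilon>1 \<epsilon>2"]) auto
qed

text \<open>The expansions cannot give this, as their radius depends on the base point and its
  multiplier. The error bound without equations does: a solution \<open>y'\<close> at one parameter
  is moved to a feasible point at the other at a cost proportional to the parameter distance, and
  \<open>f\<close> is Lipschitz near \<open>z0\<close>.\<close>

lemma real_val_lipschitz:
  "\<exists>L>0. \<exists>\<epsilon>>0. \<forall>h\<in>insert 0 (dcone u \<epsilon>). S (x0 + h) \<noteq> {} \<and>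
     (\<forall>h'\<in>insert 0 (dcone u \<epsilon>). \<bar>V (x0 + h) - V (x0 + h')\<bar> \<le> L * norm (h - h'))"
proof -
  obtain M \<delta>1 where M: "M > 0" "\<delta>1 > 0" and eb: "error_bound_at M \<delta>1"
    using error_bound by blast
  define N where "N = real CARD('p)"
  have N: "N > 0" by (simp add: N_def)
  obtain C \<delta>2 where C: "C > 0" "\<delta>2 > 0"
    "\<And>i z z'. z \<in> ball z0 \<delta>2 \<Longrightarrow> z' \<in> ball z0 \<delta>2 \<Longrightarrow> \<bar>g z $ i - g z' $ i\<bar> \<le> C * norm (z - z')"
    using GDERIV_family_lipschitz[where h = g and D = Dg, OF Dg isCont_Dg] by blast
  define B where "B = norm (Df z0) + 1"
  have B: "B > 0" by (simp add: B_def add_nonneg_pos)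
  obtain \<delta>3 where \<delta>3: "\<delta>3 > 0" "\<And>z z'. z \<in> ball z0 \<delta>3 \<Longrightarrow> z' \<in> ball z0 \<delta>3 \<Longrightarrow> \<bar>f z - f z'\<bar> \<le> B * norm (z - z')"
    using GDERIV_local_lipschitz[OF Df isCont_Df] unfolding B_def by blast
  have pos: "1 + M * N * C > 0" using M N C by (simp add: add_pos_pos)
  \<comment> \<open>The mixed pair \<open>(x0 + h, y')\<close> lies within 2r of \<open>z0\<close>,
    and the corrected point within 2r(1 + MNC), which must stay where \<open>f\<close> is
    Lipschitz.\<close>
  define r where "r = min (min (\<delta>1 / 2) (\<delta>2 / 2)) (\<delta>3 / (4 * (1 + M * N * C)))"
  have r: "r > 0" using M C \<delta>3 pos by (simp add: r_def)
  have r3: "r * (4 * (1 + M * N * C)) \<le> \<delta>3"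
  proof -
    have "r \<le> \<delta>3 / (4 * (1 + M * N * C))" by (simp add: r_def)
    then show ?thesis using pos by (simp add: pos_le_divide_eq)
  qed
  have r12: "2 * r \<le> \<delta>1" "2 * r \<le> \<delta>2" by (auto simp: r_def)
  have MNC: "0 \<le> M * N * C" using M N C by (intro mult_nonneg_nonneg) auto
  then have "2 * r * 1 \<le> 2 * r * (2 * (1 + M * N * C))" using r by (intro mult_left_mono) auto
  then have r3': "2 * r \<le> \<delta>3" using r3 by linarith
  define L where "L = B * (1 + M * N * C)"
  have L: "L > 0" using B pos by (simp add: L_def)
  have main: "V (x0 + h) - V (x0 + h') \<le> L * norm (h - h')"
    if h: "y \<in> S (x0 + h)" "(x0 + h, y) \<in> ball z0 r" and h': "y' \<in> S (x0 + h')" "(x0 + h', y') \<in> ball z0 r" for h h' y y'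
  proof -
    define a where "a = norm (h - h')"
    have "norm ((x0 + h, y) - z0) < r" "norm ((x0 + h', y') - z0) < r"
      using h(2) h'(2) by (simp_all only: mem_ball dist_norm norm_minus_commute[of z0])
    then have hb: "norm h < r" "norm h' < r" "norm (y' - y0) < r"
      using norm_fst_le[of h "y - y0"] norm_fst_le[of h' "y' - y0"] norm_snd_le[of "y' - y0" h']
      by auto
    have a: "0 \<le> a" "a < 2 * r" using hb norm_triangle_ineq4[of h h'] by (auto simp: a_def)
    have "norm ((x0 + h, y') - z0) \<le> norm h + norm (y' - y0)" using norm_Pair_le[of h "y' - y0"] by simp
    then have "norm ((x0 + h, y') - z0) < 2 * r" using hb by linarith
    then have in1: "dist z0 (x0 + h, y') < 2 * r" by (simp only: dist_norm norm_minus_commute[of z0])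
    have in2: "dist z0 (x0 + h', y') < 2 * r" "dist z0 (x0 + h, y) < 2 * r" using h(2) h'(2) r by auto
    have "\<exists>p. (\<forall>i. viol {} i (g (x0 + h, p) $ i) = 0) \<and> norm (p - y') \<le> M * (\<Sum>i\<in>UNIV. \<bar>viol {} i (g (x0 + h, y') $ i)\<bar>)"
    proof (rule eb[unfolded error_bound_at_def, rule_format])
      show "(x0 + h, y') \<in> ball z0 \<delta>1" "(x0 + h, y) \<in> ball z0 \<delta>1" using in1 in2 r12 by auto
      show "viol {} i (g (x0 + h, y) $ i) = 0" for i using h(1) by (simp add: viol_empty_iff sol_map_iff)
    qed simp
    then obtain p where p: "\<And>i. g (x0 + h, p) $ i \<le> 0"
      "norm (p - y') \<le> M * (\<Sum>i\<in>UNIV. \<bar>viol {} i (g (x0 + h, y') $ i)\<bar>)" by (auto simp: viol_empty_iff)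
    have "\<bar>viol {} i (g (x0 + h, y') $ i)\<bar> \<le> C * a" for i
    proof -
      have "\<bar>g (x0 + h, y') $ i - g (x0 + h', y') $ i\<bar> \<le> C * norm ((x0 + h, y') - (x0 + h', y'))"
        using in1 in2 r12 by (intro C(3)) auto
      then have "\<bar>g (x0 + h, y') $ i - g (x0 + h', y') $ i\<bar> \<le> C * a" by (simp add: a_def norm_Pair)
      moreover have "g (x0 + h', y') $ i \<le> 0" using h'(1) by (simp add: sol_map_iff)
      ultimately show ?thesis by (auto simp: viol_def)
    qed
    then have "(\<Sum>i\<in>UNIV. \<bar>viol {} i (g (x0 + h, y') $ i)\<bar>) \<le> (\<Sum>i\<in>(UNIV::'p set). C * a)" by (intro sum_mono)
    then have "(\<Sum>i\<in>UNIV. \<bar>viol {} i (g (x0 + h, y') $ i)\<bar>) \<le> N * C * a" by (simp add: N_def)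
    then have pb: "norm (p - y') \<le> M * (N * C * a)" using p(2) M(1) by (meson mult_left_mono less_imp_le order_trans)
    have "norm ((x0 + h, p) - z0) \<le> norm h + norm (p - y0)" using norm_Pair_le[of h "p - y0"] by simp
    also have "\<dots> \<le> norm h + (norm (p - y') + norm (y' - y0))"
      using norm_triangle_ineq[of "p - y'" "y' - y0"] by simp
    also have "\<dots> < 2 * r + M * N * C * (2 * r)"
      using hb pb mult_left_mono[OF less_imp_le[OF a(2)] MNC] by (simp add: mult.assoc)
    also have "\<dots> \<le> \<delta>3" using r3 mult_nonneg_nonneg[OF less_imp_le[OF r] MNC] r by (simp add: algebra_simps)
    finally have in3: "(x0 + h, p) \<in> ball z0 \<delta>3" by (simp only: mem_ball dist_norm norm_minus_commute[of z0])
    have "V (x0 + h) \<le> f (x0 + h, p)" using h(1) p(1) by (intro real_val_le) auto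
    moreover have "V (x0 + h') = f (x0 + h', y')" using h'(1) by (rule real_val_sol)
    moreover have "\<bar>f (x0 + h, p) - f (x0 + h', y')\<bar> \<le> B * norm ((x0 + h, p) - (x0 + h', y'))"
      using in3 in2 r3' by (intro \<delta>3(2)) auto
    moreover have "B * norm ((x0 + h, p) - (x0 + h', y')) \<le> B * (a + M * (N * C * a))"
      using norm_Pair_le[of "h - h'" "p - y'"] pb B by (intro mult_left_mono) (auto simp: a_def)
    moreover have "B * (a + M * (N * C * a)) = L * a" by (simp add: L_def algebra_simps)
    ultimately show ?thesis by (simp add: a_def)
  qed
  obtain \<epsilon> where \<epsilon>: "\<epsilon> > 0" "\<forall>h\<in>insert 0 (dcone u \<epsilon>). \<exists>y\<in>S (x0 + h). (x0 + h, y) \<in> ball z0 r"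
    using near_solution[OF r] by blast
  have "V (x0 + h) - V (x0 + h') \<le> L * norm (h - h')" if "h \<in> insert 0 (dcone u \<epsilon>)" "h' \<in> insert 0 (dcone u \<epsilon>)" for h h'
    using \<epsilon>(2) that main by meson
  note half = this
  have lip: "\<bar>V (x0 + h) - V (x0 + h')\<bar> \<le> L * norm (h - h')" if "h \<in> insert 0 (dcone u \<epsilon>)" "h' \<in> insert 0 (dcone u \<epsilon>)" for h h'
    using half[OF that] half[OF that(2,1)] by (simp add: norm_minus_commute)
  have ne: "S (x0 + h) \<noteq> {}" if "h \<in> insert 0 (dcone u \<epsilon>)" for h using \<epsilon>(2) that by blast
  show ?thesis by (intro exI[of _ L] conjI exI[of _ \<epsilon>] ballI L \<epsilon>(1) ne lip)
qed

text \<open>Diagonal selection: radii 1/(m+1) drive the solutions to \<open>y0\<close>, and the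
  bound \<open>R\<close> makes the multipliers converge after a further extraction. \<open>P\<close>
  carries along whatever else was known at the selected indices, later the Dini estimate. That
  \<open>\<kappa>\<close> tends to infinity is enough to compose limits.\<close>

lemma multiplier_subsequence:
  assumes x: "xk \<longlonglongrightarrow> x0"
    and H: "\<And>r. r > 0 \<Longrightarrow> \<exists>\<^sub>F k in sequentially. \<exists>y\<in>S (xk k). \<exists>lam\<in>mult (xk k, y).
      (xk k, y) \<in> ball z0 r \<and> norm lam \<le> R \<and> P k y lam"
  obtains \<kappa> yk lamk lam where "filterlim \<kappa> at_top sequentially" "\<And>m. yk m \<in> S (xk (\<kappa> m))" "yk \<longlonglongrightarrow> y0"
    "\<And>m. lamk m \<in> mult (xk (\<kappa> m), yk m)" "lamk \<longlonglongrightarrow> lam" "norm lam \<le> R" "\<And>m. P (\<kappa> m) (yk m) (lamk m)"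
proof -
  have "\<forall>m. \<exists>k y lam. k \<ge> m \<and> y \<in> S (xk k) \<and> lam \<in> mult (xk k, y) \<and>
      (xk k, y) \<in> ball z0 (1 / (real m + 1)) \<and> norm lam \<le> R \<and> P k y lam"
  proof
    fix m
    have "\<exists>\<^sub>F k in sequentially. \<exists>y\<in>S (xk k). \<exists>lam\<in>mult (xk k, y).
      (xk k, y) \<in> ball z0 (1 / (real m + 1)) \<and> norm lam \<le> R \<and> P k y lam" by (rule H) simp
    then show "\<exists>k y lam. k \<ge> m \<and> y \<in> S (xk k) \<and> lam \<in> mult (xk k, y) \<and>
      (xk k, y) \<in> ball z0 (1 / (real m + 1)) \<and> norm lam \<le> R \<and> P k y lam"
      unfolding frequently_sequentially by blast
  qed
  from choice[OF this] obtain \<kappa> where "\<forall>m. \<exists>y lam. \<kappa> m \<ge> m \<and> y \<in> S (xk (\<kappa> m)) \<and> lam \<in> mult (xk (\<kappa> m), y) \<and>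
      (xk (\<kappa> m), y) \<in> ball z0 (1 / (real m + 1)) \<and> norm lam \<le> R \<and> P (\<kappa> m) y lam" ..
  from choice[OF this] obtain yk where "\<forall>m. \<exists>lam. \<kappa> m \<ge> m \<and> yk m \<in> S (xk (\<kappa> m)) \<and> lam \<in> mult (xk (\<kappa> m), yk m) \<and>
      (xk (\<kappa> m), yk m) \<in> ball z0 (1 / (real m + 1)) \<and> norm lam \<le> R \<and> P (\<kappa> m) (yk m) lam" ..
  from choice[OF this] obtain lamk where sel: "\<forall>m. \<kappa> m \<ge> m \<and> yk m \<in> S (xk (\<kappa> m)) \<and> lamk m \<in> mult (xk (\<kappa> m), yk m) \<and>
      (xk (\<kappa> m), yk m) \<in> ball z0 (1 / (real m + 1)) \<and> norm (lamk m) \<le> R \<and> P (\<kappa> m) (yk m) (lamk m)" ..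
  have \<kappa>: "filterlim \<kappa> at_top sequentially"
    by (rule filterlim_at_top_mono[OF filterlim_ident]) (use sel in auto)
  have "(\<lambda>m. yk m - y0) \<longlonglongrightarrow> 0"
  proof (rule Lim_null_comparison)
    show "(\<lambda>k. 1 / (real k + 1)) \<longlonglongrightarrow> 0" by (rule inverse_Suc_tendsto_0)
    have "norm (yk m - y0) \<le> 1 / (real m + 1)" for m
      using sel[rule_format, of m] dist_snd_le[of z0 "(xk (\<kappa> m), yk m)"] by (simp add: dist_norm norm_minus_commute)
    then show "\<forall>\<^sub>F m in sequentially. norm (yk m - y0) \<le> 1 / (real m + 1)" by simp
  qed
  then have y: "yk \<longlonglongrightarrow> y0" by (rule LIM_zero_cancel)
  have "\<forall>m. lamk m \<in> cball 0 R" using sel by simp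
  then obtain lam r where r: "strict_mono r" "lam \<in> cball 0 R" "(lamk \<circ> r) \<longlonglongrightarrow> lam"
    using compact_cball[of "0::real^'p" R] unfolding compact_def by blast
  show ?thesis
  proof (rule that[of "\<kappa> \<circ> r" "yk \<circ> r" "lamk \<circ> r" lam])
    show "filterlim (\<kappa> \<circ> r) at_top sequentially"
      unfolding o_def by (rule filterlim_compose[OF \<kappa> filterlim_subseq[OF r(1)]])
    show "(yk \<circ> r) \<longlonglongrightarrow> y0" by (rule LIMSEQ_subseq_LIMSEQ[OF y r(1)])
  qed (use sel r in auto)
qed

lemma multiplier_limit_quotient:
  assumes t: "\<And>k. 0 < t k" "t \<longlonglongrightarrow> 0" and w: "w \<longlonglongrightarrow> u" and y: "yk \<longlonglongrightarrow> y0"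
    and sol: "\<And>k. yk k \<in> S (x0 + t k *\<^sub>R w k)"
    and lamk: "\<And>k. lamk k \<in> mult (x0 + t k *\<^sub>R w k, yk k)" "lamk \<longlonglongrightarrow> lam"
  shows "lam \<in> mult z0"
    and "\<eta> > 0 \<Longrightarrow> \<forall>\<^sub>F k in sequentially. (V (x0 + t k *\<^sub>R w k) - V x0) / t k \<le> fst (DL lam z0) \<bullet> u + \<eta>"
proof -
  have x: "(\<lambda>k. x0 + t k *\<^sub>R w k) \<longlonglongrightarrow> x0" using tendsto_add[OF tendsto_const dcone_sequence_0[OF t(2) w], of x0] by simp
  show "lam \<in> mult z0" by (rule multiplier_limit(1)[OF x y sol lamk])
  assume "\<eta> > 0"
  define n where "n = norm u + 1"
  \<comment> \<open>The remainder of the expansion is measured by \<open>norm (w k)\<close>, whose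
    limit is \<open>norm u\<close>; the 1 in \<open>n\<close> covers u = 0.\<close>
  define \<eta>' where "\<eta>' = \<eta> / 2 / n"
  have pos: "n > 0" by (simp add: n_def add_nonneg_pos)
  have "\<eta>' > 0" using \<open>\<eta> > 0\<close> pos by (simp add: \<eta>'_def)
  have "\<eta>' * norm u \<le> \<eta>' * n" using \<open>\<eta>' > 0\<close> by (intro mult_left_mono) (auto simp: n_def)
  also have "\<dots> < \<eta>" using \<open>\<eta> > 0\<close> pos by (simp add: \<eta>'_def)
  finally have lt: "\<eta>' * norm u < \<eta>" .
  have "(\<lambda>m. fst (DL lam z0) \<bullet> w m + \<eta>' * norm (w m)) \<longlonglongrightarrow> fst (DL lam z0) \<bullet> u + \<eta>' * norm u"
    by (intro tendsto_intros w)
  from order_tendstoD(2)[OF this, of "fst (DL lam z0) \<bullet> u + \<eta>"] lt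
  have "\<forall>\<^sub>F m in sequentially. fst (DL lam z0) \<bullet> w m + \<eta>' * norm (w m) < fst (DL lam z0) \<bullet> u + \<eta>"
    by simp
  with multiplier_limit(2)[OF x y sol lamk \<open>\<eta>' > 0\<close>]
  show "\<forall>\<^sub>F k in sequentially. (V (x0 + t k *\<^sub>R w k) - V x0) / t k \<le> fst (DL lam z0) \<bullet> u + \<eta>"
  proof eventually_elim
    case (elim m)
    have "V (x0 + t m *\<^sub>R w m) - V x0 \<le> t m * (fst (DL lam z0) \<bullet> w m + \<eta>' * norm (w m))"
      using elim(1) t(1)[of m] by (simp add: algebra_simps)
    also have "\<dots> \<le> t m * (fst (DL lam z0) \<bullet> u + \<eta>)"
      using elim(2) t(1)[of m] by (intro mult_left_mono) auto
    finally show ?case using t(1)[of m] by (simp add: pos_divide_le_eq mult.commute)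
  qed
qed

text \<open>The multiplier arises as a limit along a subsequence, hence the estimate holds only
  frequently; \<open>quotient_upper_maximal\<close> shows that this suffices.\<close>

lemma real_val_quotient_upper:
  assumes t: "\<And>k. 0 < t k" "t \<longlonglongrightarrow> 0" and w: "w \<longlonglongrightarrow> u"
  obtains lam where "lam \<in> mult z0" "norm lam \<le> R_mult"
    "\<And>\<eta>. \<eta> > 0 \<Longrightarrow> \<exists>\<^sub>F k in sequentially. (V (x0 + t k *\<^sub>R w k) - V x0) / t k \<le> fst (DL lam z0) \<bullet> u + \<eta>"
proof -
  define xk where "xk k = x0 + t k *\<^sub>R w k" for k
  have x: "xk \<longlonglongrightarrow> x0" unfolding xk_def using tendsto_add[OF tendsto_const dcone_sequence_0[OF t(2) w], of x0] by simp
  obtain \<delta> where \<delta>: "\<delta> > 0" "\<forall>x y. (x, y) \<in> ball z0 \<delta> \<longrightarrow> y \<in> S x \<longrightarrow> (\<exists>lam\<in>mult (x, y). norm lam \<le> R_mult)"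
    using R_mult by (elim exE conjE) (rule that)
  have H: "\<exists>\<^sub>F k in sequentially. \<exists>y\<in>S (xk k). \<exists>lam\<in>mult (xk k, y). (xk k, y) \<in> ball z0 r \<and> norm lam \<le> R_mult \<and> True"
    if "r > 0" for r
  proof (rule eventually_frequently)
    obtain \<epsilon> where \<epsilon>: "\<epsilon> > 0" "\<forall>h\<in>insert 0 (dcone u \<epsilon>). \<exists>y\<in>S (x0 + h). (x0 + h, y) \<in> ball z0 (min r \<delta>)"
      using near_solution[of "min r \<delta>"] \<open>r > 0\<close> \<delta>(1) by auto
    show "\<forall>\<^sub>F k in sequentially. \<exists>y\<in>S (xk k). \<exists>lam\<in>mult (xk k, y). (xk k, y) \<in> ball z0 r \<and> norm lam \<le> R_mult \<and> True"
      using dcone_eventually[OF t w \<epsilon>(1)]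
    proof eventually_elim
      case (elim k)
      with \<epsilon>(2) obtain y where y: "y \<in> S (xk k)" "(xk k, y) \<in> ball z0 (min r \<delta>)" unfolding xk_def by blast
      then obtain lam where "lam \<in> mult (xk k, y)" "norm lam \<le> R_mult" using \<delta>(2) by auto
      then show ?case using y by auto
    qed
  qed simp
  obtain \<kappa> yk lamk lam where s: "filterlim \<kappa> at_top sequentially" "\<And>m. yk m \<in> S (xk (\<kappa> m))" "yk \<longlonglongrightarrow> y0"
    "\<And>m. lamk m \<in> mult (xk (\<kappa> m), yk m)" "lamk \<longlonglongrightarrow> lam" "norm lam \<le> R_mult"
    by (rule multiplier_subsequence[where R = R_mult and P = "\<lambda>_ _ _. True", OF x H]) (assumption | rule that)+
  have t\<kappa>: "(\<lambda>m. t (\<kappa> m)) \<longlonglongrightarrow> 0" by (rule filterlim_compose[OF t(2) s(1)])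
  have w\<kappa>: "(\<lambda>m. w (\<kappa> m)) \<longlonglongrightarrow> u" by (rule filterlim_compose[OF w s(1)])
  note lim = multiplier_limit_quotient[OF t(1) t\<kappa> w\<kappa> s(3) s(2)[unfolded xk_def] s(4)[unfolded xk_def] s(5)]
  show ?thesis
  proof (rule that[of lam])
    show "lam \<in> mult z0" by (rule lim(1))
    show "norm lam \<le> R_mult" by fact
    fix \<eta> :: real assume "\<eta> > 0"
    note ev = lim(2)[OF this]
    show "\<exists>\<^sub>F k in sequentially. (V (x0 + t k *\<^sub>R w k) - V x0) / t k \<le> fst (DL lam z0) \<bullet> u + \<eta>"
    proof (rule ccontr)
      assume "\<not> ?thesis"
      then have "\<forall>\<^sub>F k in sequentially. \<not> (V (xk k) - V x0) / t k \<le> fst (DL lam z0) \<bullet> u + \<eta>"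
        by (simp add: not_frequently xk_def)
      from eventually_compose_filterlim[OF this s(1)] ev[folded xk_def]
      have "\<forall>\<^sub>F m in sequentially. False" by eventually_elim blast
      then show False by simp
    qed
  qed
qed

text \<open>In contrast to the upper estimate this holds eventually and for every multiplier of
  \<open>z0\<close>: it is the lower expansion at the fixed point \<open>z0\<close>, with nearby
  solutions supplied by inner semi-continuity.\<close>

lemma real_val_quotient_lower:
  assumes t: "\<And>k. 0 < t k" "t \<longlonglongrightarrow> 0" and w: "w \<longlonglongrightarrow> u" and lam: "lam \<in> mult z0" and \<eta>: "\<eta> > 0"
  shows "\<forall>\<^sub>F k in sequentially. fst (DL lam z0) \<bullet> u - \<eta> \<le> (V (x0 + t k *\<^sub>R w k) - V x0) / t k"
proof -
  define n where "n = norm u + 1"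
  define \<eta>' where "\<eta>' = \<eta> / 2 / n"
  have pos: "n > 0" by (simp add: n_def add_nonneg_pos)
  have "\<eta>' > 0" using \<open>\<eta> > 0\<close> pos by (simp add: \<eta>'_def)
  have "\<eta>' * norm u \<le> \<eta>' * n" using \<open>\<eta>' > 0\<close> by (intro mult_left_mono) (auto simp: n_def)
  also have "\<dots> < \<eta>" using \<open>\<eta> > 0\<close> pos by (simp add: \<eta>'_def)
  finally have lt: "\<eta>' * norm u < \<eta>" .
  obtain \<delta> where \<delta>: "\<delta> > 0" "\<forall>x y lam \<eta>. (x, y) \<in> ball z0 \<delta> \<longrightarrow> y \<in> S x \<longrightarrow> lam \<in> mult (x, y) \<longrightarrow> \<eta> > 0 \<longrightarrow>
    (\<exists>\<rho>>0. \<forall>x' y'. (x', y') \<in> ball (x, y) \<rho> \<longrightarrow> y' \<in> S x' \<longrightarrow>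
       fst (DL lam (x, y)) \<bullet> (x' - x) - \<eta> * norm (x' - x) \<le> V x' - V x)"
    using real_val_lower_expansion by (elim exE conjE) (rule that)
  from \<delta>(2)[rule_format, of x0 y0 lam \<eta>'] \<delta>(1) sol0 lam \<open>\<eta>' > 0\<close>
  obtain \<rho> where \<rho>: "\<rho> > 0" "\<forall>x' y'. (x', y') \<in> ball z0 \<rho> \<longrightarrow> y' \<in> S x' \<longrightarrow>
       fst (DL lam z0) \<bullet> (x' - x0) - \<eta>' * norm (x' - x0) \<le> V x' - V x0" by auto
  obtain \<epsilon> where \<epsilon>: "\<epsilon> > 0" "\<forall>h\<in>insert 0 (dcone u \<epsilon>). \<exists>y\<in>S (x0 + h). (x0 + h, y) \<in> ball z0 \<rho>"
    using near_solution[OF \<rho>(1)] by blast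
  have "(\<lambda>m. fst (DL lam z0) \<bullet> w m - \<eta>' * norm (w m)) \<longlonglongrightarrow> fst (DL lam z0) \<bullet> u - \<eta>' * norm u"
    by (intro tendsto_intros w)
  from order_tendstoD(1)[OF this, of "fst (DL lam z0) \<bullet> u - \<eta>"] lt
  have "\<forall>\<^sub>F m in sequentially. fst (DL lam z0) \<bullet> u - \<eta> < fst (DL lam z0) \<bullet> w m - \<eta>' * norm (w m)"
    by simp
  with dcone_eventually[OF t w \<epsilon>(1)] show ?thesis
  proof eventually_elim
    case (elim k)
    then obtain y where "y \<in> S (x0 + t k *\<^sub>R w k)" "(x0 + t k *\<^sub>R w k, y) \<in> ball z0 \<rho>" using \<epsilon>(2) by blast
    then have "fst (DL lam z0) \<bullet> (t k *\<^sub>R w k) - \<eta>' * norm (t k *\<^sub>R w k) \<le> V (x0 + t k *\<^sub>R w k) - V x0"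
      using \<rho>(2)[rule_format, of "x0 + t k *\<^sub>R w k" y] by simp
    then have "t k * (fst (DL lam z0) \<bullet> w k - \<eta>' * norm (w k)) \<le> V (x0 + t k *\<^sub>R w k) - V x0"
      using t(1)[of k] by (simp add: algebra_simps)
    moreover have "t k * (fst (DL lam z0) \<bullet> u - \<eta>) \<le> t k * (fst (DL lam z0) \<bullet> w k - \<eta>' * norm (w k))"
      using elim(2) t(1)[of k] by (intro mult_left_mono) auto
    ultimately have "t k * (fst (DL lam z0) \<bullet> u - \<eta>) \<le> V (x0 + t k *\<^sub>R w k) - V x0" by linarith
    then show ?case using t(1)[of k] by (simp add: pos_le_divide_eq mult.commute)
  qed
qed

text \<open>An upper bound that holds frequently meets a lower bound that holds eventually at a
  common index. Hence any limit multiplier maximises over all multipliers, even if these form an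
  unbounded set.\<close>

lemma quotient_upper_maximal:
  assumes t: "\<And>k. 0 < t k" "t \<longlonglongrightarrow> 0" and w: "w \<longlonglongrightarrow> u" and mu: "mu \<in> mult z0"
    and lam: "\<And>\<eta>. \<eta> > 0 \<Longrightarrow> \<exists>\<^sub>F k in sequentially. (V (x0 + t k *\<^sub>R w k) - V x0) / t k \<le> fst (DL lam z0) \<bullet> u + \<eta>"
  shows "fst (DL mu z0) \<bullet> u \<le> fst (DL lam z0) \<bullet> u"
proof (rule field_le_epsilon)
  fix e :: real assume "e > 0"
  then have "e / 2 > 0" by simp
  from frequently_eventually_conj[OF lam[OF this] real_val_quotient_lower[OF t w mu this]]
  obtain k where "(V (x0 + t k *\<^sub>R w k) - V x0) / t k \<le> fst (DL lam z0) \<bullet> u + e / 2"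
    "fst (DL mu z0) \<bullet> u - e / 2 \<le> (V (x0 + t k *\<^sub>R w k) - V x0) / t k" by (auto dest: frequently_ex)
  then show "fst (DL mu z0) \<bullet> u \<le> fst (DL lam z0) \<bullet> u + e" by linarith
qed

lemma real_val_directional_derivative:
  "\<exists>lam\<in>mult z0. norm lam \<le> R_mult \<and> (\<forall>mu\<in>mult z0. fst (DL mu z0) \<bullet> u \<le> fst (DL lam z0) \<bullet> u) \<and>
     ((\<lambda>t. (V (x0 + t *\<^sub>R u) - V x0) / t) \<longlongrightarrow> fst (DL lam z0) \<bullet> u) (at_right 0)"
proof -
  \<comment> \<open>One arbitrary sequence is enough to produce a maximiser \<open>lam\<close>; all
    other sequences are then compared with it.\<close>
  define \<tau> where "\<tau> k = 1 / (real k + 1)" for k :: nat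
  have \<tau>: "0 < \<tau> k" for k by (simp add: \<tau>_def)
  have \<tau>0: "\<tau> \<longlonglongrightarrow> 0" unfolding \<tau>_def by (rule inverse_Suc_tendsto_0)
  obtain lam where lam: "lam \<in> mult z0" "norm lam \<le> R_mult"
    "\<And>\<eta>. \<eta> > 0 \<Longrightarrow> \<exists>\<^sub>F k in sequentially. (V (x0 + \<tau> k *\<^sub>R u) - V x0) / \<tau> k \<le> fst (DL lam z0) \<bullet> u + \<eta>"
    using real_val_quotient_upper[OF \<tau> \<tau>0 tendsto_const] by blast
  have "((\<lambda>t. (V (x0 + t *\<^sub>R u) - V x0) / t) \<longlongrightarrow> fst (DL lam z0) \<bullet> u) (at_right 0)"
  proof (rule tendsto_at_right_sequentially[of 0 1])
    fix t :: "nat \<Rightarrow> real" assume t: "\<And>k. 0 < t k" "t \<longlonglongrightarrow> 0"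
    show "(\<lambda>k. (V (x0 + t k *\<^sub>R u) - V x0) / t k) \<longlonglongrightarrow> fst (DL lam z0) \<bullet> u"
    proof (rule order_tendstoI)
      fix a assume a: "a < fst (DL lam z0) \<bullet> u"
      then have "(fst (DL lam z0) \<bullet> u - a) / 2 > 0" by simp
      note low = real_val_quotient_lower[OF t tendsto_const lam(1) this]
      have lt: "a < fst (DL lam z0) \<bullet> u - (fst (DL lam z0) \<bullet> u - a) / 2" using a by (simp add: field_simps)
      from low show "\<forall>\<^sub>F k in sequentially. a < (V (x0 + t k *\<^sub>R u) - V x0) / t k"
        by (rule eventually_mono) (rule less_le_trans[OF lt])
    next
      fix a assume a: "fst (DL lam z0) \<bullet> u < a"
      show "\<forall>\<^sub>F k in sequentially. (V (x0 + t k *\<^sub>R u) - V x0) / t k < a"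
      proof (rule ccontr)
        assume "\<not> ?thesis"
        then have inf: "\<exists>\<^sub>F k in sequentially. a \<le> (V (x0 + t k *\<^sub>R u) - V x0) / t k"
          by (simp add: not_eventually not_less)
        then have "\<forall>m. \<exists>k\<ge>m. a \<le> (V (x0 + t k *\<^sub>R u) - V x0) / t k"
          unfolding frequently_sequentially by blast
        then obtain \<kappa> where \<kappa>: "\<And>m. \<kappa> m \<ge> m" "\<And>m. a \<le> (V (x0 + t (\<kappa> m) *\<^sub>R u) - V x0) / t (\<kappa> m)" by metis
        have \<kappa>l: "filterlim \<kappa> at_top sequentially"
          by (rule filterlim_at_top_mono[OF filterlim_ident]) (use \<kappa> in auto)
        have t\<kappa>: "(\<lambda>m. t (\<kappa> m)) \<longlonglongrightarrow> 0" by (rule filterlim_compose[OF t(2) \<kappa>l])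
        \<comment> \<open>The subsequence with too large quotients has its own limit multiplier,
          whose value cannot exceed that of \<open>lam\<close>.\<close>
        obtain mu where mu: "mu \<in> mult z0"
          "\<And>\<eta>. \<eta> > 0 \<Longrightarrow> \<exists>\<^sub>F k in sequentially. (V (x0 + t (\<kappa> k) *\<^sub>R u) - V x0) / t (\<kappa> k) \<le> fst (DL mu z0) \<bullet> u + \<eta>"
          using real_val_quotient_upper[OF t(1) t\<kappa> tendsto_const] by blast
        have "(a - fst (DL lam z0) \<bullet> u) / 2 > 0" using a by simp
        from frequently_ex[OF mu(2)[OF this]] obtain k where
          "(V (x0 + t (\<kappa> k) *\<^sub>R u) - V x0) / t (\<kappa> k) \<le> fst (DL mu z0) \<bullet> u + (a - fst (DL lam z0) \<bullet> u) / 2" ..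
        moreover have "fst (DL mu z0) \<bullet> u \<le> fst (DL lam z0) \<bullet> u"
          by (rule quotient_upper_maximal[OF \<tau> \<tau>0 tendsto_const mu(1) lam(3)])
        ultimately have "a \<le> fst (DL lam z0) \<bullet> u + (a - fst (DL lam z0) \<bullet> u) / 2"
          using \<kappa>(2)[of k] by linarith
        then show False using a by (simp add: field_simps)
      qed
    qed
  qed simp
  moreover have "\<forall>mu\<in>mult z0. fst (DL mu z0) \<bullet> u \<le> fst (DL lam z0) \<bullet> u"
    using quotient_upper_maximal[OF \<tau> \<tau>0 tendsto_const _ lam(3)] by blast
  ultimately show ?thesis using lam by blast
qed

end

section \<open>Stationary points of the penalised problem\<close>

text \<open>The smoothing parameter \<open>\<tau>\<close> keeps the penalty differentiable at feasible points.\<close>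

definition penalty :: "real \<Rightarrow> ('a \<times> 'b \<Rightarrow> real) \<Rightarrow> ('a \<Rightarrow> real) \<Rightarrow> ('k::finite \<Rightarrow> 'a \<times> 'b \<Rightarrow> real) \<Rightarrow> 'a \<times> 'b \<Rightarrow> real" where
  "penalty \<tau> f v h z = sqrt (\<tau>\<^sup>2 + (max 0 (f z - v (fst z)))\<^sup>2 + (\<Sum>k\<in>UNIV. (max 0 (h k z))\<^sup>2))"

lemma DERIV_line:
  assumes "GDERIV \<phi> z :> D"
  shows "((\<lambda>s. \<phi> (z + s *\<^sub>R e)) has_real_derivative D \<bullet> e) (at 0)"
proof -
  have 1: "((\<lambda>s. z + s *\<^sub>R e) has_derivative (\<lambda>s. s *\<^sub>R e)) (at 0)" by (auto intro!: derivative_eq_intros)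
  have 2: "(\<phi> has_derivative (\<lambda>h. h \<bullet> D)) (at (z + 0 *\<^sub>R e))" using assms by (simp add: gderiv_def)
  from has_derivative_compose[OF 1 2] show ?thesis
    by (simp add: has_field_derivative_def inner_commute mult_commute_abs)
qed

lemma DERIV_max0_square_compose:
  "(r has_real_derivative r') (at 0) \<Longrightarrow> ((\<lambda>s. (max 0 (r s))\<^sup>2) has_real_derivative 2 * max 0 (r 0) * r') (at 0)"
  using DERIV_chain2[OF DERIV_max0_square, of r r' 0 UNIV] by simp

text \<open>Replacing \<open>v\<close> along the line by a linear minorant that is touched frequently gives a
  differentiable majorant of the penalised function.\<close>

lemma penalty_stationary:
  fixes z :: "'a::euclidean_space \<times> 'b::euclidean_space" and h :: "'k::finite \<Rightarrow> 'a \<times> 'b \<Rightarrow> real"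
  assumes Q: "GDERIV Q z :> p" and f: "GDERIV f z :> D" and h: "\<And>k. GDERIV (h k) z :> Dh k"
    and pos: "penalty \<tau> f v h z > 0"
    and min: "\<forall>\<^sub>F z' in nhds z. Q z + penalty \<tau> f v h z \<le> Q z' + penalty \<tau> f v h z'"
    and dini: "\<exists>\<^sub>F s in at_right 0. s * \<xi> \<le> v (fst z + s *\<^sub>R a) - v (fst z)"
  shows "0 \<le> p \<bullet> (a, b) + max 0 (f z - v (fst z)) / penalty \<tau> f v h z * (D \<bullet> (a, b) - \<xi>)
     + (\<Sum>k\<in>UNIV. max 0 (h k z) / penalty \<tau> f v h z * (Dh k \<bullet> (a, b)))"
proof -
  let ?P = "penalty \<tau> f v h z"
  define e where "e = (a, b)"
  define r where "r s = f (z + s *\<^sub>R e) - v (fst z) - s * \<xi>" for s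
  define T where "T s = \<tau>\<^sup>2 + (max 0 (r s))\<^sup>2 + (\<Sum>k\<in>UNIV. (max 0 (h k (z + s *\<^sub>R e)))\<^sup>2)" for s
  define \<psi> where "\<psi> s = Q (z + s *\<^sub>R e) + sqrt (T s)" for s
  have T0: "sqrt (T 0) = ?P" by (simp add: T_def r_def penalty_def)
  then have T0pos: "T 0 > 0" using pos by (metis real_sqrt_gt_0_iff)
  define T' where "T' = 2 * max 0 (r 0) * (D \<bullet> e - \<xi>) + (\<Sum>k\<in>UNIV. 2 * max 0 (h k z) * (Dh k \<bullet> e))"
  have r': "(r has_real_derivative D \<bullet> e - \<xi>) (at 0)"
    unfolding r_def by (auto intro!: derivative_eq_intros DERIV_line[OF f])
  have h': "((\<lambda>s. (max 0 (h k (z + s *\<^sub>R e)))\<^sup>2) has_real_derivative 2 * max 0 (h k z) * (Dh k \<bullet> e)) (at 0)" for k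
    using DERIV_max0_square_compose[OF DERIV_line[OF h, of k e]] by simp
  have "(T has_real_derivative 0 + 2 * max 0 (r 0) * (D \<bullet> e - \<xi>) + (\<Sum>k\<in>UNIV. 2 * max 0 (h k z) * (Dh k \<bullet> e))) (at 0)"
    unfolding T_def by (intro DERIV_add DERIV_const DERIV_sum DERIV_max0_square_compose r' h')
  then have T': "(T has_real_derivative T') (at 0)" by (simp add: T'_def)
  have "((\<lambda>s. sqrt (T s)) has_real_derivative inverse (sqrt (T 0)) / 2 * T') (at 0)"
    by (rule DERIV_chain2[OF DERIV_real_sqrt[OF T0pos] T'])
  then have "((\<lambda>s. sqrt (T s)) has_real_derivative T' / (2 * ?P)) (at 0)" by (simp add: T0 field_simps)
  then have \<psi>': "(\<psi> has_real_derivative p \<bullet> e + T' / (2 * ?P)) (at 0)"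
    unfolding \<psi>_def by (intro DERIV_add DERIV_line Q)
  have freq: "\<exists>\<^sub>F s in at_right 0. \<psi> 0 \<le> \<psi> s"
  proof -
    have "((\<lambda>s. z + s *\<^sub>R e) \<longlongrightarrow> z + 0 *\<^sub>R e) (at_right 0)" by (intro tendsto_intros)
    then have "((\<lambda>s. z + s *\<^sub>R e) \<longlongrightarrow> z) (at_right 0)" by simp
    from frequently_eventually_conj[OF dini eventually_compose_filterlim[OF min this]]
    show ?thesis
    proof (rule frequently_elim1)
      fix s assume s: "Q z + ?P \<le> Q (z + s *\<^sub>R e) + penalty \<tau> f v h (z + s *\<^sub>R e) \<and>
        s * \<xi> \<le> v (fst z + s *\<^sub>R a) - v (fst z)"
      have "penalty \<tau> f v h (z + s *\<^sub>R e) \<le> sqrt (T s)"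
        unfolding penalty_def T_def
        using s by (intro real_sqrt_le_mono add_mono order_refl power_mono max.mono) (auto simp: r_def e_def)
      then show "\<psi> 0 \<le> \<psi> s" using s T0 by (simp add: \<psi>_def)
    qed
  qed
  have "0 \<le> p \<bullet> e + T' / (2 * ?P)"
  proof (rule ccontr)
    assume "\<not> ?thesis"
    then obtain d where "d > 0" "\<forall>h>0. h < d \<longrightarrow> \<psi> h < \<psi> 0"
      using has_real_derivative_neg_dec_right[OF \<psi>'] by auto
    then have "\<forall>\<^sub>F s in at_right 0. \<not> \<psi> 0 \<le> \<psi> s" unfolding eventually_at_right_field by (auto simp: not_le)
    then show False using freq by (simp add: frequently_def)
  qed
  also have "T' = 2 * (max 0 (f z - v (fst z)) * (D \<bullet> e - \<xi>) + (\<Sum>k\<in>UNIV. max 0 (h k z) * (Dh k \<bullet> e)))"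
    by (simp add: T'_def r_def sum_distrib_left distrib_left mult.assoc)
  also have "\<dots> / (2 * ?P) = max 0 (f z - v (fst z)) / ?P * (D \<bullet> e - \<xi>) + (\<Sum>k\<in>UNIV. max 0 (h k z) / ?P * (Dh k \<bullet> e))"
    by (simp add: add_divide_distrib sum_divide_distrib)
  finally show ?thesis by (simp add: add.assoc e_def)
qed

text \<open>A constraint violated frequently along z0 + t w with w tending to \<open>d\<close>
  cannot be inactive, by continuity, nor have negative slope along \<open>d\<close>, since h/t tends
  to that slope. This gives both orthogonality conditions for multipliers whose positive entries
  belong to violated constraints.\<close>

lemma directional_complementarity:
  fixes h :: "'z::real_inner \<Rightarrow> real"
  assumes h: "GDERIV h z0 :> D" and t: "\<And>k. 0 < t k" "t \<longlonglongrightarrow> 0" and w: "w \<longlonglongrightarrow> d"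
    and pos: "\<exists>\<^sub>F k in sequentially. h (z0 + t k *\<^sub>R w k) > 0"
    and le: "h z0 \<le> 0" "h z0 = 0 \<Longrightarrow> D \<bullet> d \<le> 0"
  shows "h z0 = 0 \<and> D \<bullet> d = 0"
proof -
  have z: "(\<lambda>k. z0 + t k *\<^sub>R w k) \<longlonglongrightarrow> z0" using tendsto_add[OF tendsto_const dcone_sequence_0[OF t(2) w], of z0] by simp
  have "(\<lambda>k. h (z0 + t k *\<^sub>R w k)) \<longlonglongrightarrow> h z0"
    by (rule isCont_tendsto_compose[OF GDERIV_isCont[OF h] z])
  have "\<not> h z0 < 0"
  proof
    assume "h z0 < 0"
    from order_tendstoD(2)[OF \<open>_ \<longlonglongrightarrow> h z0\<close> this] have "\<forall>\<^sub>F k in sequentially. \<not> h (z0 + t k *\<^sub>R w k) > 0"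
      by eventually_elim auto
    then show False using pos by (simp add: frequently_def)
  qed
  then have h0: "h z0 = 0" using le(1) by simp
  have "\<not> D \<bullet> d < 0"
  proof
    assume neg: "D \<bullet> d < 0"
    have "((\<lambda>y. norm (h y - h z0 - (y - z0) \<bullet> D) / norm (y - z0)) \<longlongrightarrow> 0) (at z0)"
      using h unfolding gderiv_def has_derivative_iff_norm by blast
    \<comment> \<open>Division by zero makes the quotient 0 at \<open>z0\<close>, so the punctured
      limit is continuity there, and the sequence may hit \<open>z0\<close>.\<close>
    then have c: "isCont (\<lambda>y. norm (h y - h z0 - (y - z0) \<bullet> D) / norm (y - z0)) z0"
      by (simp add: isCont_def)
    have "(\<lambda>k. norm (h (z0 + t k *\<^sub>R w k) - t k * (w k \<bullet> D)) / norm (t k *\<^sub>R w k)) \<longlonglongrightarrow> 0"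
      using isCont_tendsto_compose[OF c z] by (simp add: h0)
    from tendsto_mult[OF this tendsto_norm[OF w]]
    have "(\<lambda>k. norm (h (z0 + t k *\<^sub>R w k) - t k * (w k \<bullet> D)) / norm (t k *\<^sub>R w k) * norm (w k)) \<longlonglongrightarrow> 0" by simp
    then have "(\<lambda>k. h (z0 + t k *\<^sub>R w k) / t k - w k \<bullet> D) \<longlonglongrightarrow> 0"
    proof (rule Lim_null_comparison[rotated], intro always_eventually allI)
      fix k
      show "norm (h (z0 + t k *\<^sub>R w k) / t k - w k \<bullet> D) \<le>
        norm (h (z0 + t k *\<^sub>R w k) - t k * (w k \<bullet> D)) / norm (t k *\<^sub>R w k) * norm (w k)"
      proof (cases "w k = 0")
        case True
        then show ?thesis by (simp add: h0)
      next
        case False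
        have "h (z0 + t k *\<^sub>R w k) / t k - w k \<bullet> D = (h (z0 + t k *\<^sub>R w k) - t k * (w k \<bullet> D)) / t k"
          using t(1)[of k] by (simp add: diff_divide_distrib)
        then show ?thesis using False t(1)[of k] by simp
      qed
    qed
    from tendsto_add[OF this tendsto_inner[OF w tendsto_const[of D]]]
    have "(\<lambda>k. h (z0 + t k *\<^sub>R w k) / t k) \<longlonglongrightarrow> D \<bullet> d" by (simp add: inner_commute)
    from order_tendstoD(2)[OF this neg] have "\<forall>\<^sub>F k in sequentially. \<not> h (z0 + t k *\<^sub>R w k) > 0"
      by eventually_elim (use t(1) in \<open>simp add: divide_less_0_iff not_less\<close>, metis t(1) less_imp_le not_less)
    then show False using pos by (simp add: frequently_def)
  qed
  then show ?thesis using h0 le(2) by force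
qed

context directional_lower_level
begin

text \<open>Inner semi-continuity is only known at the apex, so solutions at x0 + h + s a need not
  approach a prescribed solution at x0 + h. Hence the solution \<open>y\<close> is taken as a limit
  of solutions along \<open>a\<close>; it depends on \<open>a\<close>, and the estimate holds along
  the selected steps s only.\<close>

lemma lower_dini:
  assumes r: "r > 0"
  shows "\<exists>\<epsilon>>0. \<forall>h\<in>dcone u \<epsilon>. \<exists>y\<in>S (x0 + h). \<exists>lam\<in>mult (x0 + h, y).
     (x0 + h, y) \<in> ball z0 r \<and> norm lam \<le> R_mult \<and>
     (\<forall>\<eta>>0. \<exists>\<^sub>F s in at_right 0. s * (fst (DL lam (x0 + h, y)) \<bullet> a - \<eta>) \<le> V (x0 + h + s *\<^sub>R a) - V (x0 + h))"
proof -
  obtain \<delta>1 where \<delta>1: "\<delta>1 > 0" "\<forall>x y. (x, y) \<in> ball z0 \<delta>1 \<longrightarrow> y \<in> S x \<longrightarrow> (\<exists>lam\<in>mult (x, y). norm lam \<le> R_mult)"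
    using R_mult by (elim exE conjE) (rule that)
  obtain \<delta>2 where \<delta>2: "\<delta>2 > 0" "\<forall>x y lam \<eta>. (x, y) \<in> ball z0 \<delta>2 \<longrightarrow> y \<in> S x \<longrightarrow> lam \<in> mult (x, y) \<longrightarrow> \<eta> > 0 \<longrightarrow>
    (\<exists>\<rho>>0. \<forall>x' y'. (x', y') \<in> ball (x, y) \<rho> \<longrightarrow> y' \<in> S x' \<longrightarrow>
       fst (DL lam (x, y)) \<bullet> (x' - x) - \<eta> * norm (x' - x) \<le> V x' - V x)"
    using real_val_lower_expansion by (elim exE conjE) (rule that)
  \<comment> \<open>Halved, so that limits taken in the closed ball remain inside all three open
    balls.\<close>
  define r' where "r' = min r (min \<delta>1 \<delta>2) / 2"
  have r': "r' > 0" "r' < r" "r' < \<delta>1" "r' < \<delta>2" using r \<delta>1(1) \<delta>2(1) by (auto simp: r'_def)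
  obtain \<epsilon>1 where \<epsilon>1: "\<epsilon>1 > 0" "\<forall>h\<in>insert 0 (dcone u \<epsilon>1). \<exists>y\<in>S (x0 + h). (x0 + h, y) \<in> ball z0 r'"
    using near_solution[OF r'(1)] by blast
  obtain L \<epsilon>2 where L: "L > 0" "\<epsilon>2 > 0" "\<forall>h\<in>insert 0 (dcone u \<epsilon>2). S (x0 + h) \<noteq> {} \<and>
     (\<forall>h'\<in>insert 0 (dcone u \<epsilon>2). \<bar>V (x0 + h) - V (x0 + h')\<bar> \<le> L * norm (h - h'))"
    using real_val_lipschitz by blast
  define \<epsilon> where "\<epsilon> = min \<epsilon>1 \<epsilon>2"
  have \<epsilon>: "\<epsilon> > 0" using \<epsilon>1(1) L(2) by (simp add: \<epsilon>_def)
  have sub: "dcone u \<epsilon> \<subseteq> dcone u \<epsilon>1" "dcone u \<epsilon> \<subseteq> dcone u \<epsilon>2" by (auto intro!: dcone_mono simp: \<epsilon>_def)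
  have "\<exists>y\<in>S (x0 + h). \<exists>lam\<in>mult (x0 + h, y).
     (x0 + h, y) \<in> ball z0 r \<and> norm lam \<le> R_mult \<and>
     (\<forall>\<eta>>0. \<exists>\<^sub>F s in at_right 0. s * (fst (DL lam (x0 + h, y)) \<bullet> a - \<eta>) \<le> V (x0 + h + s *\<^sub>R a) - V (x0 + h))"
    if h: "h \<in> dcone u \<epsilon>" for h
  proof -
    define sj where "sj j = 1 / (real j + 1)" for j :: nat
    have sj: "sj j > 0" for j by (simp add: sj_def)
    have sj0: "sj \<longlonglongrightarrow> 0" unfolding sj_def by (rule inverse_Suc_tendsto_0)
    have "(\<lambda>j. h + sj j *\<^sub>R a) \<longlonglongrightarrow> h + 0 *\<^sub>R a" by (intro tendsto_intros sj0)
    then have hj: "(\<lambda>j. h + sj j *\<^sub>R a) \<longlonglongrightarrow> h" by simp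
    \<comment> \<open>Openness of the cone is what permits an arbitrary test direction
      \<open>a\<close> at the point \<open>h\<close>.\<close>
    from topological_tendstoD[OF this open_dcone h]
    obtain N where N: "\<And>j. j \<ge> N \<Longrightarrow> h + sj j *\<^sub>R a \<in> dcone u \<epsilon>" unfolding eventually_sequentially by blast
    have "\<forall>j. \<exists>y. y \<in> S (x0 + (h + sj (j + N) *\<^sub>R a)) \<and> (x0 + (h + sj (j + N) *\<^sub>R a), y) \<in> ball z0 r'"
      using \<epsilon>1(2) N sub(1) by (meson insertI2 le_add2 subsetD)
    from choice[OF this] obtain yj where yj: "\<And>j. yj j \<in> S (x0 + (h + sj (j + N) *\<^sub>R a))"
      "\<And>j. (x0 + (h + sj (j + N) *\<^sub>R a), yj j) \<in> ball z0 r'" by blast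
    have "dist y0 (yj j) \<le> r'" for j
      using yj(2)[of j] dist_snd_le[of z0 "(x0 + (h + sj (j + N) *\<^sub>R a), yj j)"] by simp
    then have "\<forall>j. yj j \<in> cball y0 r'" by simp
    then obtain y \<sigma> where \<sigma>: "strict_mono \<sigma>" and y: "(yj \<circ> \<sigma>) \<longlonglongrightarrow> y"
      using compact_cball[of y0 r'] unfolding compact_def by blast
    define s where "s j = sj (\<sigma> j + N)" for j
    define x where "x j = x0 + h + s j *\<^sub>R a" for j
    have s: "s j > 0" for j by (simp add: s_def sj)
    have "filterlim (\<lambda>j. \<sigma> j + N) at_top sequentially"
      by (rule filterlim_compose[OF filterlim_add_const_nat_at_top filterlim_subseq[OF \<sigma>]])
    then have s0: "s \<longlonglongrightarrow> 0" unfolding s_def by (rule filterlim_compose[OF sj0])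
    define yy where "yy = yj \<circ> \<sigma>"
    have yyS: "yy j \<in> S (x j)" for j using yj(1)[of "\<sigma> j"] by (simp add: yy_def x_def s_def add.assoc)
    have yy: "yy \<longlonglongrightarrow> y" using y by (simp add: yy_def)
    have inb: "(x j, yy j) \<in> ball z0 r'" for j using yj(2)[of "\<sigma> j"] by (simp add: yy_def x_def s_def add.assoc)
    have hs: "h + s j *\<^sub>R a \<in> dcone u \<epsilon>2" for j using N[of "\<sigma> j + N"] sub(2) by (auto simp: s_def)
    have "x \<longlonglongrightarrow> x0 + h + 0 *\<^sub>R a" unfolding x_def by (intro tendsto_intros s0)
    then have x: "x \<longlonglongrightarrow> x0 + h" by simp
    have xy: "(\<lambda>j. (x j, yy j)) \<longlonglongrightarrow> (x0 + h, y)" by (intro tendsto_intros x yy)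
    have "dist z0 (x0 + h, y) \<le> r'"
      by (rule tendsto_upperbound[OF tendsto_dist[OF tendsto_const xy]]) (use inb in \<open>auto intro!: always_eventually simp: less_imp_le\<close>)
    then have z: "(x0 + h, y) \<in> ball z0 r" "(x0 + h, y) \<in> ball z0 \<delta>1" "(x0 + h, y) \<in> ball z0 \<delta>2" using r' by auto
    \<comment> \<open>Closedness of the solution map at x0 + h: the values \<open>V (x j)\<close>
      converge because \<open>V\<close> is Lipschitz on the cone, so the limit point is
      optimal.\<close>
    have "y \<in> S (x0 + h)"
    proof -
      have "g (x0 + h, y) $ i \<le> 0" for i
        by (rule tendsto_upperbound[OF isCont_tendsto_compose[OF isCont_g xy]])
          (use yyS in \<open>auto intro!: always_eventually simp: sol_map_iff\<close>)
      moreover have "f (x0 + h, y) = V (x0 + h)"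
      proof -
        have "(\<lambda>j. V (x j) - V (x0 + h)) \<longlonglongrightarrow> 0"
        proof (rule Lim_null_comparison)
          have "\<bar>V (x j) - V (x0 + h)\<bar> \<le> L * norm (s j *\<^sub>R a)" for j
            using L(3) hs[of j] h sub(2) by (fastforce simp: x_def add.assoc)
          then show "\<forall>\<^sub>F j in sequentially. norm (V (x j) - V (x0 + h)) \<le> L * norm (s j *\<^sub>R a)" by simp
          have "(\<lambda>j. L * norm (s j *\<^sub>R a)) \<longlonglongrightarrow> L * norm ((0::real) *\<^sub>R a)" by (intro tendsto_intros s0)
          then show "(\<lambda>j. L * norm (s j *\<^sub>R a)) \<longlonglongrightarrow> 0" by simp
        qed
        then have "(\<lambda>j. V (x j)) \<longlonglongrightarrow> V (x0 + h)" by (rule LIM_zero_cancel)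
        moreover have "(\<lambda>j. V (x j)) \<longlonglongrightarrow> f (x0 + h, y)"
          using isCont_tendsto_compose[OF isCont_f xy] by (simp add: real_val_sol[OF yyS])
        ultimately show ?thesis by (rule LIMSEQ_unique[rotated])
      qed
      moreover have "V (x0 + h) \<le> f (x0 + h, y')" if "\<And>i. g (x0 + h, y') $ i \<le> 0" for y'
        using L(3) h sub(2) that by (intro real_val_le) auto
      ultimately show ?thesis by (simp add: sol_map_iff)
    qed
    moreover obtain lam where lam: "lam \<in> mult (x0 + h, y)" "norm lam \<le> R_mult"
      using \<delta>1(2) z(2) calculation by blast
    moreover have "\<exists>\<^sub>F s in at_right 0. s * (fst (DL lam (x0 + h, y)) \<bullet> a - \<eta>) \<le> V (x0 + h + s *\<^sub>R a) - V (x0 + h)"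
      if \<eta>: "\<eta> > 0" for \<eta>
    proof -
      define \<eta>' where "\<eta>' = \<eta> / (norm a + 1)"
      have pos: "norm a + 1 > 0" by (simp add: add_nonneg_pos)
      then have \<eta>': "\<eta>' > 0" using \<eta> by (simp add: \<eta>'_def)
      have "\<eta>' * norm a \<le> \<eta>' * (norm a + 1)" using \<eta>' by (intro mult_left_mono) auto
      also have "\<dots> = \<eta>" using pos by (simp add: \<eta>'_def)
      finally have le: "\<eta>' * norm a \<le> \<eta>" .
      obtain \<rho> where \<rho>: "\<rho> > 0" "\<forall>x' y'. (x', y') \<in> ball (x0 + h, y) \<rho> \<longrightarrow> y' \<in> S x' \<longrightarrow>
         fst (DL lam (x0 + h, y)) \<bullet> (x' - (x0 + h)) - \<eta>' * norm (x' - (x0 + h)) \<le> V x' - V (x0 + h)"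
        using \<delta>2(2)[rule_format, OF z(3) \<open>y \<in> S (x0 + h)\<close> lam(1) \<eta>'] by blast
      have ev: "\<forall>\<^sub>F j in sequentially. s j * (fst (DL lam (x0 + h, y)) \<bullet> a - \<eta>) \<le> V (x0 + h + s j *\<^sub>R a) - V (x0 + h)"
        using tendstoD[OF xy \<rho>(1)]
      proof eventually_elim
        case (elim j)
        then have "fst (DL lam (x0 + h, y)) \<bullet> (x j - (x0 + h)) - \<eta>' * norm (x j - (x0 + h)) \<le> V (x j) - V (x0 + h)"
          using \<rho>(2) yyS[of j] by (simp add: dist_commute)
        then have "s j * (fst (DL lam (x0 + h, y)) \<bullet> a - \<eta>' * norm a) \<le> V (x j) - V (x0 + h)"
          using s[of j] by (simp add: x_def algebra_simps)
        moreover have "s j * (fst (DL lam (x0 + h, y)) \<bullet> a - \<eta>) \<le> s j * (fst (DL lam (x0 + h, y)) \<bullet> a - \<eta>' * norm a)"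
          using le s[of j] by (intro mult_left_mono) auto
        ultimately show ?case by (simp add: x_def)
      qed
      have fl: "filterlim s (at_right 0) sequentially"
        unfolding filterlim_at using s0 s by (auto intro!: always_eventually simp: less_imp_neq[OF s, symmetric])
      show ?thesis
      proof (rule ccontr)
        assume "\<not> ?thesis"
        then have "\<forall>\<^sub>F s in at_right 0. \<not> s * (fst (DL lam (x0 + h, y)) \<bullet> a - \<eta>) \<le> V (x0 + h + s *\<^sub>R a) - V (x0 + h)"
          by (simp add: not_frequently)
        from eventually_compose_filterlim[OF this fl] ev have "\<forall>\<^sub>F j in sequentially. False"
          by eventually_elim blast
        then show False by simp
      qed
    qed
    ultimately show ?thesis using z(1) by blast
  qed
  then show ?thesis using \<epsilon> by blast
qed

end

lemma continuous_on_comb: "continuous_on X (comb A :: real ^ 'i \<Rightarrow> 'b::real_normed_vector)"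
  unfolding comb_def[abs_def] by (intro continuous_intros)

context directional_lower_level
begin

text \<open>The multipliers that parametrise W, cut off at the fixed radius so that the set is
  compact for the separation argument. Complementarity with the directional derivative is kept
  componentwise.\<close>

definition dir_mult :: "'b \<Rightarrow> (real ^ 'p) set" where
  "dir_mult v = {lam \<in> mult z0. norm lam \<le> R_mult \<and> (\<forall>i. lam $ i * (Dg z0 i \<bullet> (u, v)) = 0)}"

lemma convex_dir_mult: "convex (dir_mult v)"
proof (rule convexI)
  fix x y and a b :: real assume xy: "x \<in> dir_mult v" "y \<in> dir_mult v" and ab: "0 \<le> a" "0 \<le> b" "a + b = 1"
  have "snd (DL (a *\<^sub>R x + b *\<^sub>R y) z0) = a *\<^sub>R snd (DL x z0) + b *\<^sub>R snd (DL y z0)"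
  proof -
    have "snd (Df z0) = (a + b) *\<^sub>R snd (Df z0)" using ab by simp
    then show ?thesis by (simp add: DL_def comb_add comb_scaleR algebra_simps)
  qed
  moreover have "norm (a *\<^sub>R x + b *\<^sub>R y) \<le> R_mult"
  proof -
    have "a *\<^sub>R x + b *\<^sub>R y \<in> cball 0 R_mult"
      using xy ab by (intro convexD[OF convex_cball]) (auto simp: dir_mult_def)
    then show ?thesis by simp
  qed
  ultimately show "a *\<^sub>R x + b *\<^sub>R y \<in> dir_mult v"
    using xy ab by (simp add: dir_mult_def mult_def) (metis add.right_neutral mult_zero_right)
qed

lemma compact_dir_mult: "compact (dir_mult v)"
proof -
  have DL: "continuous_on UNIV (\<lambda>lam. DL lam z0)"
    unfolding DL_def by (intro continuous_intros continuous_on_comb)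
  have "closed (dir_mult v)"
    unfolding dir_mult_def mult_def mem_Collect_eq
    by (intro closed_Collect_conj closed_Collect_all closed_Collect_le closed_Collect_eq
        continuous_intros DL)
  moreover have "bounded (dir_mult v)" unfolding bounded_iff dir_mult_def by auto
  ultimately show ?thesis by (simp add: compact_eq_bounded_closed)
qed

text \<open>Since the y-part of the Lagrangian gradient vanishes, the sum of the products equals the
  slope of the multiplier minus that of \<open>f\<close>, which \<open>crit\<close> makes
  nonnegative; yet no summand is positive.\<close>

lemma critical_complementarity:
  assumes lam: "lam \<in> mult z0" and crit: "Df z0 \<bullet> (u, v) \<le> fst (DL lam z0) \<bullet> u"
    and g: "\<And>i. i \<in> act \<Longrightarrow> Dg z0 i \<bullet> (u, v) \<le> 0"
  shows "lam $ i * (Dg z0 i \<bullet> (u, v)) = 0"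
proof -
  have le: "lam $ i * (Dg z0 i \<bullet> (u, v)) \<le> 0" for i
  proof (cases "i \<in> act")
    case True
    then show ?thesis using lam g by (auto simp: mult_def intro: mult_nonneg_nonpos)
  next
    case False
    then have "lam $ i = 0" using lam by (auto simp: mult_def active_def)
    then show ?thesis by simp
  qed
  have "DL lam z0 \<bullet> (u, v) = fst (DL lam z0) \<bullet> u"
    using lam by (simp add: inner_prod_def mult_def)
  then have "(\<Sum>i\<in>UNIV. lam $ i * (Dg z0 i \<bullet> (u, v))) = fst (DL lam z0) \<bullet> u - Df z0 \<bullet> (u, v)"
    by (simp add: DL_def inner_add_left inner_comb)
  then have "(\<Sum>i\<in>UNIV. - (lam $ i * (Dg z0 i \<bullet> (u, v)))) \<le> 0" using crit by (simp add: sum_negf)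
  moreover have "(\<Sum>i\<in>UNIV. - (lam $ i * (Dg z0 i \<bullet> (u, v)))) \<ge> 0" using le by (intro sum_nonneg) simp
  ultimately have "(\<Sum>i\<in>UNIV. - (lam $ i * (Dg z0 i \<bullet> (u, v)))) = 0" by linarith
  then show ?thesis using le by (simp add: sum_nonneg_eq_0_iff)
qed

text \<open>Limit of \<open>penalty_stationary\<close> along a directional sequence. The convergent
  ratios \<open>\<alpha>\<close> and \<open>C\<close> are normalised violations; the unknown slope
  of \<open>V\<close> becomes a multiplier limit. The given \<open>lam\<close> only serves to place
  the slope of \<open>f\<close> along (u,v) below the maximal slope.\<close>

lemma penalty_multiplier:
  fixes h :: "'k::finite \<Rightarrow> 'a \<times> 'b \<Rightarrow> real"
  assumes h: "\<And>k z. GDERIV (h k) z :> Dh z k" "\<And>k z. isCont (\<lambda>z. Dh z k) z"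
    and t: "\<And>n. 0 < t n" "t \<longlonglongrightarrow> 0" and d: "d \<longlonglongrightarrow> (u, v)"
    and Q: "\<And>n. GDERIV (Q n) (z0 + t n *\<^sub>R d n) :> p n" "p \<longlonglongrightarrow> p0"
    and pos: "\<And>n. penalty (\<tau> n) f V h (z0 + t n *\<^sub>R d n) > 0"
    and min: "\<And>n. \<forall>\<^sub>F z' in nhds (z0 + t n *\<^sub>R d n).
      Q n (z0 + t n *\<^sub>R d n) + penalty (\<tau> n) f V h (z0 + t n *\<^sub>R d n) \<le> Q n z' + penalty (\<tau> n) f V h z'"
    and \<alpha>: "(\<lambda>n. max 0 (f (z0 + t n *\<^sub>R d n) - V (fst (z0 + t n *\<^sub>R d n))) / penalty (\<tau> n) f V h (z0 + t n *\<^sub>R d n)) \<longlonglongrightarrow> \<alpha>"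
    and C: "(\<lambda>n. \<chi> k. max 0 (h k (z0 + t n *\<^sub>R d n)) / penalty (\<tau> n) f V h (z0 + t n *\<^sub>R d n)) \<longlonglongrightarrow> C"
    and lam: "lam \<in> mult z0" and crit: "Df z0 \<bullet> (u, v) \<le> fst (DL lam z0) \<bullet> u"
    and g: "\<And>i. i \<in> act \<Longrightarrow> Dg z0 i \<bullet> (u, v) \<le> 0"
  shows "\<exists>mu\<in>dir_mult v. p0 + \<alpha> *\<^sub>R (Df z0 - (fst (DL mu z0), 0)) + comb (Dh z0) C = 0"
proof -
  define z where "z n = z0 + t n *\<^sub>R d n" for n
  define w where "w n = fst (d n)" for n
  have z: "z \<longlonglongrightarrow> z0" unfolding z_def using tendsto_add[OF tendsto_const dcone_sequence_0[OF t(2) d], of z0] by simp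
  have w: "w \<longlonglongrightarrow> u" unfolding w_def using tendsto_fst[OF d] by simp
  have fz: "fst (z n) = x0 + t n *\<^sub>R w n" for n by (simp add: z_def w_def)
  define A where "A n = max 0 (f (z n) - V (fst (z n))) / penalty (\<tau> n) f V h (z n)" for n
  define B where "B n = (\<chi> k. max 0 (h k (z n)) / penalty (\<tau> n) f V h (z n))" for n
  have A: "A \<longlonglongrightarrow> \<alpha>" using \<alpha> by (simp add: A_def[abs_def] z_def)
  have B: "B \<longlonglongrightarrow> C" using C by (simp add: B_def[abs_def] z_def)
  have Apos: "A n \<ge> 0" for n using pos[of n] by (simp add: A_def z_def less_imp_le)
  have ineq: "\<exists>mu\<in>dir_mult v. 0 \<le> (p0 + \<alpha> *\<^sub>R (Df z0 - (fst (DL mu z0), 0)) + comb (Dh z0) C) \<bullet> (a, b)" for a b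
  proof -
    \<comment> \<open>Records the Dini estimate at the selected solution, so that the extraction of
      subsequences does not lose it.\<close>
    define P where "P k y lam \<longleftrightarrow> (\<forall>\<eta>>0. \<exists>\<^sub>F s in at_right 0.
        s * (fst (DL lam (x0 + t k *\<^sub>R w k, y)) \<bullet> a - \<eta>) \<le> V (x0 + t k *\<^sub>R w k + s *\<^sub>R a) - V (x0 + t k *\<^sub>R w k))" for k y lam
    have x: "(\<lambda>k. x0 + t k *\<^sub>R w k) \<longlonglongrightarrow> x0"
      using tendsto_add[OF tendsto_const dcone_sequence_0[OF t(2) w], of x0] by simp
    have H: "\<exists>\<^sub>F k in sequentially. \<exists>y\<in>S (x0 + t k *\<^sub>R w k). \<exists>lam\<in>mult (x0 + t k *\<^sub>R w k, y).
        (x0 + t k *\<^sub>R w k, y) \<in> ball z0 r \<and> norm lam \<le> R_mult \<and> P k y lam" if r: "r > 0" for r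
    proof (rule eventually_frequently)
      obtain \<epsilon> where \<epsilon>: "\<epsilon> > 0" "\<forall>h\<in>dcone u \<epsilon>. \<exists>y\<in>S (x0 + h). \<exists>lam\<in>mult (x0 + h, y).
         (x0 + h, y) \<in> ball z0 r \<and> norm lam \<le> R_mult \<and>
         (\<forall>\<eta>>0. \<exists>\<^sub>F s in at_right 0. s * (fst (DL lam (x0 + h, y)) \<bullet> a - \<eta>) \<le> V (x0 + h + s *\<^sub>R a) - V (x0 + h))"
        using lower_dini[OF r, of a] by (elim exE conjE) (rule that)
      show "\<forall>\<^sub>F k in sequentially. \<exists>y\<in>S (x0 + t k *\<^sub>R w k). \<exists>lam\<in>mult (x0 + t k *\<^sub>R w k, y).
        (x0 + t k *\<^sub>R w k, y) \<in> ball z0 r \<and> norm lam \<le> R_mult \<and> P k y lam"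
        using dcone_eventually[OF t w \<epsilon>(1)] unfolding P_def
        by (rule eventually_mono) (erule \<epsilon>(2)[rule_format])
    qed simp
    obtain \<kappa> yk lamk mu where s: "filterlim \<kappa> at_top sequentially" "\<And>m. yk m \<in> S (x0 + t (\<kappa> m) *\<^sub>R w (\<kappa> m))" "yk \<longlonglongrightarrow> y0"
      "\<And>m. lamk m \<in> mult (x0 + t (\<kappa> m) *\<^sub>R w (\<kappa> m), yk m)" "lamk \<longlonglongrightarrow> mu" "norm mu \<le> R_mult"
      "\<And>m. P (\<kappa> m) (yk m) (lamk m)"
      by (rule multiplier_subsequence[where R = R_mult and P = P, OF x H]) (assumption | rule that)+
    have t\<kappa>: "(\<lambda>m. t (\<kappa> m)) \<longlonglongrightarrow> 0" by (rule filterlim_compose[OF t(2) s(1)])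
    have w\<kappa>: "(\<lambda>m. w (\<kappa> m)) \<longlonglongrightarrow> u" by (rule filterlim_compose[OF w s(1)])
    note lim = multiplier_limit_quotient[OF t(1) t\<kappa> w\<kappa> s(3,2,4,5)]
    \<comment> \<open>The limit multiplier is again a maximiser, so criticality transfers to it and
      forces complementarity with (u,v).\<close>
    have "fst (DL lam z0) \<bullet> u \<le> fst (DL mu z0) \<bullet> u"
      by (rule quotient_upper_maximal[OF t(1) t\<kappa> w\<kappa> lam]) (intro eventually_frequently lim(2), auto)
    then have "\<forall>i. mu $ i * (Dg z0 i \<bullet> (u, v)) = 0"
      using critical_complementarity[OF lim(1) _ g] crit by (meson order_trans)
    then have mu: "mu \<in> dir_mult v" using lim(1) s(6) by (simp add: dir_mult_def)
    define \<xi> where "\<xi> m = fst (DL (lamk m) (x0 + t (\<kappa> m) *\<^sub>R w (\<kappa> m), yk m)) \<bullet> a" for m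
    have \<xi>: "\<xi> \<longlonglongrightarrow> fst (DL mu z0) \<bullet> a" unfolding \<xi>_def
      by (intro tendsto_inner tendsto_const tendsto_fst tendsto_DL s(5) tendsto_Pair s(3) filterlim_compose[OF x s(1)])
    define \<eta> where "\<eta> m = 1 / (real m + 1)" for m :: nat
    have \<eta>: "\<eta> \<longlonglongrightarrow> 0" unfolding \<eta>_def by (rule inverse_Suc_tendsto_0)
    have st: "0 \<le> p (\<kappa> m) \<bullet> (a, b) + A (\<kappa> m) * (Df (z (\<kappa> m)) \<bullet> (a, b) - (\<xi> m - \<eta> m)) + comb (Dh (z (\<kappa> m))) (B (\<kappa> m)) \<bullet> (a, b)" for m
    proof -
      have "\<exists>\<^sub>F s in at_right 0. s * (\<xi> m - \<eta> m) \<le> V (fst (z (\<kappa> m)) + s *\<^sub>R a) - V (fst (z (\<kappa> m)))"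
        using s(7)[of m] unfolding P_def fz \<xi>_def by (simp add: \<eta>_def)
      from penalty_stationary[OF Q(1)[of "\<kappa> m", folded z_def] Df h(1) pos[of "\<kappa> m", folded z_def] min[of "\<kappa> m", folded z_def] this, of b]
      show ?thesis by (simp add: A_def B_def inner_comb)
    qed
    have z\<kappa>: "(\<lambda>m. z (\<kappa> m)) \<longlonglongrightarrow> z0" by (rule filterlim_compose[OF z s(1)])
    have "(\<lambda>m. p (\<kappa> m) \<bullet> (a, b) + A (\<kappa> m) * (Df (z (\<kappa> m)) \<bullet> (a, b) - (\<xi> m - \<eta> m)) + comb (Dh (z (\<kappa> m))) (B (\<kappa> m)) \<bullet> (a, b))
       \<longlonglongrightarrow> p0 \<bullet> (a, b) + \<alpha> * (Df z0 \<bullet> (a, b) - (fst (DL mu z0) \<bullet> a - 0)) + comb (Dh z0) C \<bullet> (a, b)"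
      by (intro tendsto_add tendsto_mult tendsto_diff tendsto_inner tendsto_const tendsto_comb \<xi> \<eta>
          filterlim_compose[OF Q(2) s(1)] filterlim_compose[OF A s(1)] filterlim_compose[OF B s(1)]
          isCont_tendsto_compose[OF isCont_Df z\<kappa>] isCont_tendsto_compose[OF h(2) z\<kappa>])
    then have "0 \<le> p0 \<bullet> (a, b) + \<alpha> * (Df z0 \<bullet> (a, b) - (fst (DL mu z0) \<bullet> a - 0)) + comb (Dh z0) C \<bullet> (a, b)"
      by (rule LIMSEQ_le_const) (use st in auto)
    then have "0 \<le> (p0 + \<alpha> *\<^sub>R (Df z0 - (fst (DL mu z0), 0)) + comb (Dh z0) C) \<bullet> (a, b)"
      by (simp add: inner_add_left inner_diff_left)
    then show ?thesis using mu by blast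
  qed
  \<comment> \<open>So far each direction has its own multiplier. \<open>T\<close> is affine, so the
    image of \<open>dir_mult\<close> is convex and compact; a vector e strictly separating it from 0
    would contradict the inequality in the direction -e.\<close>
  define T where "T mu = p0 + \<alpha> *\<^sub>R (Df z0 - (fst (DL mu z0), 0)) + comb (Dh z0) C" for mu
  have "convex (T ` dir_mult v)"
  proof -
    define l where "l mu = - \<alpha> *\<^sub>R (fst (comb (Dg z0) mu), 0 :: 'b)" for mu
    have "linear l"
      unfolding l_def by (intro linearI) (simp_all add: comb_add comb_scaleR algebra_simps)
    then have "convex ((+) (p0 + \<alpha> *\<^sub>R (Df z0 - (fst (Df z0), 0)) + comb (Dh z0) C) ` l ` dir_mult v)"
      by (intro convex_translation convex_linear_image convex_dir_mult)
    moreover have "T mu = p0 + \<alpha> *\<^sub>R (Df z0 - (fst (Df z0), 0)) + comb (Dh z0) C + l mu" for mu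
      by (simp add: T_def l_def DL_def prod_eq_iff algebra_simps)
    ultimately show ?thesis by (simp add: image_image)
  qed
  moreover have "compact (T ` dir_mult v)"
  proof (rule compact_continuous_image[OF _ compact_dir_mult])
    show "continuous_on (dir_mult v) T" unfolding T_def DL_def
      by (intro continuous_intros continuous_on_comb)
  qed
  ultimately have "0 \<in> T ` dir_mult v"
  proof (rule_tac ccontr)
    assume "convex (T ` dir_mult v)" "compact (T ` dir_mult v)" "0 \<notin> T ` dir_mult v"
    then obtain e c where e: "0 < c" "\<forall>x\<in>T ` dir_mult v. e \<bullet> x > c"
      using separating_hyperplane_closed_0[of "T ` dir_mult v"] compact_imp_closed by blast
    obtain mu where "mu \<in> dir_mult v" "0 \<le> T mu \<bullet> (- fst e, - snd e)"
      using ineq[of "- fst e" "- snd e"] unfolding T_def by blast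
    moreover have "T mu \<bullet> (- fst e, - snd e) = - (e \<bullet> T mu)"
      by (simp add: inner_prod_def inner_commute)
    ultimately show False using e by fastforce
  qed
  then show ?thesis unfolding T_def by force
qed

end

section \<open>Error bound and exact penalty along a direction\<close>

lemma dcone_fst: "e \<in> dcone (u, v) \<epsilon> \<Longrightarrow> fst e \<in> dcone u \<epsilon>"
proof -
  assume "e \<in> dcone (u, v) \<epsilon>"
  then obtain t w where e: "e = t *\<^sub>R w" "0 < t" "t < \<epsilon>" "norm (w - (u, v)) < \<epsilon>" unfolding dcone_def by blast
  have "norm (fst w - u) \<le> norm (w - (u, v))" by (cases w) (simp add: norm_fst_le)
  then show ?thesis using e unfolding dcone_def by (intro CollectI exI[of _ t] exI[of _ "fst w"]) auto
qed

text \<open>A displacement of size t r at scale t turns the direction by at most r, so balls with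
  radius small relative to t stay in the cone.\<close>

lemma dcone_shift:
  assumes "0 < t" "t < \<epsilon>" "norm (z - (z0 + t *\<^sub>R w)) \<le> t * r" "norm (w - d) + r < \<epsilon>"
  shows "z - z0 = t *\<^sub>R ((1 / t) *\<^sub>R (z - z0))" "norm ((1 / t) *\<^sub>R (z - z0) - d) \<le> norm (w - d) + r" "z - z0 \<in> dcone d \<epsilon>"
proof -
  show eq: "z - z0 = t *\<^sub>R ((1 / t) *\<^sub>R (z - z0))" using assms(1) by simp
  have "(1 / t) *\<^sub>R (z - z0) - w = (1 / t) *\<^sub>R (z - (z0 + t *\<^sub>R w))"
    using assms(1) by (simp add: algebra_simps)
  then have "norm ((1 / t) *\<^sub>R (z - z0) - w) \<le> r"
    using assms(1,3) by (simp add: pos_divide_le_eq mult.commute)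
  then show b: "norm ((1 / t) *\<^sub>R (z - z0) - d) \<le> norm (w - d) + r"
    using norm_triangle_ineq[of "(1 / t) *\<^sub>R (z - z0) - w" "w - d"] by simp
  show "z - z0 \<in> dcone d \<epsilon>"
    unfolding dcone_def using assms(1,2,4) b by (intro CollectI exI[of _ t] exI[of _ "(1 / t) *\<^sub>R (z - z0)"]) auto
qed

section \<open>Elementary properties of the penalty, and minimisers of penalised functions\<close>

lemma penalty_nonneg: "0 \<le> penalty \<tau> f v h z"
  unfolding penalty_def by (intro real_sqrt_ge_zero add_nonneg_nonneg sum_nonneg) auto

lemma penalty_mono_0: "penalty 0 f v h z \<le> penalty \<tau> f v h z"
  unfolding penalty_def by (intro real_sqrt_le_mono) simp

lemma penalty_pos: "\<tau> \<noteq> 0 \<Longrightarrow> 0 < penalty \<tau> f v h z"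
  unfolding penalty_def by (intro real_sqrt_gt_zero add_pos_nonneg sum_nonneg) auto

lemma penalty_eq_0_iff: "penalty 0 f v h z = 0 \<longleftrightarrow> f z \<le> v (fst z) \<and> (\<forall>k. h k z \<le> 0)"
proof -
  have "penalty 0 f v h z = 0 \<longleftrightarrow> (max 0 (f z - v (fst z)))\<^sup>2 + (\<Sum>k\<in>UNIV. (max 0 (h k z))\<^sup>2) = 0"
    by (simp add: penalty_def)
  also have "\<dots> \<longleftrightarrow> (max 0 (f z - v (fst z)))\<^sup>2 = 0 \<and> (\<Sum>k\<in>UNIV. (max 0 (h k z))\<^sup>2) = 0"
    by (intro add_nonneg_eq_0_iff sum_nonneg) auto
  also have "\<dots> \<longleftrightarrow> f z \<le> v (fst z) \<and> (\<forall>k. h k z \<le> 0)"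
  proof -
    have "(max 0 r)\<^sup>2 = 0 \<longleftrightarrow> r \<le> 0" for r :: real by (auto simp: max_def)
    then show ?thesis by (subst sum_nonneg_eq_0_iff) auto
  qed
  finally show ?thesis .
qed

lemma penalty_le_sum: "\<tau> \<ge> 0 \<Longrightarrow> penalty \<tau> f v h z \<le> \<tau> + max 0 (f z - v (fst z)) + (\<Sum>k\<in>UNIV. max 0 (h k z))"
proof -
  assume \<tau>: "\<tau> \<ge> 0"
  let ?a = "max 0 (f z - v (fst z))" and ?s = "\<Sum>k\<in>UNIV. max 0 (h k z)"
  have s: "?s \<ge> 0" by (intro sum_nonneg) auto
  have "sqrt (\<Sum>k\<in>UNIV. (max 0 (h k z))\<^sup>2) \<le> ?s"
    using L2_set_le_sum[of UNIV "\<lambda>k. max 0 (h k z)"] by (simp add: L2_set_def)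
  then have "(\<Sum>k\<in>UNIV. (max 0 (h k z))\<^sup>2) \<le> ?s\<^sup>2"
    using s by (simp add: real_sqrt_le_iff' sum_nonneg real_le_lsqrt sqrt_le_D)
  then have "\<tau>\<^sup>2 + ?a\<^sup>2 + (\<Sum>k\<in>UNIV. (max 0 (h k z))\<^sup>2) \<le> \<tau>\<^sup>2 + ?a\<^sup>2 + ?s\<^sup>2" by simp
  also have "\<dots> \<le> (\<tau> + ?a + ?s)\<^sup>2"
  proof -
    have "0 \<le> \<tau> * ?a" "0 \<le> \<tau> * ?s" "0 \<le> ?a * ?s" using \<tau> s by (auto intro!: mult_nonneg_nonneg)
    then show ?thesis by (simp add: power2_eq_square algebra_simps)
  qed
  finally show ?thesis unfolding penalty_def
    using \<tau> s by (intro real_le_lsqrt) auto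
qed

lemma continuous_on_penalty:
  fixes h :: "'k::finite \<Rightarrow> 'a::topological_space \<times> 'b::topological_space \<Rightarrow> real"
  assumes "continuous_on X f" "continuous_on X (\<lambda>z. v (fst z))" "\<And>k. continuous_on X (h k)"
  shows "continuous_on X (penalty \<tau> f v h)"
  unfolding penalty_def[abs_def] by (intro continuous_intros assms)

text \<open>Finite dimensional counterpart of a smooth variational principle: the quadratic term
  excludes minimisers on the sphere, so compactness yields an interior one. All smooth terms end up
  in one function with explicit gradient, and the nonsmooth \<open>\<Psi>\<close> is left
  untouched.\<close>

lemma penalised_min:
  fixes z1 :: "'a::euclidean_space \<times> 'b::euclidean_space"
  assumes B: "\<And>z. GDERIV B z :> DB z" and \<Psi>: "continuous_on (cball z1 \<rho>) \<Psi>" and \<rho>: "\<rho> > 0"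
    and bd: "\<And>z. norm (z - z1) = \<rho> \<Longrightarrow> B z1 + \<Psi> z1 < B z + c * \<rho>\<^sup>2 + \<Psi> z"
  obtains z where "norm (z - z1) < \<rho>"
    "GDERIV (\<lambda>z. B z + c * (norm (z - z1))\<^sup>2) z :> DB z + (2 * c) *\<^sub>R (z - z1)"
    "\<forall>\<^sub>F z' in nhds z. B z + c * (norm (z - z1))\<^sup>2 + \<Psi> z \<le> B z' + c * (norm (z' - z1))\<^sup>2 + \<Psi> z'"
proof -
  have "continuous_on (cball z1 \<rho>) B"
    using B by (intro continuous_at_imp_continuous_on) (auto intro: GDERIV_isCont)
  then have "continuous_on (cball z1 \<rho>) (\<lambda>z. B z + c * (norm (z - z1))\<^sup>2 + \<Psi> z)"
    by (intro continuous_intros \<Psi>)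
  then obtain z where z: "z \<in> cball z1 \<rho>" "\<And>z'. z' \<in> cball z1 \<rho> \<Longrightarrow>
      B z + c * (norm (z - z1))\<^sup>2 + \<Psi> z \<le> B z' + c * (norm (z' - z1))\<^sup>2 + \<Psi> z'"
    using continuous_attains_inf[of "cball z1 \<rho>" "\<lambda>z. B z + c * (norm (z - z1))\<^sup>2 + \<Psi> z"] \<rho> by auto
  have "norm (z - z1) \<noteq> \<rho>" using z(2)[of z1] bd[of z] \<rho> by auto
  then have lt: "norm (z - z1) < \<rho>" using z(1) by (simp add: dist_norm norm_minus_commute)
  show ?thesis
  proof (rule that[OF lt])
    have "GDERIV (\<lambda>z. c * (norm (z - z1))\<^sup>2) z :> c *\<^sub>R (2 *\<^sub>R (z - z1))"
      using GDERIV_mult[OF GDERIV_const[of c] GDERIV_norm_square[of z1 z]] by simp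
    then show "GDERIV (\<lambda>z. B z + c * (norm (z - z1))\<^sup>2) z :> DB z + (2 * c) *\<^sub>R (z - z1)"
      using GDERIV_add[OF B[of z]] by (simp add: mult.commute)
    have "z \<in> ball z1 \<rho>" using lt by (simp add: dist_norm norm_minus_commute)
    then have "\<forall>\<^sub>F z' in nhds z. z' \<in> ball z1 \<rho>" by (intro eventually_nhds_in_open) auto
    then show "\<forall>\<^sub>F z' in nhds z. B z + c * (norm (z - z1))\<^sup>2 + \<Psi> z \<le> B z' + c * (norm (z' - z1))\<^sup>2 + \<Psi> z'"
      by eventually_elim (use z(2) in auto)
  qed
qed

text \<open>Along the straight ray in a critical direction the violation is o(t);
  \<open>directional_stationarity\<close> starts its minimisations from such points.\<close>

lemma max0_quotient_tendsto_0:
  fixes h :: "'z::real_inner \<Rightarrow> real"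
  assumes h: "GDERIV h z0 :> D" and le: "h z0 \<le> 0" "h z0 = 0 \<Longrightarrow> D \<bullet> d \<le> 0"
  shows "((\<lambda>t. max 0 (h (z0 + t *\<^sub>R d) / t)) \<longlongrightarrow> 0) (at_right 0)"
proof (cases "h z0 = 0")
  case True
  have "((\<lambda>t. h (z0 + t *\<^sub>R d)) has_real_derivative D \<bullet> d) (at 0)" by (rule DERIV_line[OF h])
  then have "((\<lambda>t. h (z0 + t *\<^sub>R d) / t) \<longlongrightarrow> D \<bullet> d) (at 0)" using True by (simp add: DERIV_def)
  then have "((\<lambda>t. h (z0 + t *\<^sub>R d) / t) \<longlongrightarrow> D \<bullet> d) (at_right 0)" by (rule filterlim_mono) (auto intro: at_le)
  from tendsto_max[OF tendsto_const[of 0] this] show ?thesis using le(2)[OF True] by (simp add: max_absorb1)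
next
  case False
  then have neg: "h z0 < 0" using le by simp
  have "((\<lambda>t. z0 + t *\<^sub>R d) \<longlongrightarrow> z0 + 0 *\<^sub>R d) (at_right 0)" by (intro tendsto_intros)
  then have "((\<lambda>t. h (z0 + t *\<^sub>R d)) \<longlongrightarrow> h z0) (at_right 0)"
    using isCont_tendsto_compose[OF GDERIV_isCont[OF h]] by simp
  from order_tendstoD(2)[OF this neg] eventually_at_right_less[of 0]
  have "\<forall>\<^sub>F t in at_right 0. max 0 (h (z0 + t *\<^sub>R d) / t) = 0"
    by eventually_elim (simp add: max_absorb1 divide_nonpos_pos less_imp_le)
  then show ?thesis by (rule tendsto_eventually)
qed

text \<open>Here \<open>h\<close> collects all explicit constraints and \<open>\<Omega>\<close> is
  the bilevel feasible set. \<open>Df_le\<close> quantifies over the limit \<open>m\<close> in order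
  to avoid extended real derivatives. In \<open>quasinormal\<close> solvability along the sequence
  is provided, so that \<open>V\<close> may be read as the extended value function.\<close>

locale directional_program = directional_lower_level f g Df Dg x0 y0 u
  for f :: "'a::euclidean_space \<times> 'b::euclidean_space \<Rightarrow> real"
    and g :: "'a \<times> 'b \<Rightarrow> real ^ 'p"
    and Df Dg x0 y0 u +
  fixes F :: "'a \<times> 'b \<Rightarrow> real" and DF :: "'a \<times> 'b \<Rightarrow> 'a \<times> 'b"
    and h :: "'k::finite \<Rightarrow> 'a \<times> 'b \<Rightarrow> real" and Dh :: "'a \<times> 'b \<Rightarrow> 'k \<Rightarrow> 'a \<times> 'b"
    and \<Omega> :: "('a \<times> 'b) set" and v :: 'b
  assumes DF: "\<And>z. GDERIV F z :> DF z" and isCont_DF: "\<And>z. isCont DF z"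
    and Dh: "\<And>k z. GDERIV (h k) z :> Dh z k" and isCont_Dh: "\<And>k z. isCont (\<lambda>z. Dh z k) z"
    and feasible: "\<And>z. S (fst z) \<noteq> {} \<Longrightarrow> f z \<le> V (fst z) \<Longrightarrow> (\<And>k. h k z \<le> 0) \<Longrightarrow> z \<in> \<Omega>"
    and z0_mem: "z0 \<in> \<Omega>" and local_min: "\<exists>\<epsilon>>0. \<forall>z\<in>\<Omega> \<inter> ball z0 \<epsilon>. F z0 \<le> F z"
    and DF_le: "DF z0 \<bullet> (u, v) \<le> 0"
    and h_le: "\<And>k. h k z0 \<le> 0" and Dh_le: "\<And>k. h k z0 = 0 \<Longrightarrow> Dh z0 k \<bullet> (u, v) \<le> 0"
    and Dg_le: "\<And>i. i \<in> act \<Longrightarrow> Dg z0 i \<bullet> (u, v) \<le> 0"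
    and Df_le: "((\<lambda>t. (V (x0 + t *\<^sub>R u) - V x0) / t) \<longlongrightarrow> m) (at_right 0) \<Longrightarrow> Df z0 \<bullet> (u, v) \<le> m"
    and quasinormal: "\<And>\<alpha> C mu t d. \<lbrakk>mu \<in> dir_mult v; 0 \<le> \<alpha>; \<And>k. 0 \<le> C $ k; (\<alpha>, C) \<noteq> 0;
        \<alpha> *\<^sub>R (Df z0 - (fst (DL mu z0), 0)) + comb (Dh z0) C = 0;
        \<And>k. 0 < C $ k \<Longrightarrow> h k z0 = 0 \<and> Dh z0 k \<bullet> (u, v) = 0;
        \<And>n. 0 < t n; t \<longlonglongrightarrow> 0; d \<longlonglongrightarrow> (u, v);
        \<And>n. S (fst (z0 + t n *\<^sub>R d n)) \<noteq> {};
        \<And>n. 0 < \<alpha> \<Longrightarrow> V (fst (z0 + t n *\<^sub>R d n)) < f (z0 + t n *\<^sub>R d n);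
        \<And>n k. 0 < C $ k \<Longrightarrow> 0 < h k (z0 + t n *\<^sub>R d n)\<rbrakk> \<Longrightarrow> False"
begin

lemma regular_region:
  "\<exists>\<epsilon>>0. (\<forall>e\<in>dcone (u, v) \<epsilon>. S (fst (z0 + e)) \<noteq> {}) \<and>
    (\<forall>\<tau>. continuous_on ((+) z0 ` dcone (u, v) \<epsilon>) (penalty \<tau> f V h))"
proof -
  obtain L \<epsilon> where L: "L > 0" "\<epsilon> > 0" "\<forall>h\<in>insert 0 (dcone u \<epsilon>). S (x0 + h) \<noteq> {} \<and>
     (\<forall>h'\<in>insert 0 (dcone u \<epsilon>). \<bar>V (x0 + h) - V (x0 + h')\<bar> \<le> L * norm (h - h'))"
    using real_val_lipschitz by blast
  have ne: "S (fst (z0 + e)) \<noteq> {}" if "e \<in> dcone (u, v) \<epsilon>" for e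
    using L(3) dcone_fst[OF that] by simp
  have "L-lipschitz_on ((+) z0 ` dcone (u, v) \<epsilon>) (\<lambda>z. V (fst z))"
  proof (rule lipschitz_onI)
    fix z z' assume "z \<in> (+) z0 ` dcone (u, v) \<epsilon>" "z' \<in> (+) z0 ` dcone (u, v) \<epsilon>"
    then obtain e e' where e: "z = z0 + e" "z' = z0 + e'" "fst e \<in> dcone u \<epsilon>" "fst e' \<in> dcone u \<epsilon>"
      using dcone_fst by blast
    then have "\<bar>V (x0 + fst e) - V (x0 + fst e')\<bar> \<le> L * norm (fst e - fst e')" using L(3) by blast
    also have "\<dots> \<le> L * norm (e - e')"
      using L(1) by (cases "e - e'") (auto intro!: mult_left_mono norm_fst_le simp flip: fst_diff)
    finally show "dist (V (fst z)) (V (fst z')) \<le> L * dist z z'" by (simp add: e dist_norm)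
  qed (use L(1) in simp)
  then have V: "continuous_on ((+) z0 ` dcone (u, v) \<epsilon>) (\<lambda>z. V (fst z))"
    by (rule lipschitz_on_continuous_on)
  have "continuous_on ((+) z0 ` dcone (u, v) \<epsilon>) (penalty \<tau> f V h)" for \<tau>
    by (intro continuous_on_penalty V continuous_at_imp_continuous_on ballI isCont_f GDERIV_isCont[OF Dh])
  then show ?thesis using L(2) ne by blast
qed

text \<open>The violation vector divided by the penalty stays in the unit ball, so it has a limit,
  whose positive entries can only come from constraints violated on a tail. Both orthogonality
  conditions then follow from \<open>directional_complementarity\<close>.\<close>

lemma penalty_sequence_multiplier:
  assumes t: "\<And>n. 0 < t n" "t \<longlonglongrightarrow> 0" and d: "d \<longlonglongrightarrow> (u, v)"
    and Q: "\<And>n. GDERIV (Q n) (z0 + t n *\<^sub>R d n) :> p n" "p \<longlonglongrightarrow> p0"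
    and pos: "\<And>n. penalty (\<tau> n) f V h (z0 + t n *\<^sub>R d n) > 0"
    and min: "\<And>n. \<forall>\<^sub>F z' in nhds (z0 + t n *\<^sub>R d n).
      Q n (z0 + t n *\<^sub>R d n) + penalty (\<tau> n) f V h (z0 + t n *\<^sub>R d n) \<le> Q n z' + penalty (\<tau> n) f V h z'"
  obtains mu \<alpha> C and \<kappa> :: "nat \<Rightarrow> nat" where "mu \<in> dir_mult v" "0 \<le> \<alpha>" "\<And>k. 0 \<le> C $ k"
    "p0 + \<alpha> *\<^sub>R (Df z0 - (fst (DL mu z0), 0)) + comb (Dh z0) C = 0"
    "\<And>k. 0 < C $ k \<Longrightarrow> h k z0 = 0 \<and> Dh z0 k \<bullet> (u, v) = 0" "strict_mono \<kappa>"
    "\<And>n. 0 < \<alpha> \<Longrightarrow> V (fst (z0 + t (\<kappa> n) *\<^sub>R d (\<kappa> n))) < f (z0 + t (\<kappa> n) *\<^sub>R d (\<kappa> n))"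
    "\<And>n k. 0 < C $ k \<Longrightarrow> 0 < h k (z0 + t (\<kappa> n) *\<^sub>R d (\<kappa> n))"
    "(\<And>n. \<tau> n = 0) \<Longrightarrow> (\<alpha>, C) \<noteq> 0"
proof -
  define z where "z n = z0 + t n *\<^sub>R d n" for n
  let ?P = "\<lambda>n. penalty (\<tau> n) f V h (z n)"
  have Ppos: "?P n > 0" for n using pos[of n] by (simp add: z_def)
  define A where "A n = max 0 (f (z n) - V (fst (z n))) / ?P n" for n
  define B where "B n = (\<chi> k. max 0 (h k (z n)) / ?P n)" for n
  have A0: "A n \<ge> 0" and B0: "B n $ k \<ge> 0" for n k
    using Ppos[of n] by (simp_all add: A_def B_def less_imp_le)
  \<comment> \<open>At most 1 for every smoothing parameter, which gives compactness; exactly 1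
    without smoothing, which keeps the limit nonzero in the abnormal case.\<close>
  have normAB: "(norm (A n, B n))\<^sup>2 = 1 - (\<tau> n)\<^sup>2 / (?P n)\<^sup>2" for n
  proof -
    have "(norm (A n, B n))\<^sup>2 = (A n)\<^sup>2 + (norm (B n))\<^sup>2" by (simp add: norm_Pair)
    also have "(norm (B n))\<^sup>2 = (\<Sum>k\<in>UNIV. (B n $ k)\<^sup>2)"
      by (simp only: power2_norm_eq_inner inner_vec_def) (simp add: power2_eq_square)
    finally have "(norm (A n, B n))\<^sup>2 * (?P n)\<^sup>2 =
        (max 0 (f (z n) - V (fst (z n))))\<^sup>2 + (\<Sum>k\<in>UNIV. (max 0 (h k (z n)))\<^sup>2)"
      using Ppos[of n] by (simp add: A_def B_def power_divide add_divide_distrib[symmetric] sum_divide_distrib[symmetric])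
    also have "\<dots> = (?P n)\<^sup>2 - (\<tau> n)\<^sup>2"
      unfolding penalty_def by (subst real_sqrt_pow2) (auto intro!: add_nonneg_nonneg sum_nonneg)
    finally show ?thesis using Ppos[of n] by (simp add: field_simps)
  qed
  have "(norm (A n, B n))\<^sup>2 \<le> 1" for n unfolding normAB by simp
  then have "norm (A n, B n) \<le> 1" for n by (simp add: power_le_one_iff)
  then have "\<forall>n. (A n, B n) \<in> cball 0 1" by simp
  then obtain AB r where r: "strict_mono r" "((\<lambda>n. (A n, B n)) \<circ> r) \<longlonglongrightarrow> AB"
    using compact_cball[of "0::real \<times> (real^'k)" 1, unfolded compact_def, rule_format, of "\<lambda>n. (A n, B n)"] by blast
  define \<alpha> where "\<alpha> = fst AB"
  define C where "C = snd AB"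
  have Ar: "(\<lambda>n. A (r n)) \<longlonglongrightarrow> \<alpha>" and Br: "(\<lambda>n. B (r n)) \<longlonglongrightarrow> C"
    using tendsto_fst[OF r(2)] tendsto_snd[OF r(2)] by (simp_all add: \<alpha>_def C_def o_def)
  have Bk: "(\<lambda>n. B (r n) $ k) \<longlonglongrightarrow> C $ k" for k using Br by (rule tendsto_vec_nth)
  have "\<forall>\<^sub>F n in sequentially. (0 < \<alpha> \<longrightarrow> 0 < A (r n)) \<and> (\<forall>k. 0 < C $ k \<longrightarrow> 0 < B (r n) $ k)"
  proof (intro eventually_conj eventually_all_finite)
    show "\<forall>\<^sub>F n in sequentially. 0 < \<alpha> \<longrightarrow> 0 < A (r n)"
      using order_tendstoD(1)[OF Ar, of 0] by (cases "0 < \<alpha>") (auto elim: eventually_mono)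
    show "\<forall>\<^sub>F n in sequentially. 0 < C $ k \<longrightarrow> 0 < B (r n) $ k" for k
      using order_tendstoD(1)[OF Bk[of k], of 0] by (cases "0 < C $ k") (auto elim: eventually_mono)
  qed
  then obtain N where N: "\<And>n. n \<ge> N \<Longrightarrow> (0 < \<alpha> \<longrightarrow> 0 < A (r n)) \<and> (\<forall>k. 0 < C $ k \<longrightarrow> 0 < B (r n) $ k)"
    unfolding eventually_sequentially by blast
  define \<kappa> where "\<kappa> n = r (n + N)" for n
  have \<kappa>: "strict_mono \<kappa>" using r(1) by (simp add: \<kappa>_def strict_mono_def)
  have A\<kappa>: "(\<lambda>n. A (\<kappa> n)) \<longlonglongrightarrow> \<alpha>" and B\<kappa>: "(\<lambda>n. B (\<kappa> n)) \<longlonglongrightarrow> C"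
    unfolding \<kappa>_def using LIMSEQ_ignore_initial_segment[OF Ar, of N] LIMSEQ_ignore_initial_segment[OF Br, of N] by auto
  note sub = LIMSEQ_subseq_LIMSEQ[OF _ \<kappa>, unfolded o_def]
  have posh: "0 < h k (z (\<kappa> n))" if "0 < C $ k" for k n
  proof -
    have "0 < B (\<kappa> n) $ k" using N[of "n + N"] that by (simp add: \<kappa>_def)
    then show ?thesis using Ppos[of "\<kappa> n"] by (simp add: B_def zero_less_divide_iff)
  qed
  have posf: "V (fst (z (\<kappa> n))) < f (z (\<kappa> n))" if "0 < \<alpha>" for n
  proof -
    have "0 < A (\<kappa> n)" using N[of "n + N"] that by (simp add: \<kappa>_def)
    then show ?thesis using Ppos[of "\<kappa> n"] by (simp add: A_def zero_less_divide_iff)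
  qed
  obtain lam where lam: "lam \<in> mult z0"
    "((\<lambda>t. (V (x0 + t *\<^sub>R u) - V x0) / t) \<longlongrightarrow> fst (DL lam z0) \<bullet> u) (at_right 0)"
    using real_val_directional_derivative by blast
  have "\<exists>mu\<in>dir_mult v. p0 + \<alpha> *\<^sub>R (Df z0 - (fst (DL mu z0), 0)) + comb (Dh z0) C = 0"
  proof (rule penalty_multiplier[where t = "\<lambda>n. t (\<kappa> n)" and d = "\<lambda>n. d (\<kappa> n)" and Q = "\<lambda>n. Q (\<kappa> n)"
        and p = "\<lambda>n. p (\<kappa> n)" and \<tau> = "\<lambda>n. \<tau> (\<kappa> n)" and h = h and Dh = Dh, OF Dh isCont_Dh t(1) sub[OF t(2)] sub[OF d] Q(1) sub[OF Q(2)]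
        pos min _ _ lam(1) Df_le[OF lam(2)] Dg_le])
    show "(\<lambda>n. max 0 (f (z0 + t (\<kappa> n) *\<^sub>R d (\<kappa> n)) - V (fst (z0 + t (\<kappa> n) *\<^sub>R d (\<kappa> n)))) /
      penalty (\<tau> (\<kappa> n)) f V h (z0 + t (\<kappa> n) *\<^sub>R d (\<kappa> n))) \<longlonglongrightarrow> \<alpha>"
      using A\<kappa> unfolding A_def z_def .
    show "(\<lambda>n. \<chi> k. max 0 (h k (z0 + t (\<kappa> n) *\<^sub>R d (\<kappa> n))) / penalty (\<tau> (\<kappa> n)) f V h (z0 + t (\<kappa> n) *\<^sub>R d (\<kappa> n))) \<longlonglongrightarrow> C"
      using B\<kappa> unfolding B_def z_def .
  qed
  then obtain mu where mu: "mu \<in> dir_mult v" "p0 + \<alpha> *\<^sub>R (Df z0 - (fst (DL mu z0), 0)) + comb (Dh z0) C = 0" by blast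
  show ?thesis
  proof (rule that[of mu \<alpha> C \<kappa>])
    show "mu \<in> dir_mult v" "strict_mono \<kappa>" by fact+
    show "p0 + \<alpha> *\<^sub>R (Df z0 - (fst (DL mu z0), 0)) + comb (Dh z0) C = 0" by fact
    show "0 \<le> \<alpha>" by (rule LIMSEQ_le_const[OF Ar]) (use A0 in auto)
    show "0 \<le> C $ k" for k by (rule LIMSEQ_le_const[OF Bk]) (use B0 in auto)
    show "h k z0 = 0 \<and> Dh z0 k \<bullet> (u, v) = 0" if "0 < C $ k" for k
    proof (rule directional_complementarity[OF Dh t(1) sub[OF t(2)] sub[OF d] _ h_le Dh_le])
      show "\<exists>\<^sub>F n in sequentially. 0 < h k (z0 + t (\<kappa> n) *\<^sub>R d (\<kappa> n))"
        using posh[OF that] by (simp add: z_def)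
    qed
    show "V (fst (z0 + t (\<kappa> n) *\<^sub>R d (\<kappa> n))) < f (z0 + t (\<kappa> n) *\<^sub>R d (\<kappa> n))" if "0 < \<alpha>" for n
      using posf[OF that] by (simp add: z_def)
    show "0 < h k (z0 + t (\<kappa> n) *\<^sub>R d (\<kappa> n))" if "0 < C $ k" for n k
      using posh[OF that] by (simp add: z_def)
    show "(\<alpha>, C) \<noteq> 0" if "\<And>n. \<tau> n = 0"
    proof
      assume 0: "(\<alpha>, C) = 0"
      have "(\<lambda>n. (norm (A (\<kappa> n), B (\<kappa> n)))\<^sup>2) \<longlonglongrightarrow> (norm (\<alpha>, C))\<^sup>2" by (intro tendsto_intros A\<kappa> B\<kappa>)
      then have "(\<lambda>n::nat. 1::real) \<longlonglongrightarrow> 0" using 0 that by (simp add: normAB)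
      then show False by (simp add: LIMSEQ_const_iff)
    qed
  qed
qed

text \<open>Quantifying over \<open>r\<close> bounds the distance to \<open>\<Omega>\<close> without
  choosing a nearest point. If the bound fails, there are points whose violation is tiny compared
  with that distance. Minimising the violation plus a quadratic term nearby gives unsmoothed
  stationary points that are still infeasible, and their limit contradicts
  \<open>quasinormal\<close>.\<close>

lemma directional_error_bound:
  "\<exists>\<kappa>>0. \<exists>\<epsilon>>0. \<forall>e\<in>dcone (u, v) \<epsilon>. \<forall>r>\<kappa> * penalty 0 f V h (z0 + e). \<exists>w\<in>\<Omega>. dist (z0 + e) w < r"
proof (rule ccontr)
  assume neg: "\<not> ?thesis"
  obtain \<epsilon>1 where \<epsilon>1: "\<epsilon>1 > 0" "\<forall>e\<in>dcone (u, v) \<epsilon>1. S (fst (z0 + e)) \<noteq> {}"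
    "\<And>\<tau>. continuous_on ((+) z0 ` dcone (u, v) \<epsilon>1) (penalty \<tau> f V h)"
    using regular_region by blast
  let ?d = "(u, v)" and ?P = "penalty 0 f V h"
  \<comment> \<open>Calibrated so that, from n = 0 on, the balls used below lie in the cone of
    radius \<open>\<epsilon>1\<close>.\<close>
  define K where "K = (norm ?d + 2) / \<epsilon>1 + 1"
  have Kpos: "K \<ge> 1" using \<epsilon>1(1) by (simp add: K_def)
  have K: "(norm ?d + 2) / K < \<epsilon>1"
  proof -
    have "(norm ?d + 2) = (K - 1) * \<epsilon>1" using \<epsilon>1(1) by (simp add: K_def)
    also have "\<dots> < K * \<epsilon>1" using \<epsilon>1(1) by (simp add: algebra_simps)
    finally show ?thesis using Kpos by (simp add: pos_divide_less_eq mult.commute)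
  qed
  define s where "s n = (real n + 1) * K" for n :: nat
  have sK: "s n \<ge> K" for n using Kpos by (simp add: s_def mult_le_cancel_right1)
  have s1: "s n \<ge> 1" for n using sK[of n] Kpos by linarith
  have spos: "s n > 0" for n using s1[of n] by linarith
  have s0: "(\<lambda>n. c / s n) \<longlonglongrightarrow> 0" for c
  proof -
    have "(\<lambda>n. (c / K) * (1 / (real n + 1))) \<longlonglongrightarrow> (c / K) * 0"
      by (intro tendsto_intros inverse_Suc_tendsto_0)
    then show ?thesis by (simp add: s_def mult.commute)
  qed
  \<comment> \<open>The negated bound is used with factor s^2: one s shrinks \<open>\<rho>\<close>
    relative to \<open>r\<close>, the other makes the gradient of the quadratic term vanish in the
    limit.\<close>
  have "\<exists>e r. e \<in> dcone ?d (1 / s n) \<and> (s n)\<^sup>2 * ?P (z0 + e) < r \<and> (\<forall>w\<in>\<Omega>. \<not> dist (z0 + e) w < r)" for n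
  proof -
    have "(s n)\<^sup>2 > 0" "1 / s n > 0" using spos[of n] by auto
    with neg show ?thesis by meson
  qed
  then obtain e r where er: "\<And>n. e n \<in> dcone ?d (1 / s n)" "\<And>n. (s n)\<^sup>2 * ?P (z0 + e n) < r n"
    "\<And>n w. w \<in> \<Omega> \<Longrightarrow> r n \<le> dist (z0 + e n) w" by (metis not_less)
  have "\<exists>t w. e n = t *\<^sub>R w \<and> 0 < t \<and> t < 1 / s n \<and> norm (w - ?d) < 1 / s n" for n
    using er(1)[of n] unfolding dcone_def by blast
  then obtain t w where tw: "\<And>n. e n = t n *\<^sub>R w n" "\<And>n. 0 < t n" "\<And>n. t n < 1 / s n" "\<And>n. norm (w n - ?d) < 1 / s n"
    by metis
  define z1 where "z1 n = z0 + t n *\<^sub>R w n" for n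
  define \<rho> where "\<rho> n = r n / (2 * s n)" for n
  have P1: "(s n)\<^sup>2 * ?P (z1 n) < r n" for n
    using er(2)[of n] tw(1)[of n] by (simp add: z1_def)
  have far: "y \<in> \<Omega> \<Longrightarrow> r n \<le> dist (z1 n) y" for n y
    using er(3)[of y n] tw(1)[of n] by (simp add: z1_def)
  have rpos: "r n > 0" for n
    using P1[of n] mult_nonneg_nonneg[OF zero_le_power2[of "s n"] penalty_nonneg[of 0 f V h "z1 n"]] by linarith
  have \<rho>: "\<rho> n > 0" "\<rho> n < r n" for n
    using rpos[of n] s1[of n] by (auto simp: \<rho>_def pos_divide_less_eq)
  \<comment> \<open>As \<open>z0\<close> is itself in \<open>\<Omega>\<close>, its distance limits
    \<open>r\<close>, and hence \<open>\<rho>\<close> becomes small relative to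
    \<open>t\<close>.\<close>
  have r_le: "r n \<le> t n * norm (w n)" for n
    using far[OF z0_mem, of n] tw(2)[of n] by (simp add: z1_def dist_norm)
  have wn: "norm (w n) \<le> norm ?d + 1" for n
  proof -
    have "1 / s n \<le> 1" using s1[of n] by simp
    then show ?thesis using tw(4)[of n] norm_triangle_ineq2[of "w n" ?d] by linarith
  qed
  define q where "q n = (norm ?d + 1) / s n" for n
  have \<rho>q: "\<rho> n \<le> t n * q n" for n
  proof -
    have "\<rho> n \<le> r n / s n" using rpos[of n] spos[of n] by (simp add: \<rho>_def field_simps)
    also have "\<dots> \<le> (t n * (norm ?d + 1)) / s n"
      using order_trans[OF r_le mult_left_mono[OF wn less_imp_le[OF tw(2)]], of n] spos[of n]
      by (intro divide_right_mono) auto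
    finally show ?thesis by (simp add: q_def)
  qed
  have sh: "norm (w n - ?d) + q n < \<epsilon>1" "t n < \<epsilon>1" for n
  proof -
    have "norm (w n - ?d) + q n < 1 / s n + q n" using tw(4)[of n] by simp
    also have "\<dots> = (norm ?d + 2) / s n" by (simp add: q_def add_divide_distrib[symmetric])
    also have "\<dots> \<le> (norm ?d + 2) / K" using sK[of n] Kpos by (intro divide_left_mono) auto
    finally show "norm (w n - ?d) + q n < \<epsilon>1" using K by linarith
    have "t n < 1 / s n" by (rule tw(3))
    also have "\<dots> \<le> (norm ?d + 2) / s n" using spos[of n] by (intro divide_right_mono) auto
    also have "\<dots> \<le> (norm ?d + 2) / K" using sK[of n] Kpos by (intro divide_left_mono) auto
    finally show "t n < \<epsilon>1" using K by linarith
  qed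
  have in_cone: "z - z0 \<in> dcone ?d \<epsilon>1" if "norm (z - z1 n) \<le> \<rho> n" for z n
    using that \<rho>q[of n] by (intro dcone_shift(3)[OF tw(2)[of n] sh(2)[of n] _ sh(1)[of n]]) (simp add: z1_def)
  \<comment> \<open>Since \<open>\<rho>\<close> is less than \<open>r\<close>, the ball misses
    \<open>\<Omega>\<close>, so the violation is positive on all of it and the penalty is
    differentiable there without smoothing, apart from \<open>V\<close>.\<close>
  have Ppos: "?P z > 0" if "norm (z - z1 n) \<le> \<rho> n" for z n
  proof -
    have "S (fst z) \<noteq> {}" using \<epsilon>1(2) in_cone[OF that] by force
    have "z \<notin> \<Omega>" using far[of z n] \<rho>(2)[of n] that by (auto simp: dist_norm norm_minus_commute)
    then have "?P z \<noteq> 0" unfolding penalty_eq_0_iff using feasible \<open>S (fst z) \<noteq> {}\<close> by blast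
    then show ?thesis using penalty_nonneg[of 0 f V h z] by linarith
  qed
  \<comment> \<open>On the sphere the quadratic term equals the violation at the centre, so boundary
    points lose strictly; inside, its gradient is at most twice that violation divided by
    \<open>\<rho>\<close>, hence at most 4/s.\<close>
  define c where "c n = ?P (z1 n) / (\<rho> n)\<^sup>2" for n
  have ex: "\<exists>z. norm (z - z1 n) < \<rho> n \<and>
    GDERIV (\<lambda>z. 0 + c n * (norm (z - z1 n))\<^sup>2) z :> 0 + (2 * c n) *\<^sub>R (z - z1 n) \<and>
    (\<forall>\<^sub>F z' in nhds z. 0 + c n * (norm (z - z1 n))\<^sup>2 + ?P z \<le> 0 + c n * (norm (z' - z1 n))\<^sup>2 + ?P z')" for n
  proof -
    have "cball (z1 n) (\<rho> n) \<subseteq> (+) z0 ` dcone ?d \<epsilon>1"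
    proof
      fix z assume "z \<in> cball (z1 n) (\<rho> n)"
      then have "z - z0 \<in> dcone ?d \<epsilon>1" by (intro in_cone[where n = n]) (simp add: dist_norm norm_minus_commute)
      then show "z \<in> (+) z0 ` dcone ?d \<epsilon>1" by (intro image_eqI[of _ _ "z - z0"]) auto
    qed
    then have cont: "continuous_on (cball (z1 n) (\<rho> n)) ?P" using continuous_on_subset[OF \<epsilon>1(3)] by blast
    have "0 + ?P (z1 n) < 0 + c n * (\<rho> n)\<^sup>2 + ?P z" if "norm (z - z1 n) = \<rho> n" for z
      using Ppos[where z = z and n = n] that \<rho>(1)[of n] by (simp add: c_def)
    from penalised_min[OF GDERIV_const cont \<rho>(1) this] show ?thesis by blast
  qed
  obtain z where zall: "\<forall>n. norm (z n - z1 n) < \<rho> n \<and>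
    GDERIV (\<lambda>z. 0 + c n * (norm (z - z1 n))\<^sup>2) (z n) :> 0 + (2 * c n) *\<^sub>R (z n - z1 n) \<and>
    (\<forall>\<^sub>F z' in nhds (z n). 0 + c n * (norm (z n - z1 n))\<^sup>2 + ?P (z n) \<le> 0 + c n * (norm (z' - z1 n))\<^sup>2 + ?P z')"
    by (rule exE[OF choice[OF allI[OF ex]]]) (rule that)
  note z = zall[THEN spec, THEN conjunct1] zall[THEN spec, THEN conjunct2, THEN conjunct1]
    zall[THEN spec, THEN conjunct2, THEN conjunct2]
  define d where "d n = (1 / t n) *\<^sub>R (z n - z0)" for n
  have zd: "z0 + t n *\<^sub>R d n = z n" for n using tw(2)[of n] by (simp add: d_def)
  have t0: "t \<longlonglongrightarrow> 0"
    by (rule Lim_null_comparison[OF _ s0[of 1]]) (use tw(2,3) in \<open>auto intro!: always_eventually simp: less_imp_le\<close>)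
  have "(\<lambda>n. d n - ?d) \<longlonglongrightarrow> 0"
  proof (rule Lim_null_comparison[OF _ s0[of "norm ?d + 2"]], intro always_eventually allI)
    fix n
    have "norm (z n - (z0 + t n *\<^sub>R w n)) \<le> t n * q n"
      using z(1)[of n] \<rho>q[of n] by (simp add: z1_def)
    then have "norm (d n - ?d) \<le> norm (w n - ?d) + q n"
      unfolding d_def by (rule dcone_shift(2)[OF tw(2)[of n] sh(2)[of n] _ sh(1)[of n]])
    also have "\<dots> \<le> 1 / s n + q n" using tw(4)[of n] by simp
    also have "\<dots> = (norm ?d + 2) / s n" by (simp add: q_def add_divide_distrib[symmetric])
    finally show "norm (d n - ?d) \<le> (norm ?d + 2) / s n" .
  qed
  then have d0: "d \<longlonglongrightarrow> ?d" by (rule LIM_zero_cancel)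
  define p where "p n = 0 + (2 * c n) *\<^sub>R (z n - z1 n)" for n
  have p0: "p \<longlonglongrightarrow> 0"
  proof (rule Lim_null_comparison[OF _ s0[of 4]], intro always_eventually allI)
    fix n
    have c: "c n \<ge> 0" unfolding c_def using penalty_nonneg[of 0 f V h "z1 n"] by simp
    then have "norm (p n) \<le> 2 * c n * \<rho> n"
      using z(1)[of n] by (simp add: p_def mult_left_mono)
    also have "\<dots> = 2 * ?P (z1 n) / \<rho> n" using \<rho>(1)[of n] by (simp add: c_def power2_eq_square)
    also have "\<dots> \<le> 2 * (r n / (s n)\<^sup>2) / \<rho> n"
      using P1[of n] \<rho>(1)[of n] spos[of n]
      by (intro divide_right_mono mult_left_mono) (auto simp: pos_le_divide_eq mult.commute)
    also have "\<dots> = 4 / s n"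
      using rpos[of n] spos[of n] by (simp add: \<rho>_def power2_eq_square field_simps)
    finally show "norm (p n) \<le> 4 / s n" .
  qed
  obtain mu \<alpha> C and \<kappa> :: "nat \<Rightarrow> nat" where *: "mu \<in> dir_mult v" "0 \<le> \<alpha>" "\<And>k. 0 \<le> C $ k"
    "0 + \<alpha> *\<^sub>R (Df z0 - (fst (DL mu z0), 0)) + comb (Dh z0) C = 0"
    "\<And>k. 0 < C $ k \<Longrightarrow> h k z0 = 0 \<and> Dh z0 k \<bullet> (u, v) = 0" "strict_mono \<kappa>"
    "\<And>n. 0 < \<alpha> \<Longrightarrow> V (fst (z0 + t (\<kappa> n) *\<^sub>R d (\<kappa> n))) < f (z0 + t (\<kappa> n) *\<^sub>R d (\<kappa> n))"
    "\<And>n k. 0 < C $ k \<Longrightarrow> 0 < h k (z0 + t (\<kappa> n) *\<^sub>R d (\<kappa> n))"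
    "(\<alpha>, C) \<noteq> 0"
  proof (rule penalty_sequence_multiplier[where \<tau> = "\<lambda>_. 0" and Q = "\<lambda>n z. 0 + c n * (norm (z - z1 n))\<^sup>2" and p = p, OF tw(2) t0 d0 _ p0])
    show "GDERIV (\<lambda>z. 0 + c n * (norm (z - z1 n))\<^sup>2) (z0 + t n *\<^sub>R d n) :> p n" for n
      unfolding zd p_def by (rule z(2))
    show "0 < ?P (z0 + t n *\<^sub>R d n)" for n
      unfolding zd by (rule Ppos[OF less_imp_le[OF z(1)]])
    show "\<forall>\<^sub>F z' in nhds (z0 + t n *\<^sub>R d n). 0 + c n * (norm (z0 + t n *\<^sub>R d n - z1 n))\<^sup>2 + ?P (z0 + t n *\<^sub>R d n)
        \<le> 0 + c n * (norm (z' - z1 n))\<^sup>2 + ?P z'" for n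
      unfolding zd by (rule z(3))
  qed (rule that, assumption+, simp)
  show False
  proof (rule quasinormal[OF *(1,2,3) *(9) _ *(5) tw(2)])
    show "\<alpha> *\<^sub>R (Df z0 - (fst (DL mu z0), 0)) + comb (Dh z0) C = 0" using *(4) by simp
    show "(\<lambda>n. t (\<kappa> n)) \<longlonglongrightarrow> 0" "(\<lambda>n. d (\<kappa> n)) \<longlonglongrightarrow> ?d"
      using LIMSEQ_subseq_LIMSEQ[OF t0 *(6)] LIMSEQ_subseq_LIMSEQ[OF d0 *(6)] by (simp_all add: o_def)
    show "S (fst (z0 + t (\<kappa> n) *\<^sub>R d (\<kappa> n))) \<noteq> {}" for n
      unfolding zd using \<epsilon>1(2) in_cone[OF less_imp_le[OF z(1)[of "\<kappa> n"]]] by force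
  qed (use * in auto)
qed

text \<open>Exact penalisation: if the penalised value fell below \<open>F z0\<close>, the error
  bound would give a point of \<open>\<Omega>\<close> so close that the Lipschitz constant of
  \<open>F\<close> cannot make up the difference, contradicting local minimality.\<close>

lemma directional_exact_penalty:
  "\<exists>\<sigma>>0. \<exists>\<epsilon>>0. \<forall>e\<in>dcone (u, v) \<epsilon>. F z0 \<le> F (z0 + e) + \<sigma> * penalty 0 f V h (z0 + e)"
proof -
  let ?P = "penalty 0 f V h"
  obtain \<kappa> \<epsilon>1 where \<kappa>: "\<kappa> > 0" "\<epsilon>1 > 0" "\<forall>e\<in>dcone (u, v) \<epsilon>1. \<forall>r>\<kappa> * ?P (z0 + e). \<exists>w\<in>\<Omega>. dist (z0 + e) w < r"
    using directional_error_bound by blast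
  define L where "L = norm (DF z0) + 1"
  have L: "L > 0" by (simp add: L_def add_nonneg_pos)
  obtain \<delta>1 where \<delta>1: "\<delta>1 > 0" "\<And>z z'. z \<in> ball z0 \<delta>1 \<Longrightarrow> z' \<in> ball z0 \<delta>1 \<Longrightarrow> \<bar>F z - F z'\<bar> \<le> L * norm (z - z')"
    using GDERIV_local_lipschitz[OF DF isCont_DF] unfolding L_def by blast
  obtain \<delta>2 where \<delta>2: "\<delta>2 > 0" "\<forall>z\<in>\<Omega> \<inter> ball z0 \<delta>2. F z0 \<le> F z" using local_min by blast
  obtain \<epsilon>2 where \<epsilon>2: "\<epsilon>2 > 0" "\<forall>e\<in>dcone (u, v) \<epsilon>2. norm e < min \<delta>1 \<delta>2 / 2"
    using dcone_small[of "min \<delta>1 \<delta>2 / 2" "(u, v)"] \<delta>1(1) \<delta>2(1) by auto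
  have "F z0 \<le> F (z0 + e) + (L * \<kappa>) * ?P (z0 + e)" if e: "e \<in> dcone (u, v) (min \<epsilon>1 \<epsilon>2)" for e
  proof (rule ccontr)
    assume "\<not> ?thesis"
    then have lt: "\<kappa> * ?P (z0 + e) < (F z0 - F (z0 + e)) / L"
      using L by (simp add: pos_less_divide_eq mult.commute mult.left_commute)
    have e12: "e \<in> dcone (u, v) \<epsilon>1" "e \<in> dcone (u, v) \<epsilon>2"
      using e dcone_mono[of "min \<epsilon>1 \<epsilon>2" \<epsilon>1 "(u, v)"] dcone_mono[of "min \<epsilon>1 \<epsilon>2" \<epsilon>2 "(u, v)"] by auto
    have ne: "norm e < \<delta>1 / 2" "norm e < \<delta>2 / 2" using \<epsilon>2(2) e12(2) by auto
    have inb: "z0 + e \<in> ball z0 \<delta>1" "z0 \<in> ball z0 \<delta>1"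
      using ne \<delta>1(1) by (simp_all add: dist_norm norm_minus_commute del: add_Pair)
    have "F z0 - F (z0 + e) \<le> L * norm e" using \<delta>1(2)[OF inb(2,1)] by simp
    then have "(F z0 - F (z0 + e)) / L \<le> norm e" using L by (simp add: pos_divide_le_eq mult.commute)
    \<comment> \<open>The strict gap leaves room for a radius; it is below \<open>norm e\<close>, so
      the point found stays in both balls about \<open>z0\<close>.\<close>
    moreover obtain r where r: "\<kappa> * ?P (z0 + e) < r" "r < (F z0 - F (z0 + e)) / L" using dense[OF lt] by blast
    ultimately have re: "r < norm e" by linarith
    obtain w where w: "w \<in> \<Omega>" "dist (z0 + e) w < r" using \<kappa>(3) e12(1) r(1) by blast
    have "dist z0 w \<le> norm e + dist (z0 + e) w"
      using dist_triangle[of z0 w "z0 + e"] by (simp add: dist_norm)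
    then have dw: "dist z0 w < \<delta>1" "dist z0 w < \<delta>2" using w(2) re ne by linarith+
    then have "F z0 \<le> F w" using \<delta>2(2) w(1) by auto
    also have "F w \<le> F (z0 + e) + L * dist (z0 + e) w"
      using \<delta>1(2)[of w "z0 + e"] dw(1) inb(1) by (simp add: dist_norm norm_minus_commute)
    also have "\<dots> \<le> F (z0 + e) + L * r" using w(2) L by simp
    also have "\<dots> < F z0" using r(2) L by (simp add: pos_less_divide_eq mult.commute)
    finally show False by simp
  qed
  moreover have "L * \<kappa> > 0" "min \<epsilon>1 \<epsilon>2 > 0" using L \<kappa> \<epsilon>2 by auto
  ultimately show ?thesis by blast
qed

text \<open>The exact penalty only compares \<open>z0\<close> with points of a cone of which it is
  the apex, so \<open>z0\<close> need not be a local minimiser of the penalised function. Points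
  \<open>z1 t\<close> on the ray are almost optimal up to o(t), and true minimisers of a perturbed
  problem are found within o(t) of them.\<close>

lemma directional_stationarity:
  "\<exists>mu\<in>dir_mult v. \<exists>\<alpha>\<ge>0. \<exists>C. (\<forall>k. 0 \<le> C $ k) \<and>
    (\<forall>k. 0 < C $ k \<longrightarrow> h k z0 = 0 \<and> Dh z0 k \<bullet> (u, v) = 0) \<and>
    DF z0 + \<alpha> *\<^sub>R (Df z0 - (fst (DL mu z0), 0)) + comb (Dh z0) C = 0"
proof -
  let ?d = "(u, v)" and ?P = "\<lambda>\<tau>. penalty \<tau> f V h"
  obtain \<epsilon>1 where \<epsilon>1: "\<epsilon>1 > 0" "\<forall>e\<in>dcone ?d \<epsilon>1. S (fst (z0 + e)) \<noteq> {}"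
    "\<And>\<tau>. continuous_on ((+) z0 ` dcone ?d \<epsilon>1) (?P \<tau>)"
    using regular_region by blast
  obtain \<sigma> \<epsilon>2 where \<sigma>: "\<sigma> > 0" "\<epsilon>2 > 0" "\<forall>e\<in>dcone ?d \<epsilon>2. F z0 \<le> F (z0 + e) + \<sigma> * ?P 0 (z0 + e)"
    using directional_exact_penalty by blast
  define \<epsilon> where "\<epsilon> = min \<epsilon>1 \<epsilon>2"
  have \<epsilon>: "\<epsilon> > 0" using \<epsilon>1 \<sigma> by (simp add: \<epsilon>_def)
  have sub: "dcone ?d \<epsilon> \<subseteq> dcone ?d \<epsilon>1" "dcone ?d \<epsilon> \<subseteq> dcone ?d \<epsilon>2" by (auto intro!: dcone_mono simp: \<epsilon>_def)
  define z1 where "z1 t = z0 + t *\<^sub>R ?d" for t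
  \<comment> \<open>\<open>t * \<beta> t\<close> bounds the excess of the smoothed penalised value
    at \<open>z1 t\<close> over its value at \<open>z0\<close>. One summand t accounts for the
    smoothing parameter t*t, the other makes the inequality \<open>up\<close> strict.\<close>
  define \<beta> where "\<beta> t = max 0 ((F (z1 t) - F z0) / t) / \<sigma> + t + max 0 ((f (z1 t) - V (fst (z1 t))) / t)
     + (\<Sum>k\<in>UNIV. max 0 (h k (z1 t) / t)) + t" for t
  have \<beta>0: "(\<beta> \<longlongrightarrow> 0) (at_right 0)"
  proof -
    have F0: "GDERIV (\<lambda>z. F z - F z0) z0 :> DF z0" using GDERIV_diff[OF DF GDERIV_const] by simp
    have 1: "((\<lambda>t. max 0 ((F (z1 t) - F z0) / t)) \<longlongrightarrow> 0) (at_right 0)"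
      using max0_quotient_tendsto_0[OF F0, of ?d] DF_le by (simp add: z1_def)
    have 2: "((\<lambda>t. max 0 (h k (z1 t) / t)) \<longlongrightarrow> 0) (at_right 0)" for k
      using max0_quotient_tendsto_0[OF Dh h_le Dh_le] by (simp add: z1_def)
    have 3: "((\<lambda>t. max 0 ((f (z1 t) - V (fst (z1 t))) / t)) \<longlongrightarrow> 0) (at_right 0)"
    proof -
      obtain lam where lam: "((\<lambda>t. (V (x0 + t *\<^sub>R u) - V x0) / t) \<longlongrightarrow> fst (DL lam z0) \<bullet> u) (at_right 0)"
        using real_val_directional_derivative by blast
      have "((\<lambda>t. (f (z0 + t *\<^sub>R ?d) - f z0) / t) \<longlongrightarrow> Df z0 \<bullet> ?d) (at 0)"
        using DERIV_line[OF Df[of z0], of ?d] by (simp add: DERIV_def zero_prod_def[symmetric])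
      then have "((\<lambda>t. (f (z0 + t *\<^sub>R ?d) - f z0) / t) \<longlongrightarrow> Df z0 \<bullet> ?d) (at_right 0)"
        by (rule filterlim_mono) (auto intro: at_le)
      from tendsto_diff[OF this lam]
      have "((\<lambda>t. (f (z1 t) - V (fst (z1 t))) / t) \<longlongrightarrow> Df z0 \<bullet> ?d - fst (DL lam z0) \<bullet> u) (at_right 0)"
        by (simp add: z1_def diff_divide_distrib[symmetric] real_val_sol[OF sol0])
      from tendsto_max[OF tendsto_const[of 0] this] show ?thesis
        using Df_le[OF lam] by (simp add: max_absorb1)
    qed
    have "(\<beta> \<longlongrightarrow> 0 / \<sigma> + 0 + 0 + (\<Sum>k\<in>(UNIV::'k set). 0) + 0) (at_right 0)"
      unfolding \<beta>_def using \<sigma>(1) by (intro tendsto_intros 1 2 3) auto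
    then show ?thesis by simp
  qed
  \<comment> \<open>A null sequence below \<open>\<epsilon>\<close> that dominates both the scale
    \<open>t n\<close> and the relative radius \<open>q n\<close>.\<close>
  define \<theta> where "\<theta> n = min (\<epsilon> / 2) (1 / (real n + 1))" for n :: nat
  have \<theta>: "\<theta> n > 0" "\<theta> n \<le> 1 / (real n + 1)" "\<theta> n < \<epsilon>" for n using \<epsilon> by (auto simp: \<theta>_def)
  have \<theta>0: "\<theta> \<longlonglongrightarrow> 0"
  proof (rule Lim_null_comparison)
    show "(\<lambda>n. 1 / (real n + 1)) \<longlonglongrightarrow> 0" by (rule inverse_Suc_tendsto_0)
    show "\<forall>\<^sub>F n in sequentially. norm (\<theta> n) \<le> 1 / (real n + 1)"
      using \<theta> by (auto intro!: always_eventually simp: less_imp_le)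
  qed
  have "\<exists>t. 0 < t \<and> t < \<theta> n \<and> \<beta> t < (\<theta> n)\<^sup>2" for n
  proof -
    have "(\<theta> n)\<^sup>2 > 0" using \<theta>(1)[of n] by simp
    from order_tendstoD(2)[OF \<beta>0 this] eventually_at_right_real[OF \<theta>(1)[of n]]
    have "\<forall>\<^sub>F t in at_right 0. 0 < t \<and> t < \<theta> n \<and> \<beta> t < (\<theta> n)\<^sup>2" by eventually_elim auto
    then show ?thesis using eventually_happens' trivial_limit_at_right_real by blast
  qed
  then obtain t where t: "\<And>n. 0 < t n" "\<And>n. t n < \<theta> n" "\<And>n. \<beta> (t n) < (\<theta> n)\<^sup>2" by metis
  define b where "b n = \<beta> (t n)" for n
  define q where "q n = sqrt (b n)" for n
  have b: "b n > 0" for n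
  proof -
    have "0 \<le> max 0 ((F (z1 (t n)) - F z0) / t n) / \<sigma>" using \<sigma>(1) by simp
    moreover have "0 \<le> (\<Sum>k\<in>UNIV. max 0 (h k (z1 (t n)) / t n))" by (intro sum_nonneg) simp
    ultimately show ?thesis unfolding b_def \<beta>_def using t(1)[of n] by linarith
  qed
  have q: "q n > 0" "(q n)\<^sup>2 = b n" for n using b[of n] by (simp_all add: q_def)
  have q\<theta>: "q n < \<theta> n" for n
    using t(3)[of n] \<theta>(1)[of n] unfolding q_def b_def by (intro real_less_lsqrt) auto
  have tq: "t n < \<epsilon>" "q n < \<epsilon>" for n using t(2)[of n] q\<theta>[of n] \<theta>(3)[of n] by linarith+
  let ?z = "\<lambda>n. z1 (t n)"
  \<comment> \<open>With \<open>q\<close> the square root of the relative excess and the weight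
    \<open>c = 1/t\<close>, the quadratic term on the sphere is t q^2, exactly the possible
    decrease, while its gradient inside is at most 2q.\<close>
  define \<rho> where "\<rho> n = t n * q n" for n
  have \<rho>: "\<rho> n > 0" for n using t(1) q(1) by (simp add: \<rho>_def)
  have in_cone: "z - z0 \<in> dcone ?d \<epsilon>" if "norm (z - ?z n) \<le> \<rho> n" for z n
    using that q(1)[of n] tq(2)[of n] by (intro dcone_shift(3)[where t = "t n" and r = "q n" and w = ?d]) (auto simp: z1_def \<rho>_def t tq)
  \<comment> \<open>Scaling the objective instead of the penalty keeps the penalty coefficient 1;
    the factor \<open>\<sigma>\<close> is put back at the end.\<close>
  define B where "B z = F z / \<sigma>" for z
  have B: "GDERIV B z :> (1 / \<sigma>) *\<^sub>R DF z" for z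
    using GDERIV_mult[OF GDERIV_const[of "1 / \<sigma>"] DF[of z]] by (simp add: B_def[abs_def])
  have low: "B z0 \<le> B z + ?P (t n * t n) z" if "norm (z - ?z n) \<le> \<rho> n" for z n
  proof -
    have "F z0 \<le> F z + \<sigma> * ?P 0 z" using \<sigma>(3) in_cone[OF that] sub(2) by force
    also have "\<dots> \<le> F z + \<sigma> * ?P (t n * t n) z"
      using penalty_mono_0[of f V h z "t n * t n"] \<sigma>(1) by simp
    finally show ?thesis using \<sigma>(1) by (simp add: B_def field_simps)
  qed
  \<comment> \<open>Together with \<open>low\<close> this shows that the penalised value can drop by
    less than \<open>t n * b n\<close> below that of the centre.\<close>
  have up: "B (?z n) + ?P (t n * t n) (?z n) < B z0 + t n * b n" for n
  proof -
    have max: "t n * max 0 (a / t n) = max 0 a" for a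
      using t(1)[of n] by (simp add: max_def field_simps)
    have "?P (t n * t n) (?z n) \<le> t n * t n + max 0 (f (?z n) - V (fst (?z n))) + (\<Sum>k\<in>UNIV. max 0 (h k (?z n)))"
      using t(1)[of n] by (intro penalty_le_sum) simp
    moreover have "B (?z n) - B z0 \<le> max 0 (F (?z n) - F z0) / \<sigma>"
      using \<sigma>(1) by (simp add: B_def diff_divide_distrib[symmetric] divide_right_mono)
    moreover have "t n * b n = max 0 (F (?z n) - F z0) / \<sigma> + t n * t n + max 0 (f (?z n) - V (fst (?z n)))
        + (\<Sum>k\<in>UNIV. max 0 (h k (?z n))) + t n * t n"
      by (simp add: b_def \<beta>_def distrib_left sum_distrib_left max)
    ultimately show ?thesis using mult_pos_pos[OF t(1) t(1), of n n] by linarith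
  qed
  define c where "c n = 1 / t n" for n
  have c\<rho>: "c n * (\<rho> n)\<^sup>2 = t n * b n" for n
    using t(1)[of n] by (simp add: c_def \<rho>_def power_mult_distrib q(2)) (simp add: power2_eq_square)
  have ex: "\<exists>z. norm (z - ?z n) < \<rho> n \<and>
    GDERIV (\<lambda>z. B z + c n * (norm (z - ?z n))\<^sup>2) z :> (1 / \<sigma>) *\<^sub>R DF z + (2 * c n) *\<^sub>R (z - ?z n) \<and>
    (\<forall>\<^sub>F z' in nhds z. B z + c n * (norm (z - ?z n))\<^sup>2 + ?P (t n * t n) z \<le> B z' + c n * (norm (z' - ?z n))\<^sup>2 + ?P (t n * t n) z')" for n
  proof -
    have "cball (?z n) (\<rho> n) \<subseteq> (+) z0 ` dcone ?d \<epsilon>1"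
    proof
      fix z assume "z \<in> cball (?z n) (\<rho> n)"
      then have "norm (z - ?z n) \<le> \<rho> n" by (simp add: dist_norm norm_minus_commute)
      from in_cone[OF this] sub(1) show "z \<in> (+) z0 ` dcone ?d \<epsilon>1" by (intro image_eqI[of _ _ "z - z0"]) auto
    qed
    then have cont: "continuous_on (cball (?z n) (\<rho> n)) (?P (t n * t n))" using continuous_on_subset[OF \<epsilon>1(3)] by blast
    have "B (?z n) + ?P (t n * t n) (?z n) < B z + c n * (\<rho> n)\<^sup>2 + ?P (t n * t n) z" if "norm (z - ?z n) = \<rho> n" for z
      using low[of z n] up[of n] that c\<rho>[of n] by linarith
    from penalised_min[OF B cont \<rho> this] show ?thesis by blast
  qed
  obtain z where zall: "\<forall>n. norm (z n - ?z n) < \<rho> n \<and>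
    GDERIV (\<lambda>z. B z + c n * (norm (z - ?z n))\<^sup>2) (z n) :> (1 / \<sigma>) *\<^sub>R DF (z n) + (2 * c n) *\<^sub>R (z n - ?z n) \<and>
    (\<forall>\<^sub>F z' in nhds (z n). B (z n) + c n * (norm (z n - ?z n))\<^sup>2 + ?P (t n * t n) (z n) \<le> B z' + c n * (norm (z' - ?z n))\<^sup>2 + ?P (t n * t n) z')"
    by (rule exE[OF choice[OF allI[OF ex]]]) (rule that)
  note z = zall[THEN spec, THEN conjunct1] zall[THEN spec, THEN conjunct2, THEN conjunct1]
    zall[THEN spec, THEN conjunct2, THEN conjunct2]
  define d where "d n = (1 / t n) *\<^sub>R (z n - z0)" for n
  have zd: "z0 + t n *\<^sub>R d n = z n" for n using t(1)[of n] by (simp add: d_def)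
  have t0: "t \<longlonglongrightarrow> 0"
    by (rule Lim_null_comparison[OF _ \<theta>0]) (use t(1,2) in \<open>auto intro!: always_eventually simp: less_imp_le\<close>)
  have q0: "q \<longlonglongrightarrow> 0"
    by (rule Lim_null_comparison[OF _ \<theta>0]) (use q(1) q\<theta> in \<open>auto intro!: always_eventually simp: less_imp_le\<close>)
  have "(\<lambda>n. d n - ?d) \<longlonglongrightarrow> 0"
  proof (rule Lim_null_comparison[OF _ q0], intro always_eventually allI)
    fix n
    have "norm (z n - (z0 + t n *\<^sub>R ?d)) \<le> t n * q n" using z(1)[of n] by (simp add: z1_def \<rho>_def)
    from dcone_shift(2)[OF t(1)[of n] tq(1)[of n] this, of ?d] tq(2)[of n]
    show "norm (d n - ?d) \<le> q n" by (simp add: d_def)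
  qed
  then have d0: "d \<longlonglongrightarrow> ?d" by (rule LIM_zero_cancel)
  define p where "p n = (1 / \<sigma>) *\<^sub>R DF (z n) + (2 * c n) *\<^sub>R (z n - ?z n)" for n
  have zlim: "z \<longlonglongrightarrow> z0"
    using tendsto_add[OF tendsto_const dcone_sequence_0[OF t0 d0], of z0] by (simp add: zd)
  have "(\<lambda>n. (2 * c n) *\<^sub>R (z n - ?z n)) \<longlonglongrightarrow> 0"
  proof (rule Lim_null_comparison)
    have "(\<lambda>n. 2 * q n) \<longlonglongrightarrow> 2 * 0" by (intro tendsto_intros q0)
    then show "(\<lambda>n. 2 * q n) \<longlonglongrightarrow> 0" by simp
    have "norm ((2 * c n) *\<^sub>R (z n - ?z n)) \<le> 2 * q n" for n
    proof -
      have "norm ((2 * c n) *\<^sub>R (z n - ?z n)) = 2 * c n * norm (z n - ?z n)" using t(1)[of n] by (simp add: c_def)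
      also have "\<dots> \<le> 2 * c n * \<rho> n" using z(1)[of n] t(1)[of n] by (intro mult_left_mono) (auto simp: c_def)
      also have "\<dots> = 2 * q n" using t(1)[of n] by (simp add: c_def \<rho>_def)
      finally show ?thesis .
    qed
    then show "\<forall>\<^sub>F n in sequentially. norm ((2 * c n) *\<^sub>R (z n - ?z n)) \<le> 2 * q n" by simp
  qed
  then have "(\<lambda>n. (1 / \<sigma>) *\<^sub>R DF (z n) + (2 * c n) *\<^sub>R (z n - ?z n)) \<longlonglongrightarrow> (1 / \<sigma>) *\<^sub>R DF z0 + 0"
    by (intro tendsto_add tendsto_scaleR tendsto_const isCont_tendsto_compose[OF isCont_DF zlim])
  then have p0: "p \<longlonglongrightarrow> (1 / \<sigma>) *\<^sub>R DF z0" by (simp add: p_def[abs_def])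
  obtain mu \<alpha> C and \<kappa> :: "nat \<Rightarrow> nat" where *: "mu \<in> dir_mult v" "0 \<le> \<alpha>" "\<And>k. 0 \<le> C $ k"
    "(1 / \<sigma>) *\<^sub>R DF z0 + \<alpha> *\<^sub>R (Df z0 - (fst (DL mu z0), 0)) + comb (Dh z0) C = 0"
    "\<And>k. 0 < C $ k \<Longrightarrow> h k z0 = 0 \<and> Dh z0 k \<bullet> (u, v) = 0"
  proof (rule penalty_sequence_multiplier[where \<tau> = "\<lambda>n. t n * t n" and Q = "\<lambda>n z. B z + c n * (norm (z - ?z n))\<^sup>2" and p = p, OF t(1) t0 d0 _ p0])
    show "GDERIV (\<lambda>z. B z + c n * (norm (z - ?z n))\<^sup>2) (z0 + t n *\<^sub>R d n) :> p n" for n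
      unfolding zd p_def by (rule z(2))
    show "0 < ?P (t n * t n) (z0 + t n *\<^sub>R d n)" for n using t(1)[of n] by (intro penalty_pos) simp
    show "\<forall>\<^sub>F z' in nhds (z0 + t n *\<^sub>R d n). B (z0 + t n *\<^sub>R d n) + c n * (norm (z0 + t n *\<^sub>R d n - ?z n))\<^sup>2 + ?P (t n * t n) (z0 + t n *\<^sub>R d n)
        \<le> B z' + c n * (norm (z' - ?z n))\<^sup>2 + ?P (t n * t n) z'" for n
      unfolding zd by (rule z(3))
  qed (rule that)
  have "DF z0 + (\<sigma> * \<alpha>) *\<^sub>R (Df z0 - (fst (DL mu z0), 0)) + comb (Dh z0) (\<sigma> *\<^sub>R C) = 0"
  proof -
    have "\<sigma> *\<^sub>R ((1 / \<sigma>) *\<^sub>R DF z0 + \<alpha> *\<^sub>R (Df z0 - (fst (DL mu z0), 0)) + comb (Dh z0) C) = 0" using *(4) by simp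
    then show ?thesis using \<sigma>(1) by (simp add: scaleR_add_right comb_scaleR)
  qed
  moreover have "0 \<le> \<sigma> * \<alpha>" "\<forall>k. 0 \<le> (\<sigma> *\<^sub>R C) $ k" using \<sigma>(1) * by simp_all
  moreover have "\<forall>k. 0 < (\<sigma> *\<^sub>R C) $ k \<longrightarrow> h k z0 = 0 \<and> Dh z0 k \<bullet> (u, v) = 0"
    using \<sigma>(1) *(5) by (simp add: zero_less_mult_iff)
  ultimately show ?thesis using *(1) by blast
qed

end

section \<open>The bilevel program\<close>

lemma gradient_eqI:
  assumes "GDERIV \<phi> a :> D"
  shows "gradient \<phi> a = D"
  unfolding gradient_def
proof (rule the_equality[of "\<lambda>D. GDERIV \<phi> a :> D", OF assms])
  fix D' assume "GDERIV \<phi> a :> D'"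
  then have "(\<lambda>h. h \<bullet> D') = (\<lambda>h. h \<bullet> D)"
    using assms unfolding gderiv_def by (rule has_derivative_unique)
  then have "(D' - D) \<bullet> D' = (D' - D) \<bullet> D" by meson
  then have "(D' - D) \<bullet> (D' - D) = 0" by (simp add: inner_diff_right)
  then show "D' = D" by simp
qed

lemma cont_differentiable_gradient:
  fixes \<phi> :: "'z::euclidean_space \<Rightarrow> real"
  assumes "cont_differentiable \<phi>"
  shows "GDERIV \<phi> z :> gradient \<phi> z" and "isCont (gradient \<phi>) z"
proof -
  obtain \<phi>' where d: "\<And>z. (\<phi> has_derivative blinfun_apply (\<phi>' z)) (at z)" and c: "continuous_on UNIV \<phi>'"
    using assms unfolding cont_differentiable_def by blast
  define D where "D z = (\<Sum>b\<in>Basis. blinfun_apply (\<phi>' z) b *\<^sub>R b)" for z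
  have app: "blinfun_apply (\<phi>' z) = (\<lambda>h. h \<bullet> D z)" for z
  proof
    fix h
    have "blinfun_apply (\<phi>' z) h = blinfun_apply (\<phi>' z) (\<Sum>b\<in>Basis. (h \<bullet> b) *\<^sub>R b)"
      by (simp add: euclidean_representation)
    also have "\<dots> = h \<bullet> D z"
      by (simp add: D_def blinfun.sum_right blinfun.scaleR_right inner_sum_right mult.commute)
    finally show "blinfun_apply (\<phi>' z) h = h \<bullet> D z" .
  qed
  have G: "GDERIV \<phi> z :> D z" for z using d[of z] by (simp add: gderiv_def app)
  then have eq: "gradient \<phi> = D" using gradient_eqI by blast
  show "GDERIV \<phi> z :> gradient \<phi> z" using G eq by simp
  have "isCont \<phi>' z" using c by (simp add: continuous_on_eq_continuous_at)
  then show "isCont (gradient \<phi>) z" unfolding eq D_def by (intro continuous_intros)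
qed

lemma cont_differentiable_component:
  fixes \<phi> :: "'z::euclidean_space \<Rightarrow> real ^ 'k"
  assumes "cont_differentiable \<phi>"
  shows "cont_differentiable (\<lambda>z. \<phi> z $ k)"
proof -
  obtain \<phi>' where d: "\<And>z. (\<phi> has_derivative blinfun_apply (\<phi>' z)) (at z)" and c: "continuous_on UNIV \<phi>'"
    using assms unfolding cont_differentiable_def by blast
  define P where "P = Blinfun (\<lambda>x::real^'k. x $ k)"
  have P: "blinfun_apply P = (\<lambda>x. x $ k)"
    unfolding P_def by (rule bounded_linear_Blinfun_apply) (rule bounded_linear_vec_nth)
  have "((\<lambda>z. \<phi> z $ k) has_derivative blinfun_apply (P o\<^sub>L \<phi>' z)) (at z)" for z
  proof -
    have "blinfun_apply (P o\<^sub>L \<phi>' z) = (\<lambda>h. blinfun_apply (\<phi>' z) h $ k)" by (simp add: fun_eq_iff P)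
    then show ?thesis using bounded_linear.has_derivative[OF bounded_linear_vec_nth d] by simp
  qed
  moreover have "continuous_on UNIV (\<lambda>z. P o\<^sub>L \<phi>' z)" using c by (intro continuous_intros)
  ultimately show ?thesis
    unfolding cont_differentiable_def by (intro exI[of _ "\<lambda>z. P o\<^sub>L \<phi>' z"]) blast
qed

lemma GDERIV_vec:
  fixes \<phi> :: "'z::euclidean_space \<Rightarrow> real ^ 'k"
  assumes "\<And>k. GDERIV (\<lambda>z. \<phi> z $ k) z :> D k"
  shows "frechet_derivative \<phi> (at z) w = (\<chi> k. D k \<bullet> w)" and "jac_tr \<phi> z \<nu> = comb D \<nu>"
proof -
  have "(\<phi> has_derivative (\<lambda>h. \<chi> k. h \<bullet> D k)) (at z)"
    unfolding has_derivative_componentwise_within[of \<phi>]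
    using assms by (auto simp: gderiv_def Basis_vec_def inner_axis)
  then have eq: "frechet_derivative \<phi> (at z) = (\<lambda>h. \<chi> k. h \<bullet> D k)"
    by (rule frechet_derivative_at[symmetric])
  then show "frechet_derivative \<phi> (at z) w = (\<chi> k. D k \<bullet> w)" by (simp add: inner_commute)
  have "adjoint (\<lambda>h. \<chi> k. h \<bullet> D k) = comb D"
    by (rule adjoint_unique)
      (simp add: inner_vec_def comb_def inner_sum_right inner_commute mult.commute)
  then show "jac_tr \<phi> z \<nu> = comb D \<nu>" by (simp add: jac_tr_def eq)
qed

lemma GDERIV_frechet: "GDERIV \<phi> z :> D \<Longrightarrow> frechet_derivative \<phi> (at z) w = D \<bullet> w"
  unfolding gderiv_def using frechet_derivative_at[of \<phi> "\<lambda>h. h \<bullet> D" z] by (simp add: inner_commute) (metis inner_commute)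

lemma grad_xy_eq:
  fixes \<phi> :: "'a::euclidean_space \<times> 'b::euclidean_space \<Rightarrow> real"
  assumes "GDERIV \<phi> z :> D"
  shows "grad_x \<phi> z = fst D" and "grad_y \<phi> z = snd D"
  using assms unfolding grad_x_def grad_y_def
  by (auto intro!: gradient_eqI GDERIV_slice_fst GDERIV_slice_snd)

lemma jac_xy_tr_eq:
  fixes \<phi> :: "'a::euclidean_space \<times> 'b::euclidean_space \<Rightarrow> real ^ 'k"
  assumes "\<And>k. GDERIV (\<lambda>z. \<phi> z $ k) z :> D k"
  shows "jac_x_tr \<phi> z \<nu> = fst (comb D \<nu>)" and "jac_y_tr \<phi> z \<nu> = snd (comb D \<nu>)"
  unfolding jac_x_tr_def jac_y_tr_def fst_comb snd_comb
  using assms by (auto intro!: GDERIV_vec GDERIV_slice_fst GDERIV_slice_snd)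

text \<open>RCR regularity speaks of the dimension of an image set, which ignores repetitions.
  Comparing it with the cardinality of \<open>J\<close> detects them: full dimension forces
  \<open>A\<close> to be injective on \<open>J\<close>.\<close>

lemma indep_family_iff_dim:
  fixes A :: "'i::finite \<Rightarrow> 'b::euclidean_space"
  shows "indep_family A J \<longleftrightarrow> dim (A ` J) = card J"
proof
  assume ind: "indep_family A J"
  have coeff: "\<forall>j\<in>J. c j = 0" if "(\<Sum>j\<in>J. c j *\<^sub>R A j) = 0" for c
  proof -
    define e where "e = (\<chi> i. if i \<in> J then c i else 0)"
    have "comb A e = (\<Sum>i\<in>UNIV. if i \<in> J then c i *\<^sub>R A i else 0)"
      unfolding comb_def e_def by (intro sum.cong) auto
    also have "\<dots> = (\<Sum>j\<in>J. c j *\<^sub>R A j)" by (simp add: sum.If_cases)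
    finally have "e = 0" using ind that unfolding indep_family_def by (simp add: e_def)
    then show ?thesis by (auto simp: e_def vec_eq_iff split: if_splits)
  qed
  have inj: "inj_on A J"
  proof (rule inj_onI, rule ccontr)
    fix i j assume ij: "i \<in> J" "j \<in> J" "A i = A j" "i \<noteq> j"
    let ?c = "\<lambda>k. (if k = i then 1 else 0) - (if k = j then 1 else 0 :: real)"
    have "(\<Sum>k\<in>J. ?c k *\<^sub>R A k) = (\<Sum>k\<in>J. (if k = i then A k else 0) - (if k = j then A k else 0))"
      by (intro sum.cong) auto
    also have "\<dots> = 0" using ij by (simp add: sum_subtractf)
    finally show False using coeff[of ?c] ij by auto
  qed
  have "independent (A ` J)"
  proof (rule independent_if_scalars_zero)
    fix c a assume "(\<Sum>a\<in>A ` J. c a *\<^sub>R a) = 0" "a \<in> A ` J"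
    then show "c a = 0" using coeff[of "c \<circ> A"] by (auto simp: sum.reindex[OF inj])
  qed simp
  then show "dim (A ` J) = card J" using card_image[OF inj] by (simp add: dim_eq_card_independent)
next
  assume dim: "dim (A ` J) = card J"
  have "card J \<le> card (A ` J)" using dim_le_card'[of "A ` J"] dim by simp
  then have inj: "inj_on A J" using card_image_le[of J A] by (intro eq_card_imp_inj_on) auto
  then have ind: "independent (A ` J)" using card_eq_dim[of "A ` J" "A ` J"] dim card_image[OF inj] span_superset[of "A ` J"] by simp
  show "indep_family A J" unfolding indep_family_def
  proof (intro allI impI, elim conjE)
    fix c :: "real^'i" assume c: "\<forall>i. i \<notin> J \<longrightarrow> c $ i = 0" "comb A c = 0"
    have "(\<Sum>a\<in>A ` J. c $ (the_inv_into J A a) *\<^sub>R a) = (\<Sum>j\<in>J. c $ j *\<^sub>R A j)"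
      by (simp add: sum.reindex[OF inj] the_inv_into_f_f[OF inj])
    also have "\<dots> = comb A c" unfolding comb_def using c(1) by (intro sum.mono_neutral_left) auto
    finally have "c $ (the_inv_into J A a) = 0" if "a \<in> A ` J" for a
      using independentD[OF ind finite_imageI[OF finite] order_refl _ that] c(2) by simp
    then have "c $ j = 0" if "j \<in> J" for j using that by (force simp: the_inv_into_f_f[OF inj])
    then show "c = 0" using c(1) by (auto simp: vec_eq_iff)
  qed
qed

lemma rcr_regular_constant_rank:
  fixes g :: "'a::euclidean_space \<times> 'b::euclidean_space \<Rightarrow> real ^ 'p"
  assumes "rcr_regular g z0" and Dg: "\<And>z i. GDERIV (\<lambda>z. g z $ i) z :> Dg z i"
  shows "\<forall>\<^sub>F z in nhds z0. \<forall>J\<subseteq>active g z0.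
      indep_family (\<lambda>i. snd (Dg z i)) J \<longleftrightarrow> indep_family (\<lambda>i. snd (Dg z0 i)) J"
proof -
  obtain \<delta> where \<delta>: "\<delta> > 0" "\<forall>K\<subseteq>active g z0. \<exists>r. \<forall>z'\<in>ball z0 \<delta>. dim ((\<lambda>j. grad_y (\<lambda>z. g z $ j) z') ` K) = r"
    using assms(1) unfolding rcr_regular_def by blast
  have "indep_family (\<lambda>i. snd (Dg z i)) J \<longleftrightarrow> indep_family (\<lambda>i. snd (Dg z0 i)) J"
    if "z \<in> ball z0 \<delta>" "J \<subseteq> active g z0" for z J
  proof -
    have "dim ((\<lambda>j. snd (Dg z j)) ` J) = dim ((\<lambda>j. snd (Dg z0 j)) ` J)"
      using \<delta>(2)[rule_format, OF that(2)] that(1) \<delta>(1) unfolding grad_xy_eq(2)[OF Dg] by (metis centre_in_ball)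
    then show ?thesis by (simp add: indep_family_iff_dim)
  qed
  then show ?thesis unfolding eventually_nhds_ball using \<delta>(1) by blast
qed

text \<open>If no cone worked, points from cones of radius 1/(n+1) would form a directional sequence
  without solutions near \<open>y\<close>.\<close>

lemma dir_inner_semicontinuous_dcone:
  fixes S :: "'a::real_normed_vector \<Rightarrow> 'b::metric_space set"
  assumes isc: "dir_inner_semicontinuous S x y u" and "\<eta> > 0"
  shows "\<exists>\<epsilon>>0. \<forall>h\<in>dcone u \<epsilon>. \<exists>y'\<in>S (x + h). dist y' y < \<eta>"
proof (rule ccontr)
  assume neg: "\<not> ?thesis"
  have "\<exists>h. h \<in> dcone u (1 / (real n + 1)) \<and> (\<forall>y'\<in>S (x + h). \<not> dist y' y < \<eta>)" for n :: nat
  proof -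
    have "1 / (real n + 1) > 0" by simp
    with neg show ?thesis by blast
  qed
  then obtain h where h: "\<And>n. h n \<in> dcone u (1 / (real n + 1))" "\<And>n y'. y' \<in> S (x + h n) \<Longrightarrow> \<not> dist y' y < \<eta>"
    by metis
  obtain t w where tw: "\<And>k. h k = t k *\<^sub>R w k" "\<And>k. 0 < t k" "t \<longlonglongrightarrow> 0" "w \<longlonglongrightarrow> u"
    by (rule dcone_sequence[OF h(1)]) (rule that)
  obtain yk where yk: "\<forall>\<^sub>F k in sequentially. yk k \<in> S (x + t k *\<^sub>R w k)" "yk \<longlonglongrightarrow> y"
    using isc tw(2,3,4) unfolding dir_inner_semicontinuous_def by blast
  from yk(1) tendstoD[OF yk(2) \<open>\<eta> > 0\<close>] have "\<forall>\<^sub>F k in sequentially. False"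
    by eventually_elim (use h(2) tw(1) in auto)
  then show False by simp
qed

text \<open>\<open>dir_nbhd\<close> contains 0 and is a full ball for u = 0, whereas
  \<open>dcone\<close> restricts scale and direction separately. This inclusion carries the
  Lipschitz estimate over to the official neighbourhoods.\<close>

lemma dir_nbhd_subset_dcone:
  assumes "\<epsilon> > 0"
  shows "\<exists>\<epsilon>'>0. \<exists>\<delta>>0. dir_nbhd \<epsilon>' \<delta> u \<subseteq> insert 0 (dcone u \<epsilon>)"
proof (cases "u = 0")
  case True
  \<comment> \<open>For u = 0 a fixed scale will do: t = \<epsilon>/2 and direction 2z/\<epsilon>,
    of norm below \<epsilon>.\<close>
  have "dir_nbhd (\<epsilon> * \<epsilon> / 2) 1 u \<subseteq> insert 0 (dcone u \<epsilon>)"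
  proof
    fix z assume "z \<in> dir_nbhd (\<epsilon> * \<epsilon> / 2) 1 u"
    then have "norm z < \<epsilon> * \<epsilon> / 2" by (simp add: dir_nbhd_def)
    then have "norm ((2 / \<epsilon>) *\<^sub>R z) < \<epsilon>" using assms by (simp add: field_simps)
    then show "z \<in> insert 0 (dcone u \<epsilon>)" unfolding dcone_def using assms True
      by (intro insertI2 CollectI exI[of _ "\<epsilon> / 2"] exI[of _ "(2 / \<epsilon>) *\<^sub>R z"]) auto
  qed
  moreover have "\<epsilon> * \<epsilon> / 2 > 0" using assms by simp
  ultimately show ?thesis using zero_less_one by blast
next
  case False
  have "dir_nbhd (\<epsilon> * norm u) (\<epsilon> / (2 * norm u)) u \<subseteq> insert 0 (dcone u \<epsilon>)"
  proof
    fix z assume z: "z \<in> dir_nbhd (\<epsilon> * norm u) (\<epsilon> / (2 * norm u)) u"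
    then have z1: "norm z < \<epsilon> * norm u" and z2: "norm (norm u *\<^sub>R z - norm z *\<^sub>R u) \<le> \<epsilon> / (2 * norm u) * norm z * norm u"
      by (auto simp: dir_nbhd_def)
    show "z \<in> insert 0 (dcone u \<epsilon>)"
    proof (cases "z = 0")
      case nz: False
      \<comment> \<open>The scale at which z/t has the norm of \<open>u\<close>; the aperture
        inequality then bounds its distance to \<open>u\<close> by \<epsilon>/2.\<close>
      define t where "t = norm z / norm u"
      have t: "0 < t" "t < \<epsilon>" using nz False z1 by (auto simp: t_def pos_divide_less_eq)
      have "(1 / t) *\<^sub>R z - u = (1 / norm z) *\<^sub>R (norm u *\<^sub>R z - norm z *\<^sub>R u)"
        using nz False by (simp add: t_def algebra_simps)
      then have "norm ((1 / t) *\<^sub>R z - u) = norm (norm u *\<^sub>R z - norm z *\<^sub>R u) / norm z" by simp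
      also have "\<dots> \<le> \<epsilon> / 2" using z2 nz False by (simp add: pos_divide_le_eq)
      also have "\<dots> < \<epsilon>" using assms by simp
      finally show ?thesis unfolding dcone_def using t
        by (intro insertI2 CollectI exI[of _ t] exI[of _ "(1 / t) *\<^sub>R z"]) auto
    qed simp
  qed
  moreover have "\<epsilon> * norm u > 0" "\<epsilon> / (2 * norm u) > 0" using assms False by auto
  ultimately show ?thesis by blast
qed

lemma comb_sum_type:
  fixes c :: "real ^ ('k::finite + 'l::finite)"
  shows "comb (case_sum A B) c = comb A (\<chi> i. c $ Inl i) + comb B (\<chi> j. c $ Inr j)"
  using sum.Plus[of UNIV UNIV "\<lambda>k. c $ k *\<^sub>R case_sum A B k"] by (simp add: comb_def)

lemma nonneg_complementarity:
  fixes c w :: "real ^ 'k"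
  assumes "\<And>i. 0 \<le> c $ i" and "\<And>i. 0 < c $ i \<Longrightarrow> w $ i = 0"
  shows "c \<bullet> w = 0"
proof -
  have "c $ i * w $ i = 0" for i using assms(1)[of i] assms(2)[of i] by (cases "c $ i = 0") auto
  then show ?thesis by (simp only: inner_vec_def inner_real_def sum.neutral_const)
qed

lemma inner_nonpos_eq_0_iff:
  fixes c w :: "real ^ 'k"
  assumes "\<And>i. 0 \<le> c $ i" and "\<And>i. w $ i \<le> 0"
  shows "w \<bullet> c = 0 \<longleftrightarrow> (\<forall>i. c $ i * w $ i = 0)"
proof -
  have "w \<bullet> c = 0 \<longleftrightarrow> (\<Sum>i\<in>UNIV. - (c $ i * w $ i)) = 0"
    by (simp add: inner_vec_def sum_negf mult.commute)
  also have "\<dots> \<longleftrightarrow> (\<forall>i. c $ i * w $ i = 0)"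
    using assms by (subst sum_nonneg_eq_0_iff) (auto simp: mult_nonneg_nonpos)
  finally show ?thesis .
qed

context regular_lower_level
begin

lemma multipliers_eq_mult: "multipliers f g z0 = mult z0"
proof -
  have "lagrangian f g lam = lag lam" for lam
    by (simp add: fun_eq_iff lagrangian_def lag_def inner_vec_def mult.commute)
  then have "grad_y (lagrangian f g lam) z0 = snd (DL lam z0)" for lam
    using grad_xy_eq(2)[OF GDERIV_lag] by metis
  then show ?thesis
    unfolding multipliers_def mult_def
    using inner_nonpos_eq_0_iff[OF _ g0_le] by (auto simp: less_eq_vec_def)
qed

lemma grad_x_lagrangian: "grad_x (lagrangian f g lam) z = fst (DL lam z)"
proof -
  have "lagrangian f g lam = lag lam"
    by (simp add: fun_eq_iff lagrangian_def lag_def inner_vec_def mult.commute)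
  then show ?thesis using grad_xy_eq(1)[OF GDERIV_lag] by metis
qed

end

section \<open>Transfer to the extended real valued value function\<close>

context directional_lower_level
begin

lemma val_fun_real: "S x \<noteq> {} \<Longrightarrow> val_fun f g x = ereal (V x)"
  using val_fun_sol real_val_sol by (metis all_not_in_conv)

lemma dir_lipschitz_val_fun: "dir_lipschitz (val_fun f g) x0 u"
proof -
  obtain L \<epsilon> where L: "L > 0" "\<epsilon> > 0" "\<forall>h\<in>insert 0 (dcone u \<epsilon>). S (x0 + h) \<noteq> {} \<and>
     (\<forall>h'\<in>insert 0 (dcone u \<epsilon>). \<bar>V (x0 + h) - V (x0 + h')\<bar> \<le> L * norm (h - h'))"
    using real_val_lipschitz by blast
  obtain \<epsilon>' \<delta> where nb: "\<epsilon>' > 0" "\<delta> > 0" "dir_nbhd \<epsilon>' \<delta> u \<subseteq> insert 0 (dcone u \<epsilon>)"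
    using dir_nbhd_subset_dcone[OF L(2), of u] by blast
  have val: "val_fun f g (x0 + h) = ereal (V (x0 + h))" if "h \<in> dir_nbhd \<epsilon>' \<delta> u" for h
    using L(3) nb(3) that by (intro val_fun_real) blast
  have lip: "\<bar>V (x0 + h) - V (x0 + h')\<bar> \<le> L * norm (h - h')" if "h \<in> dir_nbhd \<epsilon>' \<delta> u" "h' \<in> dir_nbhd \<epsilon>' \<delta> u" for h h'
    using L(3) nb(3) that by blast
  show ?thesis unfolding dir_lipschitz_def
    by (intro exI[of _ L] exI[of _ \<epsilon>'] exI[of _ \<delta>] conjI L nb) (auto simp: val lip)
qed

lemma dir_quotient_val_fun:
  assumes "((\<lambda>t. (V (x0 + t *\<^sub>R u) - V x0) / t) \<longlongrightarrow> m) (at_right 0)"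
  shows "(dir_quotient (val_fun f g) x0 u \<longlongrightarrow> ereal m) (at_right 0)"
proof -
  obtain L \<epsilon> where L: "L > 0" "\<epsilon> > 0" "\<forall>h\<in>insert 0 (dcone u \<epsilon>). S (x0 + h) \<noteq> {} \<and>
     (\<forall>h'\<in>insert 0 (dcone u \<epsilon>). \<bar>V (x0 + h) - V (x0 + h')\<bar> \<le> L * norm (h - h'))"
    using real_val_lipschitz by blast
  have "\<forall>\<^sub>F t in at_right 0. ereal ((V (x0 + t *\<^sub>R u) - V x0) / t) = dir_quotient (val_fun f g) x0 u t"
    using eventually_at_right_real[OF L(2)]
  proof eventually_elim
    case (elim t)
    then have "t *\<^sub>R u \<in> dcone u \<epsilon>" using L(2) unfolding dcone_def
      by (intro CollectI exI[of _ t] exI[of _ u]) auto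
    then have "S (x0 + t *\<^sub>R u) \<noteq> {}" using L(3) by blast
    moreover have "S x0 \<noteq> {}" using sol0 by blast
    ultimately show ?case using elim by (simp add: dir_quotient_def val_fun_real)
  qed
  then show ?thesis using tendsto_ereal[OF assms] by (rule Lim_transform_eventually[rotated])
qed

lemma dir_deriv_val_fun:
  assumes "((\<lambda>t. (V (x0 + t *\<^sub>R u) - V x0) / t) \<longlongrightarrow> m) (at_right 0)"
  shows "dir_deriv (val_fun f g) x0 u = ereal m"
  unfolding dir_deriv_def using dir_quotient_val_fun[OF assms] by (intro tendsto_Lim) auto

end

theorem theorem5p4:
  fixes F f :: "(real ^ 'n) \<times> (real ^ 'm) \<Rightarrow> real"
    and G :: "(real ^ 'n) \<times> (real ^ 'm) \<Rightarrow> real ^ 'q"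
    and g :: "(real ^ 'n) \<times> (real ^ 'm) \<Rightarrow> real ^ 'p"
    and x u :: "real ^ 'n"
    and y :: "real ^ 'm"
  assumes "cont_differentiable F"
    and "cont_differentiable f"
    and "cont_differentiable G"
    and "cont_differentiable g"
    and "bp_local_minimizer F f G g (x, y)"
    and "rcr_regular g (x, y)"
    and "dir_inner_semicontinuous (sol_map f g) x y u"
  shows
    "dir_lipschitz (val_fun f g) x u \<and>
     dir_differentiable (val_fun f g) x u \<and>
     (\<exists>lam\<in>multipliers f g (x, y).
        dir_deriv (val_fun f g) x u = ereal (grad_x (lagrangian f g lam) (x, y) \<bullet> u) \<and>
        (\<forall>\<mu>\<in>multipliers f g (x, y).
           grad_x (lagrangian f g \<mu>) (x, y) \<bullet> u \<le> grad_x (lagrangian f g lam) (x, y) \<bullet> u)) \<and>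
     (\<forall>v. (u, v) \<in> critical_cone F f G g (x, y) \<and>
        \<not> (\<exists>(\<alpha>::real) (\<nu>g :: real ^ 'p) (\<nu>G :: real ^ 'q).
             (\<alpha>, \<nu>g, \<nu>G) \<noteq> 0 \<and>
             0 \<in> (\<lambda>w. \<alpha> *\<^sub>R gradient f (x, y) - \<alpha> *\<^sub>R (w, 0)
                       + jac_tr g (x, y) \<nu>g + jac_tr G (x, y) \<nu>G) ` W_set f g (x, y) (u, v) \<and>
             0 \<le> \<alpha> \<and>
             0 \<le> \<nu>g \<and> \<nu>g \<bullet> g (x, y) = 0 \<and>
             \<nu>g \<bullet> frechet_derivative g (at (x, y)) (u, v) = 0 \<and>
             0 \<le> \<nu>G \<and> \<nu>G \<bullet> G (x, y) = 0 \<and>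
             \<nu>G \<bullet> frechet_derivative G (at (x, y)) (u, v) = 0 \<and>
             (\<exists>t uk vk. (\<forall>k. 0 < t k) \<and> t \<longlonglongrightarrow> 0 \<and> uk \<longlonglongrightarrow> u \<and> vk \<longlonglongrightarrow> v \<and>
                (\<forall>k. let xk = x + t k *\<^sub>R uk k; yk = y + t k *\<^sub>R vk k in
                   (\<alpha> > 0 \<longrightarrow> ereal \<alpha> * (ereal (f (xk, yk)) - val_fun f g xk) > 0) \<and>
                   (\<forall>i\<in>active g (x, y). \<nu>g $ i > 0 \<longrightarrow> g (xk, yk) $ i > 0) \<and>
                   (\<forall>i\<in>active G (x, y). \<nu>G $ i > 0 \<longrightarrow> G (xk, yk) $ i > 0))))
        \<longrightarrow>
        (\<exists>(lamV::real) (lamg :: real ^ 'p) (lamG :: real ^ 'q) (lam :: real ^ 'p).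
           0 = grad_x F (x, y) - lamV *\<^sub>R jac_x_tr g (x, y) lam
               + jac_x_tr g (x, y) lamg + jac_x_tr G (x, y) lamG \<and>
           0 = grad_y F (x, y) + lamV *\<^sub>R grad_y f (x, y)
               + jac_y_tr g (x, y) lamg + jac_y_tr G (x, y) lamG \<and>
           0 \<le> lamV \<and>
           0 \<le> lamg \<and> lamg \<bullet> g (x, y) = 0 \<and>
           lamg \<bullet> frechet_derivative g (at (x, y)) (u, v) = 0 \<and>
           0 \<le> lamG \<and> lamG \<bullet> G (x, y) = 0 \<and>
           lamG \<bullet> frechet_derivative G (at (x, y)) (u, v) = 0 \<and>
           0 = grad_y f (x, y) + jac_y_tr g (x, y) lam \<and>
           0 \<le> lam \<and> lam \<bullet> g (x, y) = 0 \<and>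
           lam \<bullet> frechet_derivative g (at (x, y)) (u, v) = 0))"
proof -
  define Df where "Df = gradient f"
  define Dg where "Dg z i = gradient (\<lambda>z. g z $ i) z" for z i
  define DF where "DF = gradient F"
  define DG where "DG z j = gradient (\<lambda>z. G z $ j) z" for z j
  note grads = Df_def Dg_def DF_def DG_def
  have grad_f: "GDERIV f z :> Df z" "isCont Df z" and grad_F: "GDERIV F z :> DF z" "isCont DF z" for z
    unfolding grads using assms(1,2) by (auto intro: cont_differentiable_gradient)
  have grad_g: "GDERIV (\<lambda>z. g z $ i) z :> Dg z i" "isCont (\<lambda>z. Dg z i) z" for z i
    unfolding grads using cont_differentiable_gradient[OF cont_differentiable_component[OF assms(4)]] by auto
  have grad_G: "GDERIV (\<lambda>z. G z $ j) z :> DG z j" "isCont (\<lambda>z. DG z j) z" for z j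
    unfolding grads using cont_differentiable_gradient[OF cont_differentiable_component[OF assms(3)]] by auto
  interpret directional_lower_level f g Df Dg x y u
  proof
    show "y \<in> sol_map f g x" using assms(7) by (simp add: dir_inner_semicontinuous_def)
    show "\<forall>\<^sub>F z in nhds (x, y). \<forall>J\<subseteq>active g (x, y).
      indep_family (\<lambda>i. snd (Dg z i)) J \<longleftrightarrow> indep_family (\<lambda>i. snd (Dg (x, y) i)) J"
      by (rule rcr_regular_constant_rank[OF assms(6) grad_g(1)])
    show "\<exists>\<epsilon>>0. \<forall>h\<in>dcone u \<epsilon>. \<exists>y'\<in>sol_map f g (x + h). dist y' y < \<eta>" if "\<eta> > 0" for \<eta>
      by (rule dir_inner_semicontinuous_dcone[OF assms(7) that])
  qed (rule grad_f grad_g)+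
  obtain lam where lam: "lam \<in> mult (x, y)" "\<forall>mu\<in>mult (x, y). fst (DL mu (x, y)) \<bullet> u \<le> fst (DL lam (x, y)) \<bullet> u"
    "((\<lambda>t. (V (x + t *\<^sub>R u) - V x) / t) \<longlongrightarrow> fst (DL lam (x, y)) \<bullet> u) (at_right 0)"
    using real_val_directional_derivative by blast
  have diff: "dir_differentiable (val_fun f g) x u"
    unfolding dir_differentiable_def using dir_quotient_val_fun[OF lam(3)] by blast
  have deriv: "\<exists>lam\<in>multipliers f g (x, y).
        dir_deriv (val_fun f g) x u = ereal (grad_x (lagrangian f g lam) (x, y) \<bullet> u) \<and>
        (\<forall>\<mu>\<in>multipliers f g (x, y).
           grad_x (lagrangian f g \<mu>) (x, y) \<bullet> u \<le> grad_x (lagrangian f g lam) (x, y) \<bullet> u)"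
    unfolding multipliers_eq_mult grad_x_lagrangian using lam dir_deriv_val_fun[OF lam(3)] by blast
  have fg: "frechet_derivative g (at (x, y)) w = (\<chi> i. Dg (x, y) i \<bullet> w)" for w
    by (rule GDERIV_vec(1)[OF grad_g(1)])
  have fG: "frechet_derivative G (at (x, y)) w = (\<chi> j. DG (x, y) j \<bullet> w)" for w
    by (rule GDERIV_vec(1)[OF grad_G(1)])
  have DLx: "fst (DL mu (x, y)) = grad_x f (x, y) + jac_x_tr g (x, y) mu" for mu
    by (simp add: DL_def grad_xy_eq(1)[OF grad_f(1)] jac_xy_tr_eq(1)[OF grad_g(1)])
  \<comment> \<open>Both constraint maps form one family over the sum of their index types;
    \<open>comb_sum_type\<close> splits its multiplier again.\<close>
  define h where "h = case_sum (\<lambda>i z. g z $ i) (\<lambda>j z. G z $ j)"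
  define Dh where "Dh z = case_sum (Dg z) (DG z)" for z
  have comb_Dh: "comb (Dh z) C = comb (Dg z) (\<chi> i. C $ Inl i) + comb (DG z) (\<chi> j. C $ Inr j)" for z C
    unfolding Dh_def by (rule comb_sum_type)
  \<comment> \<open>Matching against the goal names the criticality, abnormality and stationarity
    statements as functions of \<open>v\<close>.\<close>
  let "_ \<and> _ \<and> _ \<and> (\<forall>v. ?critical v \<and> \<not> ?abnormal v \<longrightarrow> ?stationary v)" = ?thesis
  have "?stationary v" if crit: "?critical v" and qn: "\<not> ?abnormal v" for v
  proof -
    have comp: "0 \<le> (\<chi> i. C $ Inl i)" "0 \<le> (\<chi> j. C $ Inr j)"
      "(\<chi> i. C $ Inl i) \<bullet> g (x, y) = 0" "(\<chi> j. C $ Inr j) \<bullet> G (x, y) = 0"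
      "(\<chi> i. C $ Inl i) \<bullet> frechet_derivative g (at (x, y)) (u, v) = 0"
      "(\<chi> j. C $ Inr j) \<bullet> frechet_derivative G (at (x, y)) (u, v) = 0"
      if C: "\<And>k. 0 \<le> C $ k" "\<And>k. 0 < C $ k \<Longrightarrow> h k (x, y) = 0 \<and> Dh (x, y) k \<bullet> (u, v) = 0"
      for C :: "real ^ ('p + 'q)"
    proof -
      have l: "0 < C $ Inl i \<Longrightarrow> g (x, y) $ i = 0 \<and> Dg (x, y) i \<bullet> (u, v) = 0"
        and r: "0 < C $ Inr j \<Longrightarrow> G (x, y) $ j = 0 \<and> DG (x, y) j \<bullet> (u, v) = 0" for i j
        using C(2)[of "Inl i"] C(2)[of "Inr j"] by (simp_all add: h_def Dh_def)
      show "0 \<le> (\<chi> i. C $ Inl i)" "0 \<le> (\<chi> j. C $ Inr j)" using C(1) by (auto simp: less_eq_vec_def)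
      show "(\<chi> i. C $ Inl i) \<bullet> g (x, y) = 0" "(\<chi> i. C $ Inl i) \<bullet> frechet_derivative g (at (x, y)) (u, v) = 0"
        using C(1) l by (auto intro!: nonneg_complementarity simp: fg)
      show "(\<chi> j. C $ Inr j) \<bullet> G (x, y) = 0" "(\<chi> j. C $ Inr j) \<bullet> frechet_derivative G (at (x, y)) (u, v) = 0"
        using C(1) r by (auto intro!: nonneg_complementarity simp: fG)
    qed
    interpret directional_program f g Df Dg x y u F DF h Dh "bp_feasible f G g" v
    proof
      show "GDERIV F z :> DF z" "isCont DF z" for z by (rule grad_F)+
      show "GDERIV (h k) z :> Dh z k" for k z by (cases k) (simp_all add: h_def Dh_def grad_g(1) grad_G(1))
      show "isCont (\<lambda>z. Dh z k) z" for k z by (cases k) (simp_all add: Dh_def grad_g(2) grad_G(2))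
      show "z \<in> bp_feasible f G g" if z: "S (fst z) \<noteq> {}" "f z \<le> V (fst z)" "\<And>k. h k z \<le> 0" for z
      proof -
        have gz: "g z $ i \<le> 0" and Gz: "G z $ j \<le> 0" for i j
          using z(3)[of "Inl i"] z(3)[of "Inr j"] by (simp_all add: h_def)
        \<comment> \<open>Value function reformulation: a lower level feasible point whose value
          does not exceed \<open>V\<close> is optimal.\<close>
        have "snd z \<in> S (fst z)"
          using gz z(2) real_val_le[OF z(1)] by (force simp: sol_map_iff)
        then show ?thesis using Gz by (auto simp: bp_feasible_def less_eq_vec_def)
      qed
      show feas: "(x, y) \<in> bp_feasible f G g" and "\<exists>\<epsilon>>0. \<forall>z\<in>bp_feasible f G g \<inter> ball (x, y) \<epsilon>. F (x, y) \<le> F z"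
        using assms(5) by (auto simp: bp_local_minimizer_def)
      show "DF (x, y) \<bullet> (u, v) \<le> 0"
        using crit by (simp add: critical_cone_def GDERIV_frechet[OF grad_F(1)])
      have G0: "G (x, y) $ j \<le> 0" for j using feas by (simp add: bp_feasible_def less_eq_vec_def)
      show "h k (x, y) \<le> 0" for k by (cases k) (simp_all add: h_def g0_le G0)
      show Dgle: "Dg (x, y) i \<bullet> (u, v) \<le> 0" if "i \<in> active g (x, y)" for i
        using crit that by (simp add: critical_cone_def fg)
      have DGle: "DG (x, y) j \<bullet> (u, v) \<le> 0" if "j \<in> active G (x, y)" for j
        using crit that by (simp add: critical_cone_def fG)
      show "Dh (x, y) k \<bullet> (u, v) \<le> 0" if "h k (x, y) = 0" for k
        using that Dgle DGle by (cases k) (simp_all add: h_def Dh_def active_def)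
      show "Df (x, y) \<bullet> (u, v) \<le> m" if "((\<lambda>t. (V (x + t *\<^sub>R u) - V x) / t) \<longlongrightarrow> m) (at_right 0)" for m
        using crit dir_deriv_val_fun[OF that] by (simp add: critical_cone_def GDERIV_frechet[OF grad_f(1)])
    next
      fix \<alpha> :: real and C :: "real ^ ('p + 'q)" and mu and t :: "nat \<Rightarrow> real" and d
      assume mu: "mu \<in> dir_mult v" and \<alpha>: "0 \<le> \<alpha>" and C: "\<And>k. 0 \<le> C $ k" and nz: "(\<alpha>, C) \<noteq> 0"
        and eq: "\<alpha> *\<^sub>R (Df (x, y) - (fst (DL mu (x, y)), 0)) + comb (Dh (x, y)) C = 0"
        and c: "\<And>k. 0 < C $ k \<Longrightarrow> h k (x, y) = 0 \<and> Dh (x, y) k \<bullet> (u, v) = 0"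
        and t: "\<And>n. 0 < t n" "t \<longlonglongrightarrow> 0" and d: "d \<longlonglongrightarrow> (u, v)"
        and ne: "\<And>n. S (fst ((x, y) + t n *\<^sub>R d n)) \<noteq> {}"
        and pf: "\<And>n. 0 < \<alpha> \<Longrightarrow> V (fst ((x, y) + t n *\<^sub>R d n)) < f ((x, y) + t n *\<^sub>R d n)"
        and ph: "\<And>n k. 0 < C $ k \<Longrightarrow> 0 < h k ((x, y) + t n *\<^sub>R d n)"
      let ?g = "\<chi> i. C $ Inl i" and ?G = "\<chi> j. C $ Inr j"
      \<comment> \<open>Componentwise complementarity of \<open>mu\<close> sums to the orthogonality
        in W, so the x-gradient of its Lagrangian is the required element.\<close>
      have "fst (DL mu (x, y)) \<in> W_set f g (x, y) (u, v)"
      proof -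
        have "(\<Sum>i\<in>UNIV. mu $ i * (Dg (x, y) i \<bullet> (u, v))) = 0"
          using mu by (intro sum.neutral) (simp add: dir_mult_def)
        then have "mu \<in> orthogonal_comp {frechet_derivative g (at (x, y)) (u, v)}"
          by (simp add: orthogonal_comp_def orthogonal_def fg inner_vec_def mult.commute)
        then show ?thesis
          unfolding W_set_def multipliers_eq_mult DLx using mu by (auto simp: dir_mult_def)
      qed
      moreover have "0 = \<alpha> *\<^sub>R gradient f (x, y) - \<alpha> *\<^sub>R (fst (DL mu (x, y)), 0) + jac_tr g (x, y) ?g + jac_tr G (x, y) ?G"
        using eq unfolding comb_Dh GDERIV_vec(2)[OF grad_g(1)] GDERIV_vec(2)[OF grad_G(1)] Df_def
        by (simp add: scaleR_diff_right add.assoc)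
      ultimately have W: "0 \<in> (\<lambda>w. \<alpha> *\<^sub>R gradient f (x, y) - \<alpha> *\<^sub>R (w, 0)
                       + jac_tr g (x, y) ?g + jac_tr G (x, y) ?G) ` W_set f g (x, y) (u, v)"
        by blast
      have nz': "(\<alpha>, ?g, ?G) \<noteq> 0"
      proof
        assume 0: "(\<alpha>, ?g, ?G) = 0"
        have "C $ k = 0" for k using 0 by (cases k) (auto simp: prod_eq_iff vec_eq_iff)
        then show False using nz 0 by (auto simp: prod_eq_iff vec_eq_iff)
      qed
      have seq: "\<exists>t uk vk. (\<forall>k. 0 < t k) \<and> t \<longlonglongrightarrow> 0 \<and> uk \<longlonglongrightarrow> u \<and> vk \<longlonglongrightarrow> v \<and>
                (\<forall>k. let xk = x + t k *\<^sub>R uk k; yk = y + t k *\<^sub>R vk k in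
                   (\<alpha> > 0 \<longrightarrow> ereal \<alpha> * (ereal (f (xk, yk)) - val_fun f g xk) > 0) \<and>
                   (\<forall>i\<in>active g (x, y). ?g $ i > 0 \<longrightarrow> g (xk, yk) $ i > 0) \<and>
                   (\<forall>i\<in>active G (x, y). ?G $ i > 0 \<longrightarrow> G (xk, yk) $ i > 0))"
      proof (intro exI[of _ t] exI[of _ "\<lambda>n. fst (d n)"] exI[of _ "\<lambda>n. snd (d n)"] conjI allI)
        show "(\<lambda>n. fst (d n)) \<longlonglongrightarrow> u" "(\<lambda>n. snd (d n)) \<longlonglongrightarrow> v"
          using tendsto_fst[OF d] tendsto_snd[OF d] by simp_all
        fix n
        have zn: "(x, y) + t n *\<^sub>R d n = (x + t n *\<^sub>R fst (d n), y + t n *\<^sub>R snd (d n))" by (simp add: prod_eq_iff)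
        have "val_fun f g (x + t n *\<^sub>R fst (d n)) = ereal (V (x + t n *\<^sub>R fst (d n)))"
          using ne[of n] by (intro val_fun_real) simp
        then show "let xk = x + t n *\<^sub>R fst (d n); yk = y + t n *\<^sub>R snd (d n) in
                   (\<alpha> > 0 \<longrightarrow> ereal \<alpha> * (ereal (f (xk, yk)) - val_fun f g xk) > 0) \<and>
                   (\<forall>i\<in>active g (x, y). ?g $ i > 0 \<longrightarrow> g (xk, yk) $ i > 0) \<and>
                   (\<forall>i\<in>active G (x, y). ?G $ i > 0 \<longrightarrow> G (xk, yk) $ i > 0)"
          using pf[of n] ph[of "Inl _" n] ph[of "Inr _" n] unfolding zn by (simp add: Let_def h_def)
      qed (use t in auto)
      show False using qn nz' W \<alpha> comp[OF C c] seq by blast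
    qed
    obtain mu \<alpha> C where mu: "mu \<in> dir_mult v" and \<alpha>: "0 \<le> \<alpha>" and C: "\<And>k. 0 \<le> C $ k"
      and c: "\<And>k. 0 < C $ k \<Longrightarrow> h k (x, y) = 0 \<and> Dh (x, y) k \<bullet> (u, v) = 0"
      and eq: "DF (x, y) + \<alpha> *\<^sub>R (Df (x, y) - (fst (DL mu (x, y)), 0)) + comb (Dh (x, y)) C = 0"
      using directional_stationarity by blast
    have mu': "mu \<in> multipliers f g (x, y)" "snd (DL mu (x, y)) = 0" "\<And>i. mu $ i * (Dg (x, y) i \<bullet> (u, v)) = 0"
      using mu unfolding multipliers_eq_mult by (auto simp: dir_mult_def mult_def)
    note eqs = grad_xy_eq[OF grad_F(1)] grad_xy_eq[OF grad_f(1)] jac_xy_tr_eq[OF grad_g(1)] jac_xy_tr_eq[OF grad_G(1)]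
    show ?thesis
    proof (rule exI[of _ \<alpha>], rule exI[of _ "\<chi> i. C $ Inl i"], rule exI[of _ "\<chi> j. C $ Inr j"], rule exI[of _ mu],
        intro conjI comp[OF C c] \<alpha>)
      \<comment> \<open>In the x-component the gradient of \<open>f\<close> cancels against the one
        in the Lagrangian, leaving minus \<alpha> times the constraint term of \<open>mu\<close>; in
        the y-component the zero entry leaves \<alpha> times the gradient of
        \<open>f\<close>.\<close>
      show "0 = grad_x F (x, y) - \<alpha> *\<^sub>R jac_x_tr g (x, y) mu
               + jac_x_tr g (x, y) (\<chi> i. C $ Inl i) + jac_x_tr G (x, y) (\<chi> j. C $ Inr j)"
        using arg_cong[OF eq, of fst] unfolding eqs comb_Dh by (simp add: DL_def algebra_simps)
      show "0 = grad_y F (x, y) + \<alpha> *\<^sub>R grad_y f (x, y)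
               + jac_y_tr g (x, y) (\<chi> i. C $ Inl i) + jac_y_tr G (x, y) (\<chi> j. C $ Inr j)"
        using arg_cong[OF eq, of snd] unfolding eqs comb_Dh by (simp add: algebra_simps)
      show "0 = grad_y f (x, y) + jac_y_tr g (x, y) mu" using mu'(2) unfolding eqs by (simp add: DL_def)
      show "0 \<le> mu" "mu \<bullet> g (x, y) = 0" using mu'(1) by (auto simp: multipliers_def inner_commute)
      show "mu \<bullet> frechet_derivative g (at (x, y)) (u, v) = 0"
        by (simp only: fg inner_vec_def inner_real_def vec_lambda_beta mu'(3) sum.neutral_const)
    qed
  qed
  then show ?thesis using dir_lipschitz_val_fun diff deriv by blast
qed

end
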